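(* Let $F$ be a countable field. For every real number $d\geq 8$ there exists a finitely generated nil associative $F$-algebra of Gelfand-Kirillov dimension $d$.
   Context: Algebras are associative over the field $F$ and are not assumed to have an identity. An algebra is nil if each of its elements is nilpotent. Gelfand-Kirillov dimension of a finitely generated algebra: if $R$ is generated by a finite dimensional subspace $V$, let $V^n=\mathrm{span}_F(v_1\cdots v_k \mid k\le n,\ v_i\in V)$ and $g_R(n)=\dim_F V^n$. Write $f_1\preceq f_2$ if there is $c\in\mathbb N$ with $f_1(n)\le c f_2(cn)$ for all $n$. Then $\mathrm{GKdim}(R)=\inf\{\alpha>0\mid g_R(n)\preceq n^\alpha\}$ ($=\infty$ if there is no such $\alpha$); this does not depend on $V$. *)

theory Defs
  imports "Jordan_Normal_Form.Missing_VectorSpace" "HOL-Library.Extended_Real"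
    "HOL-Library.Countable_Set"
begin

text \<open>
  Associative algebras over a field, not assumed to have an identity.  The record type of modules
  is reused for its multiplication; nothing is assumed about its \<open>one\<close> field, which is never used.
\<close>

locale nonunital_algebra = vectorspace K A for K and A (structure) +
  assumes mult_closed:
      "\<lbrakk>x \<in> carrier A; y \<in> carrier A\<rbrakk> \<Longrightarrow> x \<otimes>\<^bsub>A\<^esub> y \<in> carrier A"
    and mult_assoc:
      "\<lbrakk>x \<in> carrier A; y \<in> carrier A; z \<in> carrier A\<rbrakk>
        \<Longrightarrow> (x \<otimes>\<^bsub>A\<^esub> y) \<otimes>\<^bsub>A\<^esub> z = x \<otimes>\<^bsub>A\<^esub> (y \<otimes>\<^bsub>A\<^esub> z)"
    and mult_l_distr:
      "\<lbrakk>x \<in> carrier A; y \<in> carrier A; z \<in> carrier A\<rbrakk>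
        \<Longrightarrow> (x \<oplus>\<^bsub>A\<^esub> y) \<otimes>\<^bsub>A\<^esub> z = x \<otimes>\<^bsub>A\<^esub> z \<oplus>\<^bsub>A\<^esub> y \<otimes>\<^bsub>A\<^esub> z"
    and mult_r_distr:
      "\<lbrakk>x \<in> carrier A; y \<in> carrier A; z \<in> carrier A\<rbrakk>
        \<Longrightarrow> z \<otimes>\<^bsub>A\<^esub> (x \<oplus>\<^bsub>A\<^esub> y) = z \<otimes>\<^bsub>A\<^esub> x \<oplus>\<^bsub>A\<^esub> z \<otimes>\<^bsub>A\<^esub> y"
    and smult_mult_left:
      "\<lbrakk>c \<in> carrier K; x \<in> carrier A; y \<in> carrier A\<rbrakk>
        \<Longrightarrow> (c \<odot>\<^bsub>A\<^esub> x) \<otimes>\<^bsub>A\<^esub> y = c \<odot>\<^bsub>A\<^esub> (x \<otimes>\<^bsub>A\<^esub> y)"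
    and smult_mult_right:
      "\<lbrakk>c \<in> carrier K; x \<in> carrier A; y \<in> carrier A\<rbrakk>
        \<Longrightarrow> x \<otimes>\<^bsub>A\<^esub> (c \<odot>\<^bsub>A\<^esub> y) = c \<odot>\<^bsub>A\<^esub> (x \<otimes>\<^bsub>A\<^esub> y)"

text \<open>The relation \<open>f\<^sub>1 \<preceq> f\<^sub>2\<close> between growth functions.\<close>

definition growth_le :: "(nat \<Rightarrow> real) \<Rightarrow> (nat \<Rightarrow> real) \<Rightarrow> bool" where
  "growth_le f1 f2 \<longleftrightarrow> (\<exists>c::nat. \<forall>n. f1 n \<le> real c * f2 (c * n))"

context nonunital_algebra
begin

text \<open>The product \<open>v v\<^sub>1 \<dots> v\<^sub>k\<close>; without an identity, products have at least one factor.\<close>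

definition product :: "'c \<Rightarrow> 'c list \<Rightarrow> 'c" where
  "product v xs = foldl (\<lambda>x y. x \<otimes>\<^bsub>A\<^esub> y) v xs"

text \<open>\<open>product x (replicate k x)\<close> is the power of \<open>x\<close> with exponent \<open>k + 1\<close>.\<close>

definition nilpotent_elem :: "'c \<Rightarrow> bool" where
  "nilpotent_elem x \<longleftrightarrow> (\<exists>k. product x (replicate k x) = \<zero>\<^bsub>A\<^esub>)"

definition nil_algebra :: bool where
  "nil_algebra \<longleftrightarrow> (\<forall>x\<in>carrier A. nilpotent_elem x)"

definition is_subalgebra :: "'c set \<Rightarrow> bool" where
  "is_subalgebra B \<longleftrightarrow> VectorSpace.subspace K B A \<and> (\<forall>x\<in>B. \<forall>y\<in>B. x \<otimes>\<^bsub>A\<^esub> y \<in> B)"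

definition generated_by :: "'c set \<Rightarrow> bool" where
  "generated_by X \<longleftrightarrow>
     X \<subseteq> carrier A \<and> (\<forall>B. is_subalgebra B \<and> X \<subseteq> B \<longrightarrow> B = carrier A)"

definition finitely_generated :: bool where
  "finitely_generated \<longleftrightarrow> (\<exists>X. finite X \<and> generated_by X)"

text \<open>The subspace \<open>V\<^sup>n\<close> spanned by the products of at least one and at most \<open>n\<close> elements of \<open>V\<close>.\<close>

definition power_space :: "'c set \<Rightarrow> nat \<Rightarrow> 'c set" where
  "power_space V n =
     span {product v xs | v xs. v \<in> V \<and> set xs \<subseteq> V \<and> Suc (length xs) \<le> n}"

definition growth :: "'c set \<Rightarrow> nat \<Rightarrow> nat" where
  "growth V n = vectorspace.dim K (vs (power_space V n))"

definition fin_dim_generating_space :: "'c set \<Rightarrow> bool" where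
  "fin_dim_generating_space V \<longleftrightarrow>
     VectorSpace.subspace K V A \<and> vectorspace.fin_dim K (vs V) \<and> generated_by V"

definition GKdim_wrt :: "'c set \<Rightarrow> ereal" where
  "GKdim_wrt V =
     Inf {ereal \<alpha> | \<alpha>. \<alpha> > 0 \<and> growth_le (\<lambda>n. real (growth V n)) (\<lambda>n. real n powr \<alpha>)}"

text \<open>
  The Gelfand-Kirillov dimension, meaningful for finitely generated algebras; the value does not
  depend on the choice of the generating space.
\<close>

definition GKdim :: ereal where
  "GKdim = GKdim_wrt (SOME V. fin_dim_generating_space V)"

end

end

theory Submission
imports Defs "HOL-Library.Poly_Mapping" "HOL-Real_Asymp.Real_Asymp"
begin

text \<open>
Let \<open>L\<close> be a set of functions on words, closed under \<open>g \<mapsto> g (u @ _ @ v)\<close>. The elements \<open>r\<close> of a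
free algebra with \<open>\<Sum>\<^sub>w r(w) g(w) = 0\<close> for all \<open>g \<in> L\<close> form an ideal. If every member of \<open>L\<close> lives
on words of a single length, then the quotient has in length \<open>n\<close> the dimension of the span of
\<open>L\<close> on the words of length \<open>n\<close>. So a nil algebra of slow growth amounts to a set \<open>L\<close> of small rank
that annihilates some power of every element. The proof finds one over two letters, of
growth at most \<open>n\<^sup>4\<close>, and then adds a third letter to adjust the exponent.

\<^bold>\<open>Two letters.\<close> As the field is countable, the elements of the free algebra without constant
term can be listed as \<open>f\<^sub>0, f\<^sub>1, \<dots>\<close>. A tower of functions is built; level \<open>i\<close> has two functions
\<open>\<phi>\<^sub>i False\<close> and \<open>\<phi>\<^sub>i True\<close> on binary words of length \<open>l\<^sub>i\<close>. Level \<open>i + 1\<close> consists of two tensor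
products: \<open>K\<^sub>i\<close> copies of \<open>\<phi>\<^sub>i False\<close>, followed by a linear combination of the \<open>2\<^sup>T\<close> products of
\<open>T = T\<^sub>i\<close> functions of level \<open>i\<close>. The \<open>2\<^sup>T\<close> coefficients are chosen so that the second part
annihilates every window of length \<open>l\<^sub>i T\<close> of every power of \<open>f\<^sub>i\<close>. This is possible because all
these windows lie, up to shorter words, in the span of the products \<open>(z\<inverse>f\<^sub>i) f\<^sub>i\<^sup>q (f\<^sub>i z'\<inverse>)\<close>,
where \<open>z\<inverse>\<close> removes a prefix \<open>z\<close> from the words starting with it (\<open>window_two_sided\<close>), so that the
number of conditions is only linear in \<open>l\<^sub>i T\<close> (\<open>annihilating_block_sum\<close>). Every window of length
\<open>2 l\<^sub>i\<^sub>+\<^sub>1\<close> of a function of a higher level contains a complete block of level \<open>i + 1\<close>; hence the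
windows of all levels annihilate a power of \<open>f\<^sub>i\<close> (\<open>power_annihilated\<close>).

The growth is controlled because the padding by \<open>\<phi>\<^sub>i False\<close> makes the blocks longer without
adding to their rank: the prefixes and suffixes of level \<open>i\<close> have rank at most \<open>\<sigma>\<^sub>i\<close>, independent
of the choice of \<open>K\<^sub>i\<^sub>-\<^sub>1\<close>, and the windows of length \<open>m\<close> with \<open>l\<^sub>i < m \<le> l\<^sub>i\<^sub>+\<^sub>1\<close> have rank at most
\<open>3 m \<sigma>\<^sub>i\<^sup>2 2\<^sup>T\<close> (\<open>spanned_on_padded_windows\<close>). If \<open>l\<^sub>i\<close> is large, then \<open>T\<close> can be chosen with
\<open>4 \<sigma>\<^sub>i\<^sup>2 2\<^sup>T \<le> l\<^sub>i\<^sup>2\<close> and \<open>2\<^sup>T\<close> still greater than the number of conditions (\<open>exponent_choice\<close>). The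
rank in length \<open>m\<close> is then \<open>O(m\<^sup>3)\<close>, and the number \<open>H(n)\<close> of dimensions up to length \<open>n\<close> is \<open>O(n\<^sup>4)\<close>.

\<^bold>\<open>The third letter.\<close> The letter \<open>2\<close> serves as a separator. The new functions are products
\<open>g(u) e\<^sub>j\<^sub>1(u\<^sub>1) \<dots> e\<^sub>j\<^sub>k(u\<^sub>k) h(v)\<close> over the segments of a word \<open>u 2 u\<^sub>1 2 \<dots> 2 u\<^sub>k 2 v\<close>, where \<open>g\<close> and \<open>h\<close>
are arbitrary functions from the binary construction, \<open>k \<le> m\<close>, and \<open>e\<^sub>j\<close> is a single nonzero
function in length \<open>j\<close>, allowed only for \<open>j\<close> in a set \<open>J\<close>. Since at most \<open>m + 1\<close> separators can
occur, the quotient is still nil (\<open>layers_nil\<close>). Its growth is \<open>H(n)\<^sup>2 |J \<inter> {0..n}|\<^sup>m\<close> up to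
constants and rescaling of \<open>n\<close> (\<open>card_spanning_words\<close>, \<open>words_spanned\<close>, \<open>indep_independent_words\<close>).
Let \<open>\<tau>\<close> be the exponent of the growth of \<open>H\<^sup>2\<close>; by the above \<open>\<tau> \<le> 8\<close>. For \<open>d \<ge> 8\<close> a set \<open>J\<close> with about
\<open>n\<^sup>\<theta>\<close> elements up to \<open>n\<close>, where \<open>\<theta> m = d - \<tau>\<close>, gives the exponent \<open>d\<close> (\<open>functionals_of_dimension\<close>).

\<^bold>\<open>Scalars.\<close> The field is a ring with a carrier, whereas finitely supported functions form a
ring if their coefficients come from a type of class \<open>comm_ring_1\<close>. All computations therefore
take place over a commutative ring that maps onto the field, and equations of scalars hold
modulo the kernel, which is given as a predicate \<open>Z\<close>. The quotient is transported to the
natural numbers at the end.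
\<close>

section \<open>A commutative ring type mapping onto every commutative ring\<close>

text \<open>
  The product of all commutative rings with carrier in a given type; it maps onto each of its
  factors. The additional factor \<open>int\<close> keeps \<open>0\<close> and \<open>1\<close> apart when all those rings are trivial,
  as the class \<open>comm_ring_1\<close> requires.
\<close>

typedef 'a cring_product =
  "{(n :: int, x :: 'a ring \<Rightarrow> 'a). \<forall>R. if cring R then x R \<in> carrier R else x R = undefined}"
proof -
  have "\<zero>\<^bsub>R\<^esub> \<in> carrier R" if "cring R" for R :: "'a ring"
    using that by (simp add: cring.cring_simprules)
  then have "(0, \<lambda>R. if cring R then \<zero>\<^bsub>R\<^esub> else undefined) \<in>
    {(n :: int, x :: 'a ring \<Rightarrow> 'a). \<forall>R. if cring R then x R \<in> carrier R else x R = undefined}"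
    by simp
  then show ?thesis by (rule exI)
qed

setup_lifting type_definition_cring_product

instantiation cring_product :: (type) comm_ring_1
begin

lift_definition zero_cring_product :: "'a cring_product"
  is "(0, \<lambda>R. if cring R then \<zero>\<^bsub>R\<^esub> else undefined)"
  by (simp add: cring.cring_simprules)

lift_definition one_cring_product :: "'a cring_product"
  is "(1, \<lambda>R. if cring R then \<one>\<^bsub>R\<^esub> else undefined)"
  by (simp add: cring.cring_simprules)

lift_definition plus_cring_product :: "'a cring_product \<Rightarrow> 'a cring_product \<Rightarrow> 'a cring_product"
  is "\<lambda>(n, x) (m, y). (n + m, \<lambda>R. if cring R then x R \<oplus>\<^bsub>R\<^esub> y R else undefined)"
  by (auto simp: cring.cring_simprules)

lift_definition times_cring_product :: "'a cring_product \<Rightarrow> 'a cring_product \<Rightarrow> 'a cring_product"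
  is "\<lambda>(n, x) (m, y). (n * m, \<lambda>R. if cring R then x R \<otimes>\<^bsub>R\<^esub> y R else undefined)"
  by (auto simp: cring.cring_simprules)

lift_definition uminus_cring_product :: "'a cring_product \<Rightarrow> 'a cring_product"
  is "\<lambda>(n, x). (- n, \<lambda>R. if cring R then \<ominus>\<^bsub>R\<^esub> x R else undefined)"
  by (auto simp: cring.cring_simprules)

definition minus_cring_product :: "'a cring_product \<Rightarrow> 'a cring_product \<Rightarrow> 'a cring_product"
  where "minus_cring_product a b = a + - b"

instance
proof
  fix a b c :: "'a cring_product"
  show "a * b * c = a * (b * c)"
    by transfer (auto simp: cring.cring_simprules fun_eq_iff split: if_splits)
  show "a * b = b * a"
    by transfer (auto simp: cring.cring_simprules fun_eq_iff split: if_splits)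
  show "1 * a = a"
    by transfer (clarsimp simp: fun_eq_iff, metis cring.cring_simprules(12))
  show "a + b + c = a + (b + c)"
    by transfer (auto simp: cring.cring_simprules fun_eq_iff split: if_splits)
  show "a + b = b + a"
    by transfer (auto simp: cring.cring_simprules fun_eq_iff split: if_splits)
  show "0 + a = a"
    by transfer (clarsimp simp: fun_eq_iff, metis cring.cring_simprules(8))
  show "- a + a = 0"
    by transfer (auto simp: cring.cring_simprules fun_eq_iff split: if_splits)
  show "a - b = a + - b"
    by (simp add: minus_cring_product_def)
  show "(a + b) * c = a * c + b * c"
    by transfer (auto simp: cring.cring_simprules fun_eq_iff algebra_simps split: if_splits)
  show "(0 :: 'a cring_product) \<noteq> 1"
    by transfer simp
qed

end

lift_definition component :: "'a ring \<Rightarrow> 'a cring_product \<Rightarrow> 'a" is "\<lambda>R (n, x). x R" .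

context
  fixes R :: "'a ring"
  assumes R: "cring R"
begin

lemma component_closed: "component R x \<in> carrier R"
  using R by transfer (auto split: prod.splits if_splits)

lemma component_add: "component R (x + y) = component R x \<oplus>\<^bsub>R\<^esub> component R y"
  using R by transfer auto

lemma component_mult: "component R (x * y) = component R x \<otimes>\<^bsub>R\<^esub> component R y"
  using R by transfer auto

lemma component_one: "component R 1 = \<one>\<^bsub>R\<^esub>"
  using R by transfer auto

lemma component_surj:
  assumes "c \<in> carrier R"
  shows "\<exists>x. component R x = c"
proof -
  have "\<exists>p. (\<lambda>(n :: int, x :: 'a ring \<Rightarrow> 'a). \<forall>S. if cring S then x S \<in> carrier S else x S = undefined) p
    \<and> (\<lambda>(n, x). x R) p = c"
    using assms R
    by (intro exI[of _ "(0, \<lambda>S. if S = R then c else if cring S then \<zero>\<^bsub>S\<^esub> else undefined)"])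
      (auto simp: cring.cring_simprules)
  then show ?thesis by transfer auto
qed

end

section \<open>Linear algebra modulo a maximal ideal\<close>

text \<open>\<open>Z\<close> is membership in a maximal ideal, so linear algebra over the residue field can be expressed by
  elements of the ring itself: \<open>Z (x - y)\<close> stands for equality.\<close>

locale residue_field =
  fixes Z :: "'k::comm_ring_1 \<Rightarrow> bool"
  assumes Z_0: "Z 0"
    and Z_add: "\<lbrakk>Z x; Z y\<rbrakk> \<Longrightarrow> Z (x + y)"
    and Z_mult: "Z x \<Longrightarrow> Z (y * x)"
    and Z_1: "\<not> Z 1"
    and Z_inv: "\<not> Z x \<Longrightarrow> \<exists>y. Z (x * y - 1)"
begin

lemma Z_mult': "Z x \<Longrightarrow> Z (x * y)"
  using Z_mult[of x y] by (simp add: mult.commute)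

lemma Z_uminus: "Z x \<Longrightarrow> Z (- x)"
  using Z_mult[of x "-1"] by simp

lemma Z_diff: "\<lbrakk>Z x; Z y\<rbrakk> \<Longrightarrow> Z (x - y)"
  using Z_add[of x "- y"] Z_uminus by simp

lemma Z_sum: "(\<And>i. i \<in> I \<Longrightarrow> Z (f i)) \<Longrightarrow> Z (sum f I)"
  by (induction I rule: infinite_finite_induct) (auto intro: Z_0 Z_add)

lemma Z_cong: "Z (x - y) \<Longrightarrow> Z x \<longleftrightarrow> Z y"
  using Z_add[of "x - y" y] Z_diff[of x "x - y"] by auto

lemma Z_mult_iff: "Z (x * y) \<longleftrightarrow> Z x \<or> Z y"
proof -
  have "Z y" if xy: "Z (x * y)" and x: "\<not> Z x"
  proof -
    obtain z where z: "Z (x * z - 1)" using Z_inv[OF x] by blast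
    have "Z (z * (x * y) - y * (x * z - 1))"
      by (intro Z_diff Z_mult xy z)
    then show ?thesis by (simp add: algebra_simps)
  qed
  then show ?thesis using Z_mult Z_mult' by blast
qed

text \<open>Gaussian elimination, one equation at a time: an equation with an invertible coefficient
  determines one of the unknowns, and the unknown is eliminated from the other equations.\<close>

lemma underdetermined:
  assumes "finite J" "finite D" "card J < card D"
  shows "\<exists>c. (\<exists>d\<in>D. \<not> Z (c d)) \<and> (\<forall>j\<in>J. Z (\<Sum>d\<in>D. a j d * c d))"
  using assms
proof (induction J arbitrary: D a rule: finite_induct)
  case empty
  then obtain d where "d \<in> D" by fastforce
  then show ?case using Z_1 by (intro exI[of _ "\<lambda>_. 1"]) auto
next
  case (insert j J)
  show ?case
  proof (cases "\<forall>d\<in>D. Z (a j d)")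
    case True
    have "card J < card D" using insert by simp
    from insert.IH[OF insert.prems(1) this, of a]
    obtain c where c: "\<exists>d\<in>D. \<not> Z (c d)" "\<forall>j\<in>J. Z (\<Sum>d\<in>D. a j d * c d)" by blast
    have "Z (\<Sum>d\<in>D. a j d * c d)" using True by (intro Z_sum Z_mult') auto
    then show ?thesis using c by blast
  next
    case False
    then obtain e where e: "e \<in> D" "\<not> Z (a j e)" by blast
    then obtain y where y: "Z (a j e * y - 1)" using Z_inv by blast
    let ?D = "D - {e}"
    have "card J < card ?D" using insert e by simp
    from insert.IH[OF _ this, of "\<lambda>k d. a k d - a k e * y * a j d"] insert.prems
    obtain c where c: "\<exists>d\<in>?D. \<not> Z (c d)"
      "\<forall>k\<in>J. Z (\<Sum>d\<in>?D. (a k d - a k e * y * a j d) * c d)" by auto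
    define s where "s k = (\<Sum>d\<in>?D. a k d * c d)" for k
    \<comment> \<open>The equation \<open>j\<close> is solved for the unknown \<open>e\<close>.\<close>
    define c' where "c' = c(e := - y * s j)"
    have s: "(\<Sum>d\<in>D. a k d * c' d) = s k - a k e * y * s j" for k
    proof -
      have "(\<Sum>d\<in>D. a k d * c' d) = a k e * c' e + (\<Sum>d\<in>?D. a k d * c' d)"
        using e insert.prems by (simp add: sum.remove)
      also have "(\<Sum>d\<in>?D. a k d * c' d) = s k"
        unfolding s_def c'_def by (intro sum.cong) auto
      finally show ?thesis by (simp add: c'_def algebra_simps)
    qed
    have "Z (\<Sum>d\<in>D. a k d * c' d)" if "k \<in> J" for k
      using c(2) that unfolding s
      by (auto simp: s_def sum_subtractf sum_distrib_left left_diff_distrib mult.assoc)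
    moreover have "Z (\<Sum>d\<in>D. a j d * c' d)"
      using Z_uminus[OF Z_mult'[OF y, of "s j"]] unfolding s by (simp add: algebra_simps)
    moreover have "\<exists>d\<in>D. \<not> Z (c' d)" using c(1) by (auto simp: c'_def)
    ultimately show ?thesis by blast
  qed
qed

text \<open>The solutions form a space of dimension at least two, so it contains two solutions that form a
  dual basis for two of the coordinates.\<close>

lemma two_dual_solutions:
  assumes "finite J" "finite D" "card J + 2 \<le> card D"
  shows "\<exists>(c :: bool \<Rightarrow> 'd \<Rightarrow> 'k) d. (\<forall>b. d b \<in> D) \<and> (\<forall>b b'. Z (c b (d b') - of_bool (b = b')))
    \<and> (\<forall>b. \<forall>j\<in>J. Z (\<Sum>d\<in>D. a j d * c b d))"
proof -
  have "card J < card D" using assms by simp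
  from underdetermined[OF assms(1,2) this, of a]
  obtain c d where c: "d \<in> D" "\<not> Z (c d)" "\<forall>j\<in>J. Z (\<Sum>d\<in>D. a j d * c d)" by blast
  obtain y where y: "Z (c d * y - 1)" using c Z_inv by blast
  \<comment> \<open>A solution with a nonzero coordinate \<open>d\<close> is found first. For the second one,
    the vanishing of the coordinate \<open>d\<close> is imposed as a further equation.\<close>
  define a' where "a' j e = (case j of None \<Rightarrow> of_bool (e = d) | Some i \<Rightarrow> a i e)" for j e
  have "card (insert None (Some ` J)) < card D"
    using assms by (simp add: card_image card_insert_if)
  from underdetermined[OF _ assms(2) this, of a']
  obtain c' e where c': "e \<in> D" "\<not> Z (c' e)"
    "\<forall>j\<in>insert None (Some ` J). Z (\<Sum>d\<in>D. a' j d * c' d)"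
    using assms(1) by blast
  have "(\<Sum>x\<in>D. a' None x * c' x) = c' d"
    using c(1) assms(2) by (simp add: a'_def of_bool_def if_distrib[of "\<lambda>x. x * _"] cong: if_cong)
  then have d0: "Z (c' d)" using c'(3) by (metis insertI1)
  have c'J: "Z (\<Sum>d\<in>D. a j d * c' d)" if "j \<in> J" for j
  proof -
    have "Z (\<Sum>d\<in>D. a' (Some j) d * c' d)" using c'(3) that by blast
    then show ?thesis by (simp add: a'_def)
  qed
  obtain z where z: "Z (c' e * z - 1)" using c' Z_inv by blast
  \<comment> \<open>The second solution is scaled; a multiple of it is subtracted from the first
    to make the coordinate \<open>e\<close> vanish there.\<close>
  define C where "C b x = (if b then z * c' x else y * c x - y * c e * z * c' x)" for b :: bool and x
  define E where "E b = (if b then e else d)" for b :: bool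
  have "Z (C b (E b') - of_bool (b = b'))" for b b'
  proof (cases b; cases b')
    assume "b" "b'" then show ?thesis using z by (simp add: C_def E_def mult.commute)
  next
    assume "b" "\<not> b'" then show ?thesis using d0 by (simp add: C_def E_def Z_mult)
  next
    assume "\<not> b" "b'"
    have "Z (- (y * c e) * (c' e * z - 1))" using z by (rule Z_mult)
    with \<open>\<not> b\<close> \<open>b'\<close> show ?thesis by (simp add: C_def E_def algebra_simps)
  next
    assume "\<not> b" "\<not> b'"
    have "Z ((c d * y - 1) - (y * c e * z) * c' d)" using Z_diff[OF y Z_mult[OF d0]] .
    with \<open>\<not> b\<close> \<open>\<not> b'\<close> show ?thesis by (simp add: C_def E_def algebra_simps)
  qed
  moreover have "Z (\<Sum>x\<in>D. a j x * C b x)" if "j \<in> J" for b j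
  proof (cases b)
    case True
    have "(\<Sum>x\<in>D. a j x * C b x) = z * (\<Sum>x\<in>D. a j x * c' x)"
      using True by (simp add: C_def sum_distrib_left mult.left_commute)
    then show ?thesis using c'J[OF that] by (simp add: Z_mult)
  next
    case False
    have "(\<Sum>x\<in>D. a j x * C b x) =
      y * (\<Sum>x\<in>D. a j x * c x) - y * c e * z * (\<Sum>x\<in>D. a j x * c' x)"
      using False by (simp add: C_def sum_distrib_left sum_subtractf algebra_simps)
    moreover have "Z \<dots>" using c'J[OF that] c(3) that by (intro Z_diff Z_mult) auto
    ultimately show ?thesis by simp
  qed
  moreover have "E b \<in> D" for b using c(1) c'(1) by (simp add: E_def)
  ultimately show ?thesis by blast
qed

text \<open>The points of \<open>P\<close> are linearly independent as evaluations on \<open>L\<close>. For words, this says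
  that their images in the quotient by the ideal annihilated by \<open>L\<close> are independent.\<close>

definition indep :: "('w \<Rightarrow> 'k) set \<Rightarrow> 'w set \<Rightarrow> bool" where
  "indep L P \<longleftrightarrow> finite P \<and>
     (\<forall>c. (\<forall>f\<in>L. Z (\<Sum>p\<in>P. c p * f p)) \<longrightarrow> (\<forall>p\<in>P. Z (c p)))"

lemma indepD: "\<lbrakk>indep L P; \<And>f. f \<in> L \<Longrightarrow> Z (\<Sum>p\<in>P. c p * f p); p \<in> P\<rbrakk> \<Longrightarrow> Z (c p)"
  unfolding indep_def by blast

lemma indep_finite: "indep L P \<Longrightarrow> finite P"
  unfolding indep_def by blast

text \<open>A largest independent subset is a basis: a further point would make it dependent, with a nonzero
  coefficient at that point.\<close>

lemma maximal_indep:
  assumes "finite X"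
  shows "\<exists>P\<subseteq>X. indep L P \<and> (\<forall>w\<in>X. \<exists>c. \<forall>f\<in>L. Z (f w - (\<Sum>p\<in>P. c p * f p)))"
proof -
  have "indep L {}" by (simp add: indep_def)
  moreover have "\<forall>P. P \<subseteq> X \<and> indep L P \<longrightarrow> card P < Suc (card X)"
    using assms card_mono by (metis le_imp_less_Suc)
  ultimately have "\<exists>P. (P \<subseteq> X \<and> indep L P) \<and> (\<forall>Q. Q \<subseteq> X \<and> indep L Q \<longrightarrow> card Q \<le> card P)"
    by (intro ex_has_greatest_nat[where k = "{}" and b = "Suc (card X)"]) auto
  then obtain P where P: "P \<subseteq> X" "indep L P"
    and max: "\<And>Q. Q \<subseteq> X \<and> indep L Q \<Longrightarrow> card Q \<le> card P"
    by blast
  have fin: "finite P" using P(2) by (rule indep_finite)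
  have "\<exists>c. \<forall>f\<in>L. Z (f w - (\<Sum>p\<in>P. c p * f p))" if w: "w \<in> X" for w
  proof (cases "w \<in> P")
    case True
    have "(\<Sum>p\<in>P. of_bool (p = w) * f p) = f w" for f :: "'a \<Rightarrow> 'k"
      using True fin by (simp add: of_bool_def if_distrib[of "\<lambda>x. x * _"] cong: if_cong)
    then show ?thesis by (intro exI[of _ "\<lambda>p. of_bool (p = w)"]) (simp add: Z_0)
  next
    case False
    have "\<not> indep L (insert w P)"
      using max[of "insert w P"] P(1) w False fin by auto
    moreover have "finite (insert w P)" using fin by simp
    ultimately obtain c where c: "\<forall>f\<in>L. Z (\<Sum>p\<in>insert w P. c p * f p)"
      and nz: "\<exists>p\<in>insert w P. \<not> Z (c p)"
      unfolding indep_def by blast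
    have c': "Z (c w * f w + (\<Sum>p\<in>P. c p * f p))" if "f \<in> L" for f
      using c that False fin by simp
    have "\<not> Z (c w)"
    proof
      assume zw: "Z (c w)"
      have "Z (\<Sum>p\<in>P. c p * f p)" if "f \<in> L" for f
        using Z_diff[OF c'[OF that] Z_mult'[OF zw, of "f w"]] by simp
      then show False using nz zw indepD[OF P(2)] by blast
    qed
    then obtain y where y: "Z (c w * y - 1)" using Z_inv by blast
    have "Z (f w - (\<Sum>p\<in>P. - y * c p * f p))" if "f \<in> L" for f
    proof -
      have "Z (y * (c w * f w + (\<Sum>p\<in>P. c p * f p)) - f w * (c w * y - 1))"
        by (intro Z_diff Z_mult c'[OF that] y)
      moreover have "(\<Sum>p\<in>P. - y * c p * f p) = - y * (\<Sum>p\<in>P. c p * f p)"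
        by (simp only: sum_distrib_left mult.assoc)
      ultimately show ?thesis by (simp add: algebra_simps)
    qed
    then show ?thesis by (intro exI[of _ "\<lambda>p. - y * c p"] ballI)
  qed
  with P show ?thesis by blast
qed

end

section \<open>Rank of a set of functions\<close>

text \<open>The restrictions to \<open>S\<close> of the functions in \<open>L\<close> lie in the span of \<open>N\<close> functions. Spanning is meant
  over the ring; it passes to the residue field. This notion of rank avoids bases and is stable
  under the operations by which the functions below are built.\<close>

definition spanned_on :: "'w set \<Rightarrow> ('w \<Rightarrow> 'k::comm_ring_1) set \<Rightarrow> nat \<Rightarrow> bool" where
  "spanned_on S L N \<longleftrightarrow> (\<exists>g. \<forall>f\<in>L. \<exists>b. \<forall>w\<in>S. f w = (\<Sum>j<N. b j * g j w))"

lemma spanned_onI: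
  assumes "finite I" "card I \<le> N"
    and "\<And>f. f \<in> L \<Longrightarrow> \<exists>b. \<forall>w\<in>S. f w = (\<Sum>i\<in>I. b i * g i w)"
  shows "spanned_on S L N"
proof -
  obtain h where h: "bij_betw h {0..<card I} I"
    using ex_bij_betw_nat_finite[OF assms(1)] by blast
  have "\<exists>b. \<forall>w\<in>S. f w = (\<Sum>j<N. b j * g (h j) w)" if f: "f \<in> L" for f
  proof -
    obtain b where b: "\<forall>w\<in>S. f w = (\<Sum>i\<in>I. b i * g i w)" using assms(3)[OF f] by blast
    have "f w = (\<Sum>j<N. (if j < card I then b (h j) else 0) * g (h j) w)" if "w \<in> S" for w
    proof -
      have "f w = (\<Sum>j\<in>{0..<card I}. b (h j) * g (h j) w)"
        using b that sum.reindex_bij_betw[OF h, of "\<lambda>i. b i * g i w"] by simp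
      also have "\<dots> = (\<Sum>j<N. (if j < card I then b (h j) else 0) * g (h j) w)"
        using assms(2) by (intro sum.mono_neutral_cong_left) auto
      finally show ?thesis .
    qed
    then show ?thesis by (intro exI[of _ "\<lambda>j. if j < card I then b (h j) else 0"]) blast
  qed
  then show ?thesis unfolding spanned_on_def by (intro exI[of _ "\<lambda>j. g (h j)"]) blast
qed

lemma spanned_on_le: "\<lbrakk>spanned_on S L N; N \<le> M\<rbrakk> \<Longrightarrow> spanned_on S L M"
proof -
  assume "spanned_on S L N" "N \<le> M"
  then obtain g where "\<forall>f\<in>L. \<exists>b. \<forall>w\<in>S. f w = (\<Sum>j\<in>{..<N}. b j * g j w)"
    unfolding spanned_on_def by auto
  then show ?thesis using \<open>N \<le> M\<close> by (intro spanned_onI[of "{..<N}" M L S g]) auto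
qed

lemma spanned_on_UN:
  assumes "finite I" "\<And>i. i \<in> I \<Longrightarrow> spanned_on S (L i) (N i)"
    and "\<And>f. f \<in> M \<Longrightarrow> \<exists>i\<in>I. f \<in> L i"
  shows "spanned_on S M (\<Sum>i\<in>I. N i)"
proof -
  obtain g where g: "\<And>i f. i \<in> I \<Longrightarrow> f \<in> L i \<Longrightarrow> \<exists>b. \<forall>w\<in>S. f w = (\<Sum>j<N i. b j * g i j w)"
    using assms(2) unfolding spanned_on_def by metis
  show ?thesis
  proof (rule spanned_onI[where I = "SIGMA i:I. {..<N i}" and g = "\<lambda>p. g (fst p) (snd p)"])
    fix f assume "f \<in> M"
    then obtain i where i: "i \<in> I" "f \<in> L i" using assms(3) by blast
    obtain b where b: "\<forall>w\<in>S. f w = (\<Sum>j<N i. b j * g i j w)" using g[OF i] by blast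
    have "(\<Sum>p\<in>(SIGMA i:I. {..<N i}). (if fst p = i then b (snd p) else 0) * g (fst p) (snd p) w)
       = (\<Sum>j<N i. b j * g i j w)" for w
    proof -
      have "(\<Sum>p\<in>(SIGMA i:I. {..<N i}). (if fst p = i then b (snd p) else 0) * g (fst p) (snd p) w)
        = (\<Sum>k\<in>I. \<Sum>j<N k. if k = i then b j * g k j w else 0)"
        using assms(1) by (subst sum.Sigma) (auto intro!: sum.cong)
      also have "\<dots> = (\<Sum>k\<in>I. if k = i then (\<Sum>j<N k. b j * g k j w) else 0)"
        by (intro sum.cong) auto
      also have "\<dots> = (\<Sum>j<N i. b j * g i j w)" using i assms(1) by simp
      finally show ?thesis .
    qed
    with b show "\<exists>b. \<forall>w\<in>S. f w = (\<Sum>p\<in>(SIGMA i:I. {..<N i}). b p * g (fst p) (snd p) w)"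
      by (intro exI[of _ "\<lambda>p. if fst p = i then b (snd p) else 0"]) simp
  qed (use assms(1) in auto)
qed

lemma spanned_on_all: "\<lbrakk>finite S; card S \<le> N\<rbrakk> \<Longrightarrow> spanned_on S L N"
proof (rule spanned_onI[where I = S and g = "\<lambda>v w. of_bool (v = w)"])
  fix f :: "'a \<Rightarrow> 'b" assume "finite S"
  then show "\<exists>b. \<forall>w\<in>S. f w = (\<Sum>v\<in>S. b v * of_bool (v = w))"
    by (intro exI[of _ f]) (simp add: of_bool_def if_distrib[of "\<lambda>x. _ * x"] cong: if_cong)
qed

lemma spanned_on_finite: "\<lbrakk>finite L; card L \<le> N\<rbrakk> \<Longrightarrow> spanned_on S L N"
proof (rule spanned_onI[where I = L and g = "\<lambda>g. g"])
  fix f :: "'a \<Rightarrow> 'b" assume "finite L" "f \<in> L"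
  then show "\<exists>b. \<forall>w\<in>S. f w = (\<Sum>g\<in>L. b g * g w)"
    by (intro exI[of _ "\<lambda>g. of_bool (g = f)"])
      (simp add: of_bool_def if_distrib[of "\<lambda>x. x * _"] cong: if_cong)
qed

text \<open>Rank is submultiplicative: products of functions of two consecutive parts of a word are
  spanned by the products of the spanning functions.\<close>

lemma spanned_on_tensor:
  assumes "spanned_on A L N" "spanned_on B M K"
    and "\<And>f. f \<in> F \<Longrightarrow> \<exists>g\<in>L. \<exists>h\<in>M. \<forall>x\<in>A. \<forall>y\<in>B. f (x @ y) = g x * h y"
    and "\<And>x. x \<in> A \<Longrightarrow> length x = a"
    and "\<And>w. w \<in> S \<Longrightarrow> \<exists>x\<in>A. \<exists>y\<in>B. w = x @ y"
  shows "spanned_on S F (N * K)"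
proof -
  obtain p where p: "\<forall>f\<in>L. \<exists>b. \<forall>w\<in>A. f w = (\<Sum>j<N. b j * p j w)"
    using assms(1) unfolding spanned_on_def by blast
  obtain q where q: "\<forall>f\<in>M. \<exists>b. \<forall>w\<in>B. f w = (\<Sum>j<K. b j * q j w)"
    using assms(2) unfolding spanned_on_def by blast
  show ?thesis
  proof (rule spanned_onI[where I = "{..<N} \<times> {..<K}"
        and g = "\<lambda>i w. p (fst i) (take a w) * q (snd i) (drop a w)"])
    fix f assume "f \<in> F"
    then obtain g h where gh: "g \<in> L" "h \<in> M" "\<forall>x\<in>A. \<forall>y\<in>B. f (x @ y) = g x * h y"
      using assms(3) by blast
    obtain b where b: "\<forall>w\<in>A. g w = (\<Sum>j<N. b j * p j w)" using p gh by blast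
    obtain c where c: "\<forall>w\<in>B. h w = (\<Sum>j<K. c j * q j w)" using q gh by blast
    have "f w = (\<Sum>i\<in>{..<N} \<times> {..<K}. (b (fst i) * c (snd i)) *
        (p (fst i) (take a w) * q (snd i) (drop a w)))" if "w \<in> S" for w
    proof -
      obtain x y where xy: "x \<in> A" "y \<in> B" "w = x @ y" using assms(5)[OF \<open>w \<in> S\<close>] by blast
      then have "f w = (\<Sum>i<N. b i * p i x) * (\<Sum>j<K. c j * q j y)" using gh b c by simp
      also have "\<dots> = (\<Sum>i<N. \<Sum>j<K. (b i * p i x) * (c j * q j y))" by (simp add: sum_product)
      also have "\<dots> = (\<Sum>(i, j)\<in>{..<N} \<times> {..<K}. (b i * p i x) * (c j * q j y))"
        by (simp add: sum.cartesian_product)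
      finally show ?thesis using xy assms(4)
        by (auto intro!: sum.cong simp: algebra_simps)
    qed
    then show "\<exists>b. \<forall>w\<in>S. f w = (\<Sum>i\<in>{..<N} \<times> {..<K}. b i *
        (p (fst i) (take a w) * q (snd i) (drop a w)))"
      by (intro exI[of _ "\<lambda>i. b (fst i) * c (snd i)"]) blast
  qed auto
qed

text \<open>A linear relation between points has to satisfy only \<open>N\<close> equations, one for each spanning function.\<close>

lemma (in residue_field) card_indep_le:
  assumes "spanned_on S L N" "indep L P" "P \<subseteq> S"
  shows "card P \<le> N"
proof (rule ccontr)
  assume "\<not> card P \<le> N"
  obtain g where g: "\<forall>f\<in>L. \<exists>b. \<forall>w\<in>S. f w = (\<Sum>j<N. b j * g j w)"
    using assms(1) unfolding spanned_on_def by blast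
  have "card {..<N} < card P" using \<open>\<not> card P \<le> N\<close> by simp
  from underdetermined[OF _ indep_finite[OF assms(2)] this, of g]
  obtain c where c: "\<exists>p\<in>P. \<not> Z (c p)" "\<forall>j<N. Z (\<Sum>p\<in>P. g j p * c p)" by auto
  have "Z (\<Sum>p\<in>P. c p * f p)" if fL: "f \<in> L" for f
  proof -
    obtain b where b: "\<forall>w\<in>S. f w = (\<Sum>j<N. b j * g j w)" using g fL by blast
    have "f p = (\<Sum>j<N. b j * g j p)" if "p \<in> P" for p
      using b assms(3) that by (meson subsetD)
    then have "(\<Sum>p\<in>P. c p * f p) = (\<Sum>p\<in>P. c p * (\<Sum>j<N. b j * g j p))"
      by (intro sum.cong) auto
    also have "\<dots> = (\<Sum>p\<in>P. \<Sum>j<N. b j * (g j p * c p))"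
      unfolding sum_distrib_left by (intro sum.cong) (simp_all add: mult_ac)
    also have "\<dots> = (\<Sum>j<N. b j * (\<Sum>p\<in>P. g j p * c p))"
      by (subst sum.swap) (simp add: sum_distrib_left)
    also have "Z \<dots>" using c(2) by (auto intro!: Z_sum[of "{..<N}"] Z_mult)
    finally show ?thesis .
  qed
  then show False using c(1) indepD[OF assms(2)] by blast
qed

section \<open>Words, the free algebra and its pairing with functions\<close>

text \<open>
  Finitely supported functions on a monoid have the convolution product. With words under
  concatenation as the monoid, this is the free algebra. The class is that of additive monoids, which
  is why concatenation has to be called addition.
\<close>

instantiation list :: (type) monoid_add
begin

definition zero_list :: "'a list" where "zero_list = []"

definition plus_list :: "'a list \<Rightarrow> 'a list \<Rightarrow> 'a list" where "plus_list = (@)"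

instance by standard (simp_all add: zero_list_def plus_list_def)

end

type_synonym word = "nat list"

abbreviation scalar :: "'k::comm_ring_1 \<Rightarrow> word \<Rightarrow>\<^sub>0 'k" where
  "scalar c \<equiv> Poly_Mapping.single [] c"

lemma poly_mapping_eq_sum_single:
  "r = (\<Sum>w\<in>Poly_Mapping.keys r. Poly_Mapping.single w (Poly_Mapping.lookup r w))"
  by (rule poly_mapping_eqI)
    (auto simp: lookup_sum lookup_single when_def in_keys_iff)

lemma poly_mapping_additive_induct [case_names zero single add]:
  assumes "P 0" "\<And>w c. P (Poly_Mapping.single w c)" "\<And>a b. P a \<Longrightarrow> P b \<Longrightarrow> P (a + b)"
  shows "P (r :: 'a \<Rightarrow>\<^sub>0 'b::comm_monoid_add)"
proof -
  have "P (\<Sum>w\<in>A. Poly_Mapping.single w (Poly_Mapping.lookup r w))" if "finite A" for A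
    using that by (induction A rule: finite_induct) (auto intro: assms)
  from this[OF finite_keys[of r]] show ?thesis
    using poly_mapping_eq_sum_single[of r] by simp
qed

lemma single_times_single:
  "Poly_Mapping.single u c * Poly_Mapping.single v d = Poly_Mapping.single (u @ v) (c * d)"
  for u v :: "'a list"
  by (simp add: mult_single plus_list_def)

lemma scalar_1: "scalar 1 = 1"
  using single_one[where 'a = word] by (simp add: zero_list_def)

lemma keys_mult_words:
  "Poly_Mapping.keys (r * s) \<subseteq> {u @ v | u v. u \<in> Poly_Mapping.keys r \<and> v \<in> Poly_Mapping.keys s}"
  for r s :: "'a list \<Rightarrow>\<^sub>0 'k::comm_ring_1"
  using keys_mult[of r s] by (simp add: plus_list_def)

lemma lookup_scalar_mult: "Poly_Mapping.lookup (scalar c * r) w = c * Poly_Mapping.lookup r w"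
  by (induction r rule: poly_mapping_additive_induct)
    (auto simp: single_times_single lookup_single when_def algebra_simps lookup_add)

text \<open>Functions on words are linear functionals on the free algebra.\<close>

definition pairing :: "('w \<Rightarrow>\<^sub>0 'k::comm_ring_1) \<Rightarrow> ('w \<Rightarrow> 'k) \<Rightarrow> 'k" where
  "pairing r f = (\<Sum>w\<in>Poly_Mapping.keys r. Poly_Mapping.lookup r w * f w)"

lemma pairing_superset:
  "\<lbrakk>finite A; Poly_Mapping.keys r \<subseteq> A\<rbrakk> \<Longrightarrow> pairing r f = (\<Sum>w\<in>A. Poly_Mapping.lookup r w * f w)"
  unfolding pairing_def by (rule sum.mono_neutral_left) (auto simp: in_keys_iff)

lemma pairing_support:
  assumes "finite A" "\<And>w. w \<in> Poly_Mapping.keys r \<Longrightarrow> w \<notin> A \<Longrightarrow> f w = 0"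
  shows "pairing r f = (\<Sum>w\<in>A. Poly_Mapping.lookup r w * f w)"
proof -
  have "pairing r f = (\<Sum>w\<in>Poly_Mapping.keys r \<union> A. Poly_Mapping.lookup r w * f w)"
    by (rule pairing_superset) (use assms(1) in auto)
  also have "\<dots> = (\<Sum>w\<in>A. Poly_Mapping.lookup r w * f w)"
    by (rule sum.mono_neutral_right) (use assms in \<open>auto simp: in_keys_iff\<close>)
  finally show ?thesis .
qed

lemma pairing_zero [simp]: "pairing 0 f = 0"
  by (simp add: pairing_def)

lemma pairing_single [simp]: "pairing (Poly_Mapping.single w c) f = c * f w"
  by (cases "c = 0") (auto simp: pairing_def)

lemma pairing_add: "pairing (r + s) f = pairing r f + pairing s f"
proof -
  let ?A = "Poly_Mapping.keys r \<union> Poly_Mapping.keys s"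
  have "pairing (r + s) f = (\<Sum>w\<in>?A. Poly_Mapping.lookup (r + s) w * f w)"
    by (rule pairing_superset) (use Poly_Mapping.keys_add[of r s] in auto)
  then show ?thesis
    using pairing_superset[of ?A r f] pairing_superset[of ?A s f]
    by (simp add: lookup_add algebra_simps sum.distrib)
qed

lemma pairing_scalar: "pairing (scalar c * r) f = c * pairing r f"
  by (induction r rule: poly_mapping_additive_induct)
    (auto simp: pairing_add algebra_simps single_times_single)

lemma pairing_uminus: "pairing (- r) f = - pairing r f"
  using pairing_add[of r "- r" f] by (simp add: add_eq_0_iff)

lemma pairing_diff: "pairing (r - s) f = pairing r f - pairing s f"
  using pairing_add[of r "- s" f] by (simp add: pairing_uminus)

lemma pairing_sum: "pairing (sum r A) f = (\<Sum>i\<in>A. pairing (r i) f)"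
  by (induction A rule: infinite_finite_induct) (auto simp: pairing_add)

lemma pairing_fun_add: "pairing r (\<lambda>w. f w + g w) = pairing r f + pairing r g"
  by (simp add: pairing_def algebra_simps sum.distrib)

lemma pairing_fun_scale: "pairing r (\<lambda>w. c * f w) = c * pairing r f"
  by (simp add: pairing_def sum_distrib_left mult.left_commute)

text \<open>The product on the left corresponds to translations of the functional on the right; this is why
  translation closed sets of functionals annihilate ideals.\<close>

lemma pairing_mult: "pairing (r * s) f = pairing r (\<lambda>u. pairing s (\<lambda>v. f (u @ v)))"
proof (induction r rule: poly_mapping_additive_induct)
  case (single u c)
  show ?case
    by (induction s rule: poly_mapping_additive_induct)
      (auto simp: single_times_single distrib_left pairing_add mult_ac)
qed (auto simp: pairing_add algebra_simps)

lemma (in residue_field) Z_pairing: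
  "(\<And>w. w \<in> Poly_Mapping.keys r \<Longrightarrow> Z (f w)) \<Longrightarrow> Z (pairing r f)"
  unfolding pairing_def by (intro Z_sum Z_mult)

section \<open>Windows of powers\<close>

text \<open>\<open>lder z r\<close> is the part of \<open>r\<close> on words with prefix \<open>z\<close>, the prefix removed; \<open>rder z r\<close> is its mirror image.
  The windows of \<open>r\<close> are the elements \<open>rder y (lder x r)\<close>, with the coefficient of \<open>x @ w @ y\<close> at \<open>w\<close>.\<close>

lift_definition lder :: "word \<Rightarrow> (word \<Rightarrow>\<^sub>0 'k::zero) \<Rightarrow> (word \<Rightarrow>\<^sub>0 'k)"
  is "\<lambda>z f w. f (z @ w)"
proof -
  fix z :: word and f :: "word \<Rightarrow> 'k" assume "finite {w. f w \<noteq> 0}"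
  then have "finite ((@) z -` {w. f w \<noteq> 0})" by (intro finite_vimageI) (auto simp: inj_def)
  then show "finite {w. f (z @ w) \<noteq> 0}" by (simp add: vimage_def)
qed

lift_definition rder :: "word \<Rightarrow> (word \<Rightarrow>\<^sub>0 'k::zero) \<Rightarrow> (word \<Rightarrow>\<^sub>0 'k)"
  is "\<lambda>z f w. f (w @ z)"
proof -
  fix z :: word and f :: "word \<Rightarrow> 'k" assume "finite {w. f w \<noteq> 0}"
  then have "finite ((\<lambda>w. w @ z) -` {w. f w \<noteq> 0})" by (intro finite_vimageI) (auto simp: inj_def)
  then show "finite {w. f (w @ z) \<noteq> 0}" by (simp add: vimage_def)
qed

lemma lder_append: "lder (x @ y) r = lder y (lder x r)"
  by (rule poly_mapping_eqI) (simp add: lder.rep_eq)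

lemma rder_append: "rder (x @ y) r = rder x (rder y r)"
  by (rule poly_mapping_eqI) (simp add: rder.rep_eq)

lemma lder_Nil [simp]: "lder [] r = r"
  by (rule poly_mapping_eqI) (simp add: lder.rep_eq)

lemma rder_Nil [simp]: "rder [] r = r"
  by (rule poly_mapping_eqI) (simp add: rder.rep_eq)

lemma lder_zero [simp]: "lder z 0 = 0"
  by (rule poly_mapping_eqI) (simp add: lder.rep_eq)

lemma rder_zero [simp]: "rder z 0 = 0"
  by (rule poly_mapping_eqI) (simp add: rder.rep_eq)

lemma lder_add: "lder z (r + s) = lder z r + lder z s"
  by (rule poly_mapping_eqI) (simp add: lder.rep_eq lookup_add)

lemma rder_add: "rder z (r + s) = rder z r + rder z s"
  by (rule poly_mapping_eqI) (simp add: rder.rep_eq lookup_add)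

lemma lder_single:
  "lder [a] (Poly_Mapping.single w c) = (if w \<noteq> [] \<and> hd w = a then Poly_Mapping.single (tl w) c else 0)"
  by (rule poly_mapping_eqI) (cases w; auto simp: lder.rep_eq lookup_single when_def)

lemma rder_single:
  "rder [a] (Poly_Mapping.single w c) = (if w \<noteq> [] \<and> last w = a then Poly_Mapping.single (butlast w) c else 0)"
  by (rule poly_mapping_eqI) (cases w rule: rev_cases; auto simp: rder.rep_eq lookup_single when_def)

text \<open>A Leibniz rule: a first letter of a product is the first letter of its left factor, except where
  the left factor contributes the empty word.\<close>

lemma lder_mult:
  "lder [a] (r * s) = lder [a] r * s + scalar (Poly_Mapping.lookup r []) * lder [a] s"
  for r s :: "word \<Rightarrow>\<^sub>0 'k::comm_ring_1"
proof (induction r rule: poly_mapping_additive_induct)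
  case (single u c)
  show ?case
  proof (induction s rule: poly_mapping_additive_induct)
    case (single v d)
    show ?case
      by (cases u) (auto simp: single_times_single lder_single lookup_single)
  qed (auto simp: distrib_left lder_add)
qed (auto simp: distrib_right lder_add lookup_add single_add)

lemma rder_mult:
  "rder [a] (r * s) = r * rder [a] s + scalar (Poly_Mapping.lookup s []) * rder [a] r"
  for r s :: "word \<Rightarrow>\<^sub>0 'k::comm_ring_1"
proof (induction r rule: poly_mapping_additive_induct)
  case (single u c)
  show ?case
  proof (induction s rule: poly_mapping_additive_induct)
    case (single v d)
    show ?case
      by (cases v rule: rev_cases) (auto simp: single_times_single rder_single mult.commute butlast_append lookup_single)
  qed (auto simp: distrib_left distrib_right rder_add lookup_add single_add)
qed (auto simp: distrib_right distrib_left rder_add)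

lemma lder_scalar: "lder [a] (scalar c * r) = scalar c * lder [a] r"
  by (simp add: lder_mult lder_single)

lemma rder_scalar: "rder [a] (scalar c * r) = scalar c * rder [a] r"
  by (simp add: rder_mult rder_single)

lemma scalar_commute: "r * scalar c = scalar c * r"
  by (induction r rule: poly_mapping_additive_induct)
    (auto simp: single_times_single mult.commute distrib_left distrib_right)

lemma keys_lder: "Poly_Mapping.keys (lder z r) = {w. z @ w \<in> Poly_Mapping.keys r}"
  by (auto simp: in_keys_iff lder.rep_eq)

lemma keys_rder: "Poly_Mapping.keys (rder z r) = {w. w @ z \<in> Poly_Mapping.keys r}"
  by (auto simp: in_keys_iff rder.rep_eq)

lemma length_keys_power:
  fixes r :: "'a list \<Rightarrow>\<^sub>0 'k::comm_ring_1"
  assumes "\<And>w. w \<in> Poly_Mapping.keys r \<Longrightarrow> n \<le> length w" "w \<in> Poly_Mapping.keys (r ^ q)"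
  shows "q * n \<le> length w"
  using assms(2)
proof (induction q arbitrary: w)
  case (Suc q)
  then obtain u v where "w = u @ v" "u \<in> Poly_Mapping.keys r" "v \<in> Poly_Mapping.keys (r ^ q)"
    using keys_mult_words[of r "r ^ q"] by auto
  then show ?case using Suc.IH[of v] assms(1)[of u] by simp
qed simp

lemma set_keys_power:
  fixes r :: "'a list \<Rightarrow>\<^sub>0 'k::comm_ring_1"
  assumes "\<And>w. w \<in> Poly_Mapping.keys r \<Longrightarrow> set w \<subseteq> A" "w \<in> Poly_Mapping.keys (r ^ q)"
  shows "set w \<subseteq> A"
  using assms(2)
proof (induction q arbitrary: w)
  case 0
  then have "w = []" by (auto simp: zero_list_def split: if_splits)
  then show ?case by simp
next
  case (Suc q)
  then obtain u v where "w = u @ v" "u \<in> Poly_Mapping.keys r" "v \<in> Poly_Mapping.keys (r ^ q)"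
    using keys_mult_words[of r "r ^ q"] by auto
  then show ?case using Suc.IH[of v] assms(1)[of u] by auto
qed

text \<open>The span of the elements \<open>(z\<inverse>r) r\<^sup>q\<close>. It contains the powers of \<open>r\<close> and is closed under left
  derivatives when \<open>r\<close> has no constant term: a derivative of \<open>r\<^sup>q\<close> falls on the first factor.\<close>

inductive_set left_pieces :: "(word \<Rightarrow>\<^sub>0 'k::comm_ring_1) \<Rightarrow> (word \<Rightarrow>\<^sub>0 'k) set"
  for r :: "word \<Rightarrow>\<^sub>0 'k::comm_ring_1" where
  piece: "lder z r * r ^ q \<in> left_pieces r"
| zero: "0 \<in> left_pieces r"
| add: "\<lbrakk>g \<in> left_pieces r; h \<in> left_pieces r\<rbrakk> \<Longrightarrow> g + h \<in> left_pieces r"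
| scale: "g \<in> left_pieces r \<Longrightarrow> scalar c * g \<in> left_pieces r"

text \<open>The two-sided version of \<open>left_pieces\<close>. The elements \<open>(z\<inverse>r) r\<^sup>q\<close> with \<open>q = 0\<close> and their right derivatives
  do not have two outer factors, but their words are short. The span is therefore enlarged by
  the elements with words shorter than \<open>W\<close>, which every functional on words of length \<open>W\<close> annihilates.\<close>

inductive_set two_sided_pieces :: "nat \<Rightarrow> (word \<Rightarrow>\<^sub>0 'k::comm_ring_1) \<Rightarrow> (word \<Rightarrow>\<^sub>0 'k) set"
  for W :: nat and r :: "word \<Rightarrow>\<^sub>0 'k::comm_ring_1" where
  piece: "lder z r * r ^ q * rder z' r \<in> two_sided_pieces W r"
| short: "(\<And>w. w \<in> Poly_Mapping.keys g \<Longrightarrow> length w < W) \<Longrightarrow> g \<in> two_sided_pieces W r"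
| add: "\<lbrakk>g \<in> two_sided_pieces W r; h \<in> two_sided_pieces W r\<rbrakk> \<Longrightarrow> g + h \<in> two_sided_pieces W r"
| scale: "g \<in> two_sided_pieces W r \<Longrightarrow> scalar c * g \<in> two_sided_pieces W r"

context
  fixes r :: "word \<Rightarrow>\<^sub>0 'k::comm_ring_1" and t W :: nat
  assumes no_constant: "Poly_Mapping.lookup r [] = 0"
    and bound: "\<And>w. w \<in> Poly_Mapping.keys r \<Longrightarrow> length w \<le> t"
    and W: "t < W"
begin

lemma lder_left_pieces:
  assumes "g \<in> left_pieces r"
  shows "lder [a] g \<in> left_pieces r"
  using assms
proof induction
  case (piece z q)
  have "lder [a] (r ^ q) \<in> left_pieces r"
  proof (cases q)
    case 0
    have "lder [a] (1 :: word \<Rightarrow>\<^sub>0 'k) = 0"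
      using lder_single[of a "[]" "1 :: 'k"] by (simp add: scalar_1)
    with 0 show ?thesis by (simp add: left_pieces.zero)
  next
    case (Suc p)
    then show ?thesis using left_pieces.piece[of "[a]" r p]
      by (simp add: lder_mult no_constant)
  qed
  then show ?case
    using left_pieces.piece[of "z @ [a]" r q]
    by (simp add: lder_mult lder_append left_pieces.add left_pieces.scale)
qed (auto simp: lder_add lder_scalar intro: left_pieces.intros)

lemma lder_power_left_pieces: "0 < N \<Longrightarrow> lder x (r ^ N) \<in> left_pieces r"
proof (induction x rule: rev_induct)
  case Nil
  then show ?case using left_pieces.piece[of "[]" r "N - 1"]
    by (simp flip: power_Suc)
next
  case (snoc a x)
  then show ?case by (simp add: lder_append lder_left_pieces)
qed

lemma left_pieces_two_sided:
  assumes "g \<in> left_pieces r"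
  shows "g \<in> two_sided_pieces W r"
  using assms
proof induction
  case (piece z q)
  show ?case
  proof (cases q)
    case 0
    then show ?thesis using bound W
      by (auto intro!: two_sided_pieces.short simp: keys_lder) fastforce
  next
    case (Suc p)
    then show ?thesis using two_sided_pieces.piece[of z r p "[]" W]
      by (simp add: power_Suc2 mult.assoc del: power_Suc)
  qed
qed (auto intro: two_sided_pieces.intros)

lemma rder_two_sided:
  assumes "g \<in> two_sided_pieces W r"
  shows "rder [a] g \<in> two_sided_pieces W r"
  using assms
proof induction
  case (piece z q z')
  have "rder [a] (lder z r * r ^ q) \<in> two_sided_pieces W r"
  proof (cases q)
    case 0
    then show ?thesis using bound W
      by (auto intro!: two_sided_pieces.short simp: keys_lder keys_rder) fastforce
  next
    case (Suc p)
    then have "lder z r * r ^ q = (lder z r * r ^ p) * r"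
      by (simp add: power_Suc2 mult.assoc del: power_Suc)
    then show ?thesis using two_sided_pieces.piece[of z r p "[a]" W]
      by (simp add: rder_mult no_constant)
  qed
  then show ?case
    using two_sided_pieces.piece[of z r q "[a] @ z'" W]
    by (simp only: rder_mult rder_append two_sided_pieces.add two_sided_pieces.scale)
next
  case (short g)
  then show ?case by (intro two_sided_pieces.short) (fastforce simp: keys_rder)
qed (auto simp: rder_add rder_scalar intro: two_sided_pieces.intros)

text \<open>The point of this description is that it is finite: \<open>r\<close> has only finitely many nonzero
  derivatives, and only exponents \<open>q\<close> up to \<open>W\<close> contribute to words of length \<open>W\<close>, whereas \<open>x\<close>, \<open>y\<close> and \<open>N\<close>
  are unrestricted.\<close>

lemma window_two_sided:
  assumes "0 < N"
  shows "rder y (lder x (r ^ N)) \<in> two_sided_pieces W r"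
proof (induction y)
  case Nil
  then show ?case using lder_power_left_pieces[OF assms] left_pieces_two_sided by simp
next
  case (Cons a y)
  have "rder (a # y) (lder x (r ^ N)) = rder [a] (rder y (lder x (r ^ N)))"
    using rder_append[of "[a]" y] by simp
  then show ?case using rder_two_sided[OF Cons] by simp
qed

end

lemma (in residue_field) two_sided_annihilated:
  assumes "g \<in> two_sided_pieces W r"
    and "\<And>w. length w \<noteq> W \<Longrightarrow> f w = 0"
    and "\<And>z q z'. Z (pairing (lder z r * r ^ q * rder z' r) f)"
  shows "Z (pairing g f)"
  using assms(1)
proof induction
  case (short g)
  have "pairing g f = 0"
    unfolding pairing_def using short assms(2) by (intro sum.neutral) (metis mult_zero_right nat_less_le)
  then show ?case by (simp add: Z_0)
qed (auto simp: assms(3) pairing_add pairing_scalar Z_add Z_mult)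

section \<open>Block functionals\<close>

text \<open>The functions that agree on \<open>S\<close> with a linear combination of members of \<open>L\<close>; their values outside \<open>S\<close>
  are unconstrained.\<close>

inductive_set combos :: "'w set \<Rightarrow> ('w \<Rightarrow> 'k::comm_ring_1) set \<Rightarrow> ('w \<Rightarrow> 'k) set"
  for S :: "'w set" and L :: "('w \<Rightarrow> 'k::comm_ring_1) set" where
  zero: "(\<And>w. w \<in> S \<Longrightarrow> f w = 0) \<Longrightarrow> f \<in> combos S L"
| add: "\<lbrakk>g \<in> L; h \<in> combos S L; \<And>w. w \<in> S \<Longrightarrow> f w = c * g w + h w\<rbrakk> \<Longrightarrow> f \<in> combos S L"

lemma combos_base: "g \<in> L \<Longrightarrow> (\<And>w. w \<in> S \<Longrightarrow> f w = c * g w) \<Longrightarrow> f \<in> combos S L"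
  by (rule combos.add[where g = g and h = "\<lambda>_. 0" and c = c]) (auto intro: combos.zero)

lemma combos_cong: "f \<in> combos S L \<Longrightarrow> (\<And>w. w \<in> S \<Longrightarrow> f' w = f w) \<Longrightarrow> f' \<in> combos S L"
  by (induction arbitrary: f' rule: combos.induct)
    (auto intro: combos.zero combos.add)

lemma combos_lin:
  assumes "f \<in> combos S L" "g \<in> combos S L"
  shows "(\<lambda>w. c * f w + g w) \<in> combos S L"
  using assms
proof (induction rule: combos.induct)
  case (zero f)
  then show ?case by (auto intro: combos_cong)
next
  case (add p h f d)
  show ?case
    by (rule combos.add[OF add.hyps(1) add.IH[OF add.prems], where c = "c * d"])
      (simp add: add.hyps algebra_simps)
qed

lemma combos_sum:
  assumes "finite I" "\<And>i. i \<in> I \<Longrightarrow> h i \<in> combos S L"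
    and "\<And>w. w \<in> S \<Longrightarrow> f w = (\<Sum>i\<in>I. c i * h i w)"
  shows "f \<in> combos S L"
proof -
  have "(\<lambda>w. \<Sum>i\<in>I. c i * h i w) \<in> combos S L"
    using assms(1,2)
    by (induction I rule: finite_induct) (auto intro: combos.zero combos_lin)
  then show ?thesis by (rule combos_cong) (rule assms(3))
qed

lemma combos_subset:
  assumes "f \<in> combos S L" "\<And>g. g \<in> L \<Longrightarrow> g \<in> combos S M"
  shows "f \<in> combos S M"
  using assms(1)
proof induction
  case (add g h f c)
  from combos_lin[OF assms(2)[OF add.hyps(1)] add.IH, of c]
  show ?case by (rule combos_cong) (simp add: add.hyps)
qed (auto intro: combos.zero)

lemma combos_mono: "f \<in> combos S L \<Longrightarrow> L \<subseteq> M \<Longrightarrow> f \<in> combos S M"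
  by (erule combos_subset) (auto intro: combos_base[where c = 1])

text \<open>Through this lemma, rank bounds follow from descriptions of functions as linear combinations.\<close>

lemma spanned_on_combos:
  assumes "spanned_on S L N" "\<And>f. f \<in> M \<Longrightarrow> f \<in> combos S L"
  shows "spanned_on S M N"
proof -
  obtain g where g: "\<forall>f\<in>L. \<exists>b. \<forall>w\<in>S. f w = (\<Sum>j<N. b j * g j w)"
    using assms(1) unfolding spanned_on_def by blast
  have "\<exists>b. \<forall>w\<in>S. f w = (\<Sum>j<N. b j * g j w)" if "f \<in> combos S L" for f
    using that
  proof induction
    case (zero f)
    then show ?case by (intro exI[of _ "\<lambda>_. 0"]) simp
  next
    case (add p h f c)
    obtain b where b: "\<forall>w\<in>S. h w = (\<Sum>j<N. b j * g j w)" using add.IH by blast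
    obtain d where d: "\<forall>w\<in>S. p w = (\<Sum>j<N. d j * g j w)" using g add.hyps(1) by blast
    have "f w = (\<Sum>j<N. (c * d j + b j) * g j w)" if "w \<in> S" for w
      using add.hyps(3)[OF that] b d that
      by (simp add: algebra_simps sum.distrib sum_distrib_left)
    then show ?case by (intro exI[of _ "\<lambda>j. c * d j + b j"] ballI)
  qed
  then show ?thesis using assms(2) unfolding spanned_on_def by (intro exI[of _ g]) auto
qed

lemma (in residue_field) Z_sum_combos:
  assumes "f \<in> combos S L" "\<And>g. g \<in> L \<Longrightarrow> Z (\<Sum>w\<in>S. R w * g w)"
  shows "Z (\<Sum>w\<in>S. R w * f w)"
  using assms(1)
proof induction
  case (zero f)
  then show ?case by (auto intro!: Z_sum simp: Z_0)
next
  case (add g h f c)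
  have "(\<Sum>w\<in>S. R w * f w) = c * (\<Sum>w\<in>S. R w * g w) + (\<Sum>w\<in>S. R w * h w)"
    by (simp add: add.hyps algebra_simps sum.distrib sum_distrib_left)
  then show ?case using add assms(2) by (simp add: Z_add Z_mult)
qed

text \<open>The letters \<open>0\<close> and \<open>1\<close> are those of the algebra of slow growth; \<open>2\<close> will be the separator.\<close>

definition bwords :: "nat \<Rightarrow> word set" where
  "bwords n = {w. length w = n \<and> set w \<subseteq> {0, 1}}"

lemma finite_bwords: "finite (bwords n)"
  using finite_lists_length_eq[of "{0, 1 :: nat}" n] by (simp add: bwords_def conj_commute)

lemma card_bwords: "card (bwords n) = 2 ^ n"
  using card_lists_length_eq[of "{0, 1 :: nat}" n] by (simp add: bwords_def conj_commute numeral_2_eq_2)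

lemma bwords_0 [simp]: "bwords 0 = {[]}"
  by (auto simp: bwords_def)

lemma length_bwords: "w \<in> bwords n \<Longrightarrow> length w = n"
  by (simp add: bwords_def)

lemma append_in_bwords: "length u = a \<Longrightarrow> u @ v \<in> bwords (a + b) \<longleftrightarrow> u \<in> bwords a \<and> v \<in> bwords b"
  by (auto simp: bwords_def)

lemma bwords_split: "w \<in> bwords (a + b) \<Longrightarrow> \<exists>x\<in>bwords a. \<exists>y\<in>bwords b. w = x @ y"
  by (intro bexI[of _ "take a w"] bexI[of _ "drop a w"])
    (auto simp: bwords_def dest: in_set_takeD in_set_dropD)

definition homog :: "nat \<Rightarrow> (word \<Rightarrow> 'k::comm_ring_1) \<Rightarrow> bool" where
  "homog n f \<longleftrightarrow> (\<forall>w. w \<notin> bwords n \<longrightarrow> f w = 0)"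

text \<open>The tensor product of functions on words of length \<open>l\<close>.\<close>

primrec blocks :: "nat \<Rightarrow> (word \<Rightarrow> 'k::comm_ring_1) list \<Rightarrow> word \<Rightarrow> 'k" where
  "blocks l [] w = of_bool (w = [])"
| "blocks l (g # gs) w = g (take l w) * blocks l gs (drop l w)"

lemma blocks_append:
  "length u = l * length gs \<Longrightarrow> blocks l (gs @ hs) (u @ v) = blocks l gs u * blocks l hs v"
  by (induction gs arbitrary: u) (auto simp: mult.assoc)

lemma blocks_nth:
  assumes "j < length gs" "length u = l * j" "length w = l"
  shows "blocks l gs (u @ w @ v) = blocks l (take j gs) u * (gs ! j) w * blocks l (drop (Suc j) gs) v"
proof -
  have gs: "gs = take j gs @ [gs ! j] @ drop (Suc j) gs"
    using assms(1) by (simp add: id_take_nth_drop[symmetric] Cons_nth_drop_Suc)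
  have "blocks l gs (u @ w @ v) = blocks l (take j gs @ [gs ! j] @ drop (Suc j) gs) (u @ w @ v)"
    using gs by simp
  also have "\<dots> = blocks l (take j gs) u * (blocks l [gs ! j] w * blocks l (drop (Suc j) gs) v)"
    using assms by (subst blocks_append, simp, subst blocks_append) simp_all
  finally show ?thesis using assms(3) by (simp add: mult.assoc)
qed

lemma homog_blocks:
  assumes "\<And>g. g \<in> set gs \<Longrightarrow> homog l g"
  shows "homog (l * length gs) (blocks l gs)"
  using assms
proof (induction gs)
  case Nil
  then show ?case by (simp add: homog_def)
next
  case (Cons g gs)
  have "blocks l (g # gs) w = 0" if w: "w \<notin> bwords (l * length (g # gs))" for w
  proof (rule ccontr)
    assume "blocks l (g # gs) w \<noteq> 0"
    then have "g (take l w) \<noteq> 0" "blocks l gs (drop l w) \<noteq> 0" by auto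
    then have *: "take l w \<in> bwords l" "drop l w \<in> bwords (l * length gs)"
      using Cons by (auto simp: homog_def)
    then have "take l w @ drop l w \<in> bwords (l + l * length gs)"
      by (metis append_in_bwords length_bwords)
    then show False using w by simp
  qed
  then show ?case by (simp add: homog_def)
qed

definition bools :: "nat \<Rightarrow> bool list set" where "bools n = {e. length e = n}"

lemma finite_bools: "finite (bools n)"
  using finite_lists_length_eq[of "UNIV :: bool set" n] by (simp add: bools_def)

lemma card_bools: "card (bools n) = 2 ^ n"
  using card_lists_length_eq[of "UNIV :: bool set" n] by (simp add: bools_def)

text \<open>The new part of a level of the tower: all products of \<open>T\<close> functions of the level below, with
  coefficients that remain to be chosen.\<close>

definition block_sum :: "nat \<Rightarrow> (bool \<Rightarrow> word \<Rightarrow> 'k::comm_ring_1) \<Rightarrow> nat \<Rightarrow> (bool list \<Rightarrow> 'k) \<Rightarrow> word \<Rightarrow> 'k" where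
  "block_sum l \<phi> T c w = (\<Sum>e\<in>bools T. c e * blocks l (map \<phi> e) w)"

text \<open>A function of the next level of the tower: \<open>K\<close> factors \<open>\<phi> False\<close> in front of a \<open>block_sum\<close>. The padding
  makes the level longer without making it richer.\<close>

definition padded :: "nat \<Rightarrow> (bool \<Rightarrow> word \<Rightarrow> 'k::comm_ring_1) \<Rightarrow> nat \<Rightarrow> nat \<Rightarrow> (bool list \<Rightarrow> 'k) \<Rightarrow> word \<Rightarrow> 'k" where
  "padded l \<phi> K T c w = (\<Sum>e\<in>bools T. c e * blocks l (map \<phi> (replicate K False @ e)) w)"

lemma padded_append:
  assumes "length u = l * K"
  shows "padded l \<phi> K T c (u @ w) = blocks l (map \<phi> (replicate K False)) u * block_sum l \<phi> T c w"
proof -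
  have "blocks l (map \<phi> (replicate K False @ e)) (u @ w)
     = blocks l (map \<phi> (replicate K False)) u * blocks l (map \<phi> e) w" for e
    unfolding map_append using assms by (subst blocks_append) simp_all
  then show ?thesis unfolding padded_def block_sum_def by (simp add: sum_distrib_left mult.left_commute)
qed

lemma homog_sum: "(\<And>e. e \<in> E \<Longrightarrow> homog n (f e)) \<Longrightarrow> homog n (\<lambda>w. \<Sum>e\<in>E. c e * f e w)"
  by (auto simp: homog_def)

lemma homog_block_sum:
  assumes "\<And>a. homog l (\<phi> a)"
  shows "homog (l * T) (block_sum l \<phi> T c)"
proof -
  have "homog (l * T) (blocks l (map \<phi> e))" if "e \<in> bools T" for e
    using homog_blocks[of "map \<phi> e" l] that assms by (auto simp: bools_def)
  then show ?thesis unfolding block_sum_def[abs_def] by (rule homog_sum)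
qed

lemma homog_padded:
  assumes "\<And>a. homog l (\<phi> a)"
  shows "homog (l * (K + T)) (padded l \<phi> K T c)"
proof -
  have "homog (l * (K + T)) (blocks l (map \<phi> (replicate K False @ e)))" if "e \<in> bools T" for e
    using homog_blocks[of "map \<phi> (replicate K False @ e)" l] that assms by (auto simp: bools_def)
  then show ?thesis unfolding padded_def[abs_def] by (rule homog_sum)
qed

text \<open>Two words that separate the two functions of a level. The tower preserves this property, which
  keeps its functions from vanishing.\<close>

definition dual_words :: "('k::comm_ring_1 \<Rightarrow> bool) \<Rightarrow> nat \<Rightarrow> (bool \<Rightarrow> word \<Rightarrow> 'k) \<Rightarrow> (bool \<Rightarrow> word) \<Rightarrow> bool" where
  "dual_words Z l \<phi> p \<longleftrightarrow> (\<forall>a. p a \<in> bwords l) \<and> (\<forall>a b. Z (\<phi> a (p b) - of_bool (a = b)))"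

lemma (in residue_field) blocks_dual:
  assumes "dual_words Z l \<phi> p" "length xs = length ys"
  shows "Z (blocks l (map \<phi> xs) (concat (map p ys)) - of_bool (xs = ys))"
  using assms(2)
proof (induction xs ys rule: list_induct2)
  case (Cons x xs y ys)
  have len: "length (p y) = l" using assms(1) by (simp add: dual_words_def bwords_def)
  define A where "A = blocks l (map \<phi> xs) (concat (map p ys))"
  have "Z ((\<phi> x (p y) - of_bool (x = y)) * A + of_bool (x = y) * (A - of_bool (xs = ys)))"
    using assms(1) Cons.IH by (intro Z_add Z_mult Z_mult') (auto simp: dual_words_def A_def)
  then show ?case using len by (simp add: A_def algebra_simps of_bool_conj)
qed (simp add: Z_0)

lemma concat_bwords:
  assumes "\<And>a. p a \<in> bwords l"
  shows "concat (map p xs) \<in> bwords (l * length xs)"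
proof (induction xs)
  case (Cons x xs)
  have "p x @ concat (map p xs) \<in> bwords (l + l * length xs)"
    using assms[of x] Cons by (subst append_in_bwords) (simp_all add: length_bwords)
  then show ?case by simp
qed simp

lemma (in residue_field) padded_dual:
  assumes "dual_words Z l \<phi> p"
    and "\<And>b. d b \<in> bools T" "\<And>a b. Z (c a (d b) - of_bool (a = b))"
  shows "dual_words Z (l * (K + T)) (\<lambda>a. padded l \<phi> K T (c a))
    (\<lambda>b. concat (map p (replicate K False @ d b)))"
  unfolding dual_words_def
proof (intro conjI allI)
  fix a b
  show "concat (map p (replicate K False @ d a)) \<in> bwords (l * (K + T))"
    using concat_bwords[of p l "replicate K False @ d a"] assms(1,2)
    by (simp add: dual_words_def bools_def)
  let ?p = "concat (map p (replicate K False @ d b))"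
  have "Z (\<Sum>e\<in>bools T. c a e * (blocks l (map \<phi> (replicate K False @ e)) ?p - of_bool (e = d b)))"
  proof (intro Z_sum Z_mult)
    fix e assume "e \<in> bools T"
    then have "length (replicate K False @ e) = length (replicate K False @ d b)"
      using assms(2)[of b] by (simp add: bools_def)
    from blocks_dual[OF assms(1) this]
    show "Z (blocks l (map \<phi> (replicate K False @ e)) ?p - of_bool (e = d b))" by simp
  qed
  moreover have "(\<Sum>e\<in>bools T. c a e * of_bool (e = d b)) = c a (d b)"
    using assms(2)[of b] finite_bools[of T]
    by (simp add: of_bool_def if_distrib[of "\<lambda>x. _ * x"] cong: if_cong)
  ultimately have "Z (padded l \<phi> K T (c a) ?p - c a (d b))"
    by (simp add: padded_def right_diff_distrib sum_subtractf)
  from Z_add[OF this assms(3)[of a b]]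
  show "Z (padded l \<phi> K T (c a) ?p - of_bool (a = b))" by simp
qed

section \<open>Cutting a padded block functional\<close>

text \<open>The functions of the last \<open>r\<close> letters that arise by fixing the other letters. The two
  definitions that follow do the same for the first letters and for letters in the middle.\<close>

definition suffixes :: "nat \<Rightarrow> (bool \<Rightarrow> word \<Rightarrow> 'k) \<Rightarrow> nat \<Rightarrow> (word \<Rightarrow> 'k) set" where
  "suffixes l \<phi> r = {\<lambda>w. \<phi> a (u @ w) | a u. length u + r = l}"

definition prefixes :: "nat \<Rightarrow> (bool \<Rightarrow> word \<Rightarrow> 'k) \<Rightarrow> nat \<Rightarrow> (word \<Rightarrow> 'k) set" where
  "prefixes l \<phi> r = {\<lambda>w. \<phi> a (w @ u) | a u. length u + r = l}"

definition infixes :: "nat \<Rightarrow> (bool \<Rightarrow> word \<Rightarrow> 'k) \<Rightarrow> nat \<Rightarrow> (word \<Rightarrow> 'k) set" where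
  "infixes l \<phi> r = {\<lambda>w. \<phi> a (u @ w @ v) | a u v. length u + r + length v = l}"

text \<open>A cut between two blocks leaves an empty part of a block. A function of it is a scalar, and need not
  arise from a function \<open>\<phi> a\<close>.\<close>

definition suffixes1 :: "nat \<Rightarrow> (bool \<Rightarrow> word \<Rightarrow> 'k::comm_ring_1) \<Rightarrow> nat \<Rightarrow> (word \<Rightarrow> 'k) set" where
  "suffixes1 l \<phi> r = (if r = 0 then UNIV else suffixes l \<phi> r)"

definition prefixes1 :: "nat \<Rightarrow> (bool \<Rightarrow> word \<Rightarrow> 'k::comm_ring_1) \<Rightarrow> nat \<Rightarrow> (word \<Rightarrow> 'k) set" where
  "prefixes1 l \<phi> r = (if r = 0 then UNIV else prefixes l \<phi> r)"

definition tensors :: "nat \<Rightarrow> nat \<Rightarrow> (word \<Rightarrow> 'k::comm_ring_1) set \<Rightarrow> (word \<Rightarrow> 'k) set \<Rightarrow> (word \<Rightarrow> 'k) set" where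
  "tensors a b L M = {f. \<exists>g\<in>L. \<exists>h\<in>M. \<forall>x\<in>bwords a. \<forall>y\<in>bwords b. f (x @ y) = g x * h y}"

lemma spanned_on_tensors:
  assumes "spanned_on (bwords a) L N" "spanned_on (bwords b) M K"
  shows "spanned_on (bwords (a + b)) (tensors a b L M) (N * K)"
  by (rule spanned_on_tensor[OF assms, where a = a])
    (auto simp: tensors_def length_bwords dest: bwords_split)

lemma spanned_on_prefixes1: "\<lbrakk>spanned_on (bwords r) (prefixes l \<phi> r) N; 1 \<le> N\<rbrakk> \<Longrightarrow>
   spanned_on (bwords r) (prefixes1 l \<phi> r) N"
  by (cases "r = 0") (auto simp: prefixes1_def intro: spanned_on_all)

lemma spanned_on_suffixes1: "\<lbrakk>spanned_on (bwords r) (suffixes l \<phi> r) N; 1 \<le> N\<rbrakk> \<Longrightarrow>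
   spanned_on (bwords r) (suffixes1 l \<phi> r) N"
  by (cases "r = 0") (auto simp: suffixes1_def intro: spanned_on_all)

lemma blocks_cut_suffix:
  assumes "0 < r" "r \<le> l" "length u + r = l * length xs"
  shows "\<exists>c. \<exists>g\<in>suffixes l \<phi> r. \<forall>w\<in>bwords r. blocks l (map \<phi> xs) (u @ w) = c * g w"
proof -
  from assms have "xs \<noteq> []" by auto
  then obtain ys x where xs: "xs = ys @ [x]" by (metis rev_exhaust)
  have len: "length u = l * length ys + (l - r)" using assms xs by (simp add: algebra_simps)
  define u1 u2 where "u1 = take (l * length ys) u" and "u2 = drop (l * length ys) u"
  have u: "u = u1 @ u2" "length u1 = l * length ys" "length u2 = l - r"
    using len by (auto simp: u1_def u2_def)
  show ?thesis
  proof (intro exI[of _ "blocks l (map \<phi> ys) u1"] bexI[of _ "\<lambda>w. \<phi> x (u2 @ w)"] ballI)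
    fix w assume "w \<in> bwords r"
    then have "length (u2 @ w) = l" using u assms by (simp add: length_bwords)
    then show "blocks l (map \<phi> xs) (u @ w) = blocks l (map \<phi> ys) u1 * \<phi> x (u2 @ w)"
      using u by (simp add: xs blocks_append)
  next
    show "(\<lambda>w. \<phi> x (u2 @ w)) \<in> suffixes l \<phi> r"
      using u assms unfolding suffixes_def
      by (auto intro!: exI[of _ x] exI[of _ u2])
  qed
qed

lemma blocks_cut_prefix:
  assumes "0 < r" "r \<le> l" "r + length v = l * length xs"
  shows "\<exists>c. \<exists>g\<in>prefixes l \<phi> r. \<forall>w\<in>bwords r. blocks l (map \<phi> xs) (w @ v) = c * g w"
proof -
  from assms have "xs \<noteq> []" by auto
  then obtain ys x where xs: "xs = x # ys" by (metis list.exhaust)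
  have len: "length v = (l - r) + l * length ys" using assms xs by simp
  show ?thesis
  proof (intro exI[of _ "blocks l (map \<phi> ys) (drop (l - r) v)"]
      bexI[of _ "\<lambda>w. \<phi> x (w @ take (l - r) v)"] ballI)
    fix w assume "w \<in> bwords r"
    then have "length w = r" by (rule length_bwords)
    then show "blocks l (map \<phi> xs) (w @ v) = blocks l (map \<phi> ys) (drop (l - r) v) * \<phi> x (w @ take (l - r) v)"
      using assms by (simp add: xs)
  next
    show "(\<lambda>w. \<phi> x (w @ take (l - r) v)) \<in> prefixes l \<phi> r"
      using len assms unfolding prefixes_def
      by (auto intro!: exI[of _ x] exI[of _ "take (l - r) v"])
  qed
qed

lemma blocks_partial_suffix:
  assumes "r < l" "length u + r = l * length xs"
  shows "\<exists>c. \<exists>g\<in>suffixes1 l \<phi> r. \<forall>w\<in>bwords r. blocks l (map \<phi> xs) (u @ w) = c * g w"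
proof (cases "r = 0")
  case True
  then show ?thesis
    by (intro exI[of _ "blocks l (map \<phi> xs) u"] bexI[of _ "\<lambda>_. 1"]) (auto simp: suffixes1_def)
next
  case False
  then show ?thesis using blocks_cut_suffix[of r l u xs \<phi>] assms by (simp add: suffixes1_def)
qed

lemma blocks_partial_prefix:
  assumes "r < l" "r + length v = l * length xs"
  shows "\<exists>c. \<exists>g\<in>prefixes1 l \<phi> r. \<forall>w\<in>bwords r. blocks l (map \<phi> xs) (w @ v) = c * g w"
proof (cases "r = 0")
  case True
  then show ?thesis
    by (intro exI[of _ "blocks l (map \<phi> xs) v"] bexI[of _ "\<lambda>_. 1"]) (auto simp: prefixes1_def)
next
  case False
  then show ?thesis using blocks_cut_prefix[of r l v xs \<phi>] assms by (simp add: prefixes1_def)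
qed

text \<open>Complete blocks occur as products of the functions of a level, indexed by lists of truth values.\<close>

definition patterns :: "nat \<Rightarrow> (bool \<Rightarrow> word \<Rightarrow> 'k::comm_ring_1) \<Rightarrow> bool list set \<Rightarrow> (word \<Rightarrow> 'k) set" where
  "patterns l \<phi> E = (\<lambda>e. blocks l (map \<phi> e)) ` E"

lemma spanned_on_patterns: "\<lbrakk>finite E; card E \<le> N\<rbrakk> \<Longrightarrow> spanned_on S (patterns l \<phi> E) N"
  unfolding patterns_def by (intro spanned_on_finite) (auto intro: card_image_le le_trans)

lemma card_padded_lists: "card ((\<lambda>e. replicate n False @ e) ` bools m) \<le> 2 ^ m"
  by (metis card_bools card_image_le finite_bools)

text \<open>The last \<open>r + l k\<close> letters, \<open>r < l\<close>, consist of a suffix of a block and \<open>k\<close> complete blocks. Of the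
  latter, only the last \<open>min k T\<close> are not padding; this is the number of binary choices in a pattern.\<close>

lemma padded_suffix:
  assumes "r < l" "k \<le> K + T" "length u + (r + l * k) = l * (K + T)"
  shows "(\<lambda>w. padded l \<phi> K T c (u @ w)) \<in> combos (bwords (r + l * k))
    (tensors r (l * k) (suffixes1 l \<phi> r)
      (patterns l \<phi> ((\<lambda>e. replicate (k - T) False @ e) ` bools (min k T))))"
proof (rule combos_sum[OF finite_bools, where h = "\<lambda>e w. blocks l (map \<phi> (replicate K False @ e)) (u @ w)"])
  fix e :: "bool list" assume "e \<in> bools T"
  then have e: "length e = T" by (simp add: bools_def)
  let ?xs = "replicate K False @ e" and ?j = "K + T - k"
  have lt: "length (take ?j ?xs) = ?j" using e by simp
  have len: "length u + r = l * length (take ?j ?xs)"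
    unfolding lt diff_mult_distrib2 using assms(3) by simp
  obtain d g where g: "g \<in> suffixes1 l \<phi> r"
    "\<And>w. w \<in> bwords r \<Longrightarrow> blocks l (map \<phi> (take ?j ?xs)) (u @ w) = d * g w"
    using blocks_partial_suffix[OF assms(1) len, of \<phi>] by blast
  have drop: "drop ?j ?xs = replicate (k - T) False @ drop (T - k) e"
  proof -
    have "K - (K + T - k) = k - T" "K + T - k - K = T - k" using assms(2) by linarith+
    then show ?thesis by simp
  qed
  have pat: "blocks l (map \<phi> (drop ?j ?xs))
      \<in> patterns l \<phi> ((\<lambda>e. replicate (k - T) False @ e) ` bools (min k T))"
    unfolding patterns_def drop using e by (intro imageI) (auto simp: bools_def)
  have eq: "blocks l (map \<phi> ?xs) (u @ x @ y) = d * (g x * blocks l (map \<phi> (drop ?j ?xs)) y)"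
    if "x \<in> bwords r" for x y
  proof -
    have "blocks l (map \<phi> ?xs) (u @ x @ y)
      = blocks l (map \<phi> (take ?j ?xs) @ map \<phi> (drop ?j ?xs)) ((u @ x) @ y)"
      by (simp only: map_append[symmetric] append_take_drop_id append_assoc)
    also have "\<dots> = blocks l (map \<phi> (take ?j ?xs)) (u @ x) * blocks l (map \<phi> (drop ?j ?xs)) y"
      using len that by (intro blocks_append) (simp add: length_bwords)
    finally show ?thesis using g(2)[OF that] by (simp add: mult.assoc)
  qed
  show "(\<lambda>w. blocks l (map \<phi> ?xs) (u @ w)) \<in> combos (bwords (r + l * k)) (tensors r (l * k) (suffixes1 l \<phi> r)
      (patterns l \<phi> ((\<lambda>e. replicate (k - T) False @ e) ` bools (min k T))))"
  proof (rule combos_base[where c = d and g = "\<lambda>w. g (take r w) * blocks l (map \<phi> (drop ?j ?xs)) (drop r w)"])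
    show "(\<lambda>w. g (take r w) * blocks l (map \<phi> (drop ?j ?xs)) (drop r w))
      \<in> tensors r (l * k) (suffixes1 l \<phi> r)
        (patterns l \<phi> ((\<lambda>e. replicate (k - T) False @ e) ` bools (min k T)))"
      unfolding tensors_def using g(1) pat by (fastforce simp: length_bwords)
    fix w assume "w \<in> bwords (r + l * k)"
    then obtain x y where "x \<in> bwords r" "w = x @ y" using bwords_split by blast
    then show "blocks l (map \<phi> ?xs) (u @ w) = d * (g (take r w) * blocks l (map \<phi> (drop ?j ?xs)) (drop r w))"
      using eq by (simp add: length_bwords)
  qed
qed (simp add: padded_def)

text \<open>The first \<open>l k + r\<close> letters, \<open>r < l\<close>, consist of \<open>k\<close> complete blocks and a prefix of a block. The
  first \<open>K\<close> blocks are padding, which leaves \<open>k - K\<close> binary choices.\<close>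

lemma padded_prefix:
  assumes "r < l" "k \<le> K + T" "(l * k + r) + length v = l * (K + T)"
  shows "(\<lambda>w. padded l \<phi> K T c (w @ v)) \<in> combos (bwords (l * k + r))
    (tensors (l * k) r (patterns l \<phi> ((\<lambda>e. replicate (min k K) False @ e) ` bools (k - K)))
      (prefixes1 l \<phi> r))"
proof (rule combos_sum[OF finite_bools, where h = "\<lambda>e w. blocks l (map \<phi> (replicate K False @ e)) (w @ v)"])
  fix e :: "bool list" assume "e \<in> bools T"
  then have e: "length e = T" by (simp add: bools_def)
  let ?xs = "replicate K False @ e"
  have len: "r + length v = l * length (drop k ?xs)"
    using assms e by (simp add: diff_mult_distrib2 add_mult_distrib2)
  obtain d g where g: "g \<in> prefixes1 l \<phi> r"
    "\<And>w. w \<in> bwords r \<Longrightarrow> blocks l (map \<phi> (drop k ?xs)) (w @ v) = d * g w"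
    using blocks_partial_prefix[OF assms(1) len, of \<phi>] by blast
  have pat: "blocks l (map \<phi> (take k ?xs))
      \<in> patterns l \<phi> ((\<lambda>e. replicate (min k K) False @ e) ` bools (k - K))"
    unfolding patterns_def using e assms(2) by (intro imageI) (auto simp: bools_def min.commute)
  have lt: "length (take k ?xs) = k" using e assms(2) by simp
  have eq: "blocks l (map \<phi> ?xs) (x @ y @ v) = d * (blocks l (map \<phi> (take k ?xs)) x * g y)"
    if "x \<in> bwords (l * k)" "y \<in> bwords r" for x y
  proof -
    have "blocks l (map \<phi> ?xs) (x @ y @ v)
      = blocks l (map \<phi> (take k ?xs) @ map \<phi> (drop k ?xs)) (x @ y @ v)"
      by (simp only: map_append[symmetric] append_take_drop_id)
    also have "\<dots> = blocks l (map \<phi> (take k ?xs)) x * blocks l (map \<phi> (drop k ?xs)) (y @ v)"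
      by (rule blocks_append) (simp only: length_map lt length_bwords[OF that(1)])
    finally show ?thesis using g(2)[OF that(2)] by (simp add: mult_ac)
  qed
  show "(\<lambda>w. blocks l (map \<phi> ?xs) (w @ v)) \<in> combos (bwords (l * k + r))
    (tensors (l * k) r (patterns l \<phi> ((\<lambda>e. replicate (min k K) False @ e) ` bools (k - K)))
      (prefixes1 l \<phi> r))"
  proof (rule combos_base[where c = d
        and g = "\<lambda>w. blocks l (map \<phi> (take k ?xs)) (take (l * k) w) * g (drop (l * k) w)"])
    show "(\<lambda>w. blocks l (map \<phi> (take k ?xs)) (take (l * k) w) * g (drop (l * k) w))
      \<in> tensors (l * k) r (patterns l \<phi> ((\<lambda>e. replicate (min k K) False @ e) ` bools (k - K)))
      (prefixes1 l \<phi> r)"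
      unfolding tensors_def using g(1) pat by (fastforce simp: length_bwords)
    fix w assume "w \<in> bwords (l * k + r)"
    then obtain x y where "x \<in> bwords (l * k)" "y \<in> bwords r" "w = x @ y" using bwords_split by blast
    then show "blocks l (map \<phi> ?xs) (w @ v)
      = d * (blocks l (map \<phi> (take k ?xs)) (take (l * k) w) * g (drop (l * k) w))"
      using eq by (simp add: length_bwords)
  qed
qed (simp add: padded_def)

text \<open>Consecutive blocks of a padded row: padding, followed by at most \<open>T\<close> blocks of arbitrary type.\<close>

definition inner_patterns :: "nat \<Rightarrow> nat \<Rightarrow> bool list set" where
  "inner_patterns T k = (\<Union>b\<in>{..T}. (\<lambda>e. replicate (k - b) False @ e) ` bools b)"

lemma inner_patterns: "finite (inner_patterns T k)" "card (inner_patterns T k) \<le> 2 ^ (T + 1)"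
proof -
  show "finite (inner_patterns T k)" by (simp add: inner_patterns_def finite_bools)
  have "card (inner_patterns T k) \<le> (\<Sum>b\<le>T. card ((\<lambda>e. replicate (k - b) False @ e) ` bools b))"
    unfolding inner_patterns_def by (rule card_UN_le) simp
  also have "\<dots> \<le> (\<Sum>b\<le>T. 2 ^ b)" by (intro sum_mono card_padded_lists)
  also have "\<dots> \<le> 2 ^ (T + 1)" by (induction T) auto
  finally show "card (inner_patterns T k) \<le> 2 ^ (T + 1)" .
qed

text \<open>A window in the middle consists of a suffix of a block, complete blocks and a prefix of a block.\<close>

lemma padded_infix:
  assumes "0 < l" "l \<le> m" "length u + m + length v = l * (K + T)"
  shows "\<exists>r<l. (\<lambda>w. padded l \<phi> K T c (u @ w @ v)) \<in> combos (bwords m)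
    (tensors r (m - r) (suffixes1 l \<phi> r)
      (tensors (l * ((m - r) div l)) ((m - r) mod l) (patterns l \<phi> (inner_patterns T ((m - r) div l)))
        (prefixes1 l \<phi> ((m - r) mod l))))"
proof -
  \<comment> \<open>The window starts in the block before block \<open>j\<close> or at the beginning of
    block \<open>j\<close>; the quotient is rounded up.\<close>
  define j where "j = (length u + (l - 1)) div l"
  have j: "length u \<le> l * j" "l * j < length u + l"
  proof -
    have "(length u + (l - 1)) = l * j + (length u + (l - 1)) mod l" by (simp add: j_def)
    moreover have "(length u + (l - 1)) mod l < l" using assms(1) by simp
    ultimately show "length u \<le> l * j" "l * j < length u + l" using assms(1) by linarith+
  qed
  define r where "r = l * j - length u"
  have r: "r < l" "length u + r = l * j" using j by (auto simp: r_def)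
  define k where "k = (m - r) div l"
  define s where "s = (m - r) mod l"
  have s: "s < l" using assms(1) by (simp add: s_def)
  have ks: "m - r = l * k + s" by (simp add: k_def s_def)
  have m: "m = r + (l * k + s)" using ks r assms(2) by simp
  have tot: "l * j + (l * k + s) + length v = l * (K + T)" using assms(3) m r by simp
  have jk: "j + k \<le> K + T"
  proof -
    have "l * (j + k) \<le> l * (K + T)" using tot by (simp add: add_mult_distrib2)
    then show ?thesis using assms(1) by simp
  qed
  let ?target = "tensors r (l * k + s) (suffixes1 l \<phi> r)
      (tensors (l * k) s (patterns l \<phi> (inner_patterns T k)) (prefixes1 l \<phi> s))"
  have "(\<lambda>w. padded l \<phi> K T c (u @ w @ v)) \<in> combos (bwords m) ?target"
  proof (rule combos_sum[OF finite_bools, where h = "\<lambda>e w. blocks l (map \<phi> (replicate K False @ e)) (u @ w @ v)"])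
    fix e :: "bool list" assume "e \<in> bools T"
    then have e: "length e = T" by (simp add: bools_def)
    let ?xs = "replicate K False @ e"
    obtain a b c where abc: "?xs = a @ b @ c" "length a = j" "length b = k" "length c = K + T - (j + k)"
      and b: "b \<in> inner_patterns T k"
    proof
      let ?b = "take k (drop j ?xs)"
      show "?xs = take j ?xs @ ?b @ drop k (drop j ?xs)" by (simp only: append_take_drop_id)
      show "length (take j ?xs) = j" "length ?b = k" "length (drop k (drop j ?xs)) = K + T - (j + k)"
        using jk e by auto
      let ?e = "take (k - (K - j)) (drop (j - K) e)"
      have "?b = replicate (k - length ?e) False @ ?e"
        using jk e by (auto simp: min_def)
      moreover have "length ?e \<le> T" using e by simp
      ultimately show "?b \<in> inner_patterns T k" unfolding inner_patterns_def
        by (intro UN_I[of "length ?e"] image_eqI[of _ _ ?e]) (auto simp: bools_def)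
    qed
    have lc: "s + length v = l * length c"
      unfolding abc using tot jk by (simp add: diff_mult_distrib2 add_mult_distrib2)
    obtain d g where g: "g \<in> suffixes1 l \<phi> r"
      "\<And>w. w \<in> bwords r \<Longrightarrow> blocks l (map \<phi> a) (u @ w) = d * g w"
      using blocks_partial_suffix[OF r(1), of u a \<phi>] r(2) abc by auto
    obtain d' h where h: "h \<in> prefixes1 l \<phi> s"
      "\<And>w. w \<in> bwords s \<Longrightarrow> blocks l (map \<phi> c) (w @ v) = d' * h w"
      using blocks_partial_prefix[OF s lc, of \<phi>] by blast
    have pat: "blocks l (map \<phi> b) \<in> patterns l \<phi> (inner_patterns T k)"
      using b unfolding patterns_def by (rule imageI)
    have eq: "blocks l (map \<phi> ?xs) (u @ x @ (y @ z) @ v) = (d * d') * (g x * (blocks l (map \<phi> b) y * h z))"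
      if "x \<in> bwords r" "y \<in> bwords (l * k)" "z \<in> bwords s" for x y z
    proof -
      have "blocks l (map \<phi> ?xs) (u @ x @ (y @ z) @ v)
        = blocks l (map \<phi> a @ map \<phi> b @ map \<phi> c) ((u @ x) @ y @ (z @ v))"
        unfolding abc(1) by simp
      also have "\<dots> = blocks l (map \<phi> a) (u @ x) * blocks l (map \<phi> b @ map \<phi> c) (y @ (z @ v))"
        by (rule blocks_append) (use r abc that in \<open>simp add: length_bwords\<close>)
      also have "blocks l (map \<phi> b @ map \<phi> c) (y @ (z @ v))
        = blocks l (map \<phi> b) y * blocks l (map \<phi> c) (z @ v)"
        by (rule blocks_append) (use abc that in \<open>simp add: length_bwords\<close>)
      finally show ?thesis using g(2)[OF that(1)] h(2)[OF that(3)] by (simp add: mult_ac)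
    qed
    let ?h = "\<lambda>w. blocks l (map \<phi> b) (take (l * k) w) * h (drop (l * k) w)"
    have th: "?h \<in> tensors (l * k) s (patterns l \<phi> (inner_patterns T k)) (prefixes1 l \<phi> s)"
      unfolding tensors_def using h(1) pat by (fastforce simp: length_bwords)
    show "(\<lambda>w. blocks l (map \<phi> ?xs) (u @ w @ v)) \<in> combos (bwords m) ?target"
    proof (rule combos_base[where c = "d * d'" and g = "\<lambda>w. g (take r w) * ?h (drop r w)"])
      show "(\<lambda>w. g (take r w) * ?h (drop r w)) \<in> ?target"
        unfolding tensors_def[of r] using g(1) th by (fastforce simp: length_bwords)
      fix w assume "w \<in> bwords m"
      then obtain x y z where "x \<in> bwords r" "y \<in> bwords (l * k)" "z \<in> bwords s" "w = x @ y @ z"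
        unfolding m using bwords_split by metis
      then show "blocks l (map \<phi> ?xs) (u @ w @ v) = (d * d') * (g (take r w) * ?h (drop r w))"
        using eq by (simp add: length_bwords)
    qed
  qed (simp add: padded_def)
  from this[folded ks, unfolded k_def s_def] show ?thesis
    by (intro exI[of _ r] conjI r(1))
qed

section \<open>Ranks of windows of a padded block functional\<close>

definition windows_ranked :: "nat \<Rightarrow> (bool \<Rightarrow> word \<Rightarrow> 'k::comm_ring_1) \<Rightarrow> nat \<Rightarrow> bool" where
  "windows_ranked l \<phi> \<sigma> \<longleftrightarrow> (\<forall>r\<le>l. spanned_on (bwords r) (suffixes l \<phi> r) \<sigma> \<and>
     spanned_on (bwords r) (prefixes l \<phi> r) \<sigma>)"

text \<open>Windows of length \<open>m\<close> across the boundary of two blocks, with \<open>a\<close> letters before the boundary.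
  Linear combinations are admitted on each side, since the blocks are cut out of functions of a
  higher level.\<close>

definition straddles :: "nat \<Rightarrow> (bool \<Rightarrow> word \<Rightarrow> 'k::comm_ring_1) \<Rightarrow> nat \<Rightarrow> nat \<Rightarrow> (word \<Rightarrow> 'k) set" where
  "straddles l \<phi> m a = tensors a (m - a) {g. g \<in> combos (bwords a) (suffixes l \<phi> a)}
      {g. g \<in> combos (bwords (m - a)) (prefixes l \<phi> (m - a))}"

lemma spanned_on_combos_set:
  "spanned_on S L N \<Longrightarrow> spanned_on S {f. f \<in> combos S L} N"
  by (rule spanned_on_combos) auto

context
  fixes l \<sigma> K T :: nat and \<phi> :: "bool \<Rightarrow> word \<Rightarrow> 'k::comm_ring_1" and c :: "bool \<Rightarrow> bool list \<Rightarrow> 'k"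
  assumes l: "0 < l" and \<sigma>: "1 \<le> \<sigma>" and ranked: "windows_ranked l \<phi> \<sigma>"
begin

lemma spanned_on_padded_suffixes:
  assumes "a \<le> l * (K + T)"
  shows "spanned_on (bwords a) (suffixes (l * (K + T)) (\<lambda>b. padded l \<phi> K T (c b)) a)
    (\<sigma> * 2 ^ min (a div l) T)"
proof -
  define r k where "r = a mod l" and "k = a div l"
  have a: "a = r + l * k" "r < l" using l by (simp_all add: r_def k_def)
  have k: "k \<le> K + T" using assms l div_le_mono[OF assms, of l] by (simp add: k_def)
  have "spanned_on (bwords (r + l * k)) (tensors r (l * k) (suffixes1 l \<phi> r)
      (patterns l \<phi> ((\<lambda>e. replicate (k - T) False @ e) ` bools (min k T)))) (\<sigma> * 2 ^ min k T)"
    using ranked a(2) \<sigma>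
    by (intro spanned_on_tensors spanned_on_suffixes1 spanned_on_patterns card_padded_lists)
      (auto simp: windows_ranked_def finite_bools)
  then have "spanned_on (bwords (r + l * k)) (suffixes (l * (K + T)) (\<lambda>b. padded l \<phi> K T (c b)) a)
      (\<sigma> * 2 ^ min k T)"
  proof (rule spanned_on_combos)
    fix f assume "f \<in> suffixes (l * (K + T)) (\<lambda>b. padded l \<phi> K T (c b)) a"
    then obtain b u where "f = (\<lambda>w. padded l \<phi> K T (c b) (u @ w))" "length u + a = l * (K + T)"
      unfolding suffixes_def by blast
    then show "f \<in> combos (bwords (r + l * k)) (tensors r (l * k) (suffixes1 l \<phi> r)
      (patterns l \<phi> ((\<lambda>e. replicate (k - T) False @ e) ` bools (min k T))))"
      using padded_suffix[OF a(2) k] a(1) by metis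
  qed
  from this[folded a(1)] show ?thesis unfolding k_def .
qed

lemma spanned_on_padded_prefixes:
  assumes "a \<le> l * (K + T)"
  shows "spanned_on (bwords a) (prefixes (l * (K + T)) (\<lambda>b. padded l \<phi> K T (c b)) a)
    (2 ^ (a div l - K) * \<sigma>)"
proof -
  define r k where "r = a mod l" and "k = a div l"
  have a: "a = l * k + r" "r < l" using l by (simp_all add: r_def k_def)
  have k: "k \<le> K + T" using assms l div_le_mono[OF assms, of l] by (simp add: k_def)
  have "spanned_on (bwords (l * k + r)) (tensors (l * k) r
      (patterns l \<phi> ((\<lambda>e. replicate (min k K) False @ e) ` bools (k - K))) (prefixes1 l \<phi> r))
      (2 ^ (k - K) * \<sigma>)"
    using ranked a(2) \<sigma>
    by (intro spanned_on_tensors spanned_on_prefixes1 spanned_on_patterns card_padded_lists)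
      (auto simp: windows_ranked_def finite_bools)
  then have "spanned_on (bwords (l * k + r)) (prefixes (l * (K + T)) (\<lambda>b. padded l \<phi> K T (c b)) a)
      (2 ^ (k - K) * \<sigma>)"
  proof (rule spanned_on_combos)
    fix f assume "f \<in> prefixes (l * (K + T)) (\<lambda>b. padded l \<phi> K T (c b)) a"
    then obtain b u where "f = (\<lambda>w. padded l \<phi> K T (c b) (w @ u))" "a + length u = l * (K + T)"
      unfolding prefixes_def by (auto simp: add.commute)
    then show "f \<in> combos (bwords (l * k + r)) (tensors (l * k) r
      (patterns l \<phi> ((\<lambda>e. replicate (min k K) False @ e) ` bools (k - K))) (prefixes1 l \<phi> r))"
      using padded_prefix[OF a(2) k] a(1) by metis
  qed
  from this[folded a(1)] show ?thesis unfolding k_def .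
qed

text \<open>Here the padding pays off: among the complete blocks in a suffix or a prefix, at most \<open>T\<close> are free,
  however large \<open>K\<close> is.\<close>

lemma windows_ranked_padded:
  "windows_ranked (l * (K + T)) (\<lambda>b. padded l \<phi> K T (c b)) (\<sigma> * 2 ^ T)"
  unfolding windows_ranked_def
proof (intro allI impI conjI)
  fix r assume r: "r \<le> l * (K + T)"
  show "spanned_on (bwords r) (suffixes (l * (K + T)) (\<lambda>b. padded l \<phi> K T (c b)) r) (\<sigma> * 2 ^ T)"
    by (rule spanned_on_le[OF spanned_on_padded_suffixes[OF r]]) simp
  have "r div l - K \<le> T" using div_le_mono[OF r, of l] l by simp
  then have "2 ^ (r div l - K) * \<sigma> \<le> \<sigma> * 2 ^ T" by simp
  then show "spanned_on (bwords r) (prefixes (l * (K + T)) (\<lambda>b. padded l \<phi> K T (c b)) r) (\<sigma> * 2 ^ T)"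
    by (rule spanned_on_le[OF spanned_on_padded_prefixes[OF r]])
qed

lemma spanned_on_padded_infixes:
  assumes "l \<le> m"
  shows "spanned_on (bwords m) (infixes (l * (K + T)) (\<lambda>b. padded l \<phi> K T (c b)) m)
    (l * (\<sigma> * (2 ^ (T + 1) * \<sigma>)))"
proof -
  define target where "target r = tensors r (m - r) (suffixes1 l \<phi> r)
      (tensors (l * ((m - r) div l)) ((m - r) mod l) (patterns l \<phi> (inner_patterns T ((m - r) div l)))
        (prefixes1 l \<phi> ((m - r) mod l)))" for r
  have "spanned_on (bwords m) {f. f \<in> combos (bwords m) (target r)} (\<sigma> * (2 ^ (T + 1) * \<sigma>))"
    if r: "r \<in> {..<l}" for r
  proof (rule spanned_on_combos_set)
    let ?s = "(m - r) mod l" and ?k = "(m - r) div l"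
    have s: "?s < l" using l by simp
    have "spanned_on (bwords (l * ?k + ?s)) (tensors (l * ?k) ?s (patterns l \<phi> (inner_patterns T ?k))
        (prefixes1 l \<phi> ?s)) (2 ^ (T + 1) * \<sigma>)"
      using ranked s \<sigma>
      by (intro spanned_on_tensors spanned_on_prefixes1 spanned_on_patterns inner_patterns)
        (auto simp: windows_ranked_def)
    then have "spanned_on (bwords (m - r)) (tensors (l * ?k) ?s (patterns l \<phi> (inner_patterns T ?k))
        (prefixes1 l \<phi> ?s)) (2 ^ (T + 1) * \<sigma>)" by simp
    then have "spanned_on (bwords (r + (m - r))) (target r) (\<sigma> * (2 ^ (T + 1) * \<sigma>))"
      unfolding target_def using ranked r \<sigma>
      by (intro spanned_on_tensors spanned_on_suffixes1) (auto simp: windows_ranked_def)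
    then show "spanned_on (bwords m) (target r) (\<sigma> * (2 ^ (T + 1) * \<sigma>))"
      using r assms by simp
  qed
  note st = this
  have "spanned_on (bwords m) (infixes (l * (K + T)) (\<lambda>b. padded l \<phi> K T (c b)) m)
    (\<Sum>r\<in>{..<l}. \<sigma> * (2 ^ (T + 1) * \<sigma>))"
  proof (rule spanned_on_UN[OF finite_lessThan st])
    fix f assume "f \<in> infixes (l * (K + T)) (\<lambda>b. padded l \<phi> K T (c b)) m"
    then obtain b u v where f: "f = (\<lambda>w. padded l \<phi> K T (c b) (u @ w @ v))"
      "length u + m + length v = l * (K + T)" unfolding infixes_def by blast
    from padded_infix[OF l assms f(2)] show "\<exists>r\<in>{..<l}. f \<in> {f. f \<in> combos (bwords m) (target r)}"
      unfolding f(1) target_def by auto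
  qed
  then show ?thesis by simp
qed

text \<open>A window straddling two blocks of the new level sees the end of the first one and
  the beginning of the second. Both together have at most \<open>T\<close> binary choices: the beginning of a block
  is padding, and the window is not longer than a block, so that the more of the \<open>T\<close> free blocks
  it reaches at one side, the fewer it reaches at the other. Therefore \<open>2\<^sup>T\<close> appears here to the
  first power, which the bound \<open>m\<^sup>3\<close> on the growth relies on. For windows inside a block, there are \<open>l\<close>
  positions relative to the blocks of the old level, and at most \<open>2\<^bsup>T+1\<^esup>\<close> patterns for each.\<close>

lemma spanned_on_padded_windows:
  assumes "l \<le> m" "m \<le> l * (K + T)"
  defines "\<psi> \<equiv> \<lambda>b. padded l \<phi> K T (c b)"
  shows "spanned_on (bwords m)
    (infixes (l * (K + T)) \<psi> m \<union> (\<Union>a\<in>{1..<m}. straddles (l * (K + T)) \<psi> m a))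
    (3 * m * \<sigma>\<^sup>2 * 2 ^ T)"
proof -
  have st: "spanned_on (bwords m) (straddles (l * (K + T)) \<psi> m a) (\<sigma>\<^sup>2 * 2 ^ T)"
    if a: "a \<in> {1..<m}" for a
  proof -
    let ?b = "m - a"
    have le: "a \<le> l * (K + T)" "?b \<le> l * (K + T)" using a assms by auto
    have "spanned_on (bwords (a + ?b)) (straddles (l * (K + T)) \<psi> m a)
        ((\<sigma> * 2 ^ min (a div l) T) * (2 ^ (?b div l - K) * \<sigma>))"
      unfolding straddles_def \<psi>_def
      by (intro spanned_on_tensors spanned_on_combos_set spanned_on_padded_suffixes
          spanned_on_padded_prefixes le)
    moreover have "(\<sigma> * 2 ^ min (a div l) T) * (2 ^ (?b div l - K) * \<sigma>) \<le> \<sigma>\<^sup>2 * 2 ^ T"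
    proof -
      have "a div l + ?b div l \<le> (a + ?b) div l"
        by (metis div_add1_eq le_add1)
      also have "\<dots> \<le> K + T" using div_le_mono[OF assms(2), of l] a l by simp
      finally have "min (a div l) T + (?b div l - K) \<le> T" by linarith
      then have "(2::nat) ^ (min (a div l) T + (?b div l - K)) \<le> 2 ^ T"
        by (intro power_increasing) auto
      then have "\<sigma>\<^sup>2 * 2 ^ (min (a div l) T + (?b div l - K)) \<le> \<sigma>\<^sup>2 * 2 ^ T" by (rule mult_le_mono2)
      then show ?thesis by (simp add: power_add power2_eq_square mult_ac)
    qed
    moreover have "a + ?b = m" using a by simp
    ultimately show ?thesis by (metis spanned_on_le)
  qed
  have inf: "spanned_on (bwords m) (infixes (l * (K + T)) \<psi> m) (l * (\<sigma> * (2 ^ (T + 1) * \<sigma>)))"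
    unfolding \<psi>_def by (rule spanned_on_padded_infixes[OF assms(1)])
  \<comment> \<open>The index \<open>0\<close>, which is no boundary inside a window, stands for the windows
    inside a single block.\<close>
  define L where "L a = (if a = (0::nat) then infixes (l * (K + T)) \<psi> m else straddles (l * (K + T)) \<psi> m a)" for a
  define N where "N a = (if a = (0::nat) then l * (\<sigma> * (2 ^ (T + 1) * \<sigma>)) else \<sigma>\<^sup>2 * 2 ^ T)" for a
  have "spanned_on (bwords m)
    (infixes (l * (K + T)) \<psi> m \<union> (\<Union>a\<in>{1..<m}. straddles (l * (K + T)) \<psi> m a)) (\<Sum>a\<in>{..<m}. N a)"
  proof (rule spanned_on_UN[where L = L])
    show "spanned_on (bwords m) (L a) (N a)" if "a \<in> {..<m}" for a
      using that st[of a] inf by (auto simp: L_def N_def)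
  next
    fix f assume "f \<in> infixes (l * (K + T)) \<psi> m \<union> (\<Union>a\<in>{1..<m}. straddles (l * (K + T)) \<psi> m a)"
    then consider "f \<in> infixes (l * (K + T)) \<psi> m" | a where "1 \<le> a" "a < m" "f \<in> straddles (l * (K + T)) \<psi> m a"
      by auto
    then show "\<exists>a\<in>{..<m}. f \<in> L a"
    proof cases
      case 1
      then show ?thesis using l assms(1) by (intro bexI[of _ 0]) (simp_all add: L_def)
    next
      case 2
      then show ?thesis by (intro bexI[of _ a]) (simp_all add: L_def)
    qed
  qed simp
  moreover have "(\<Sum>a\<in>{..<m}. N a) \<le> 3 * m * \<sigma>\<^sup>2 * 2 ^ T"
  proof -
    have m0: "0 \<in> {..<m}" using l assms(1) by auto
    have "(\<Sum>a\<in>{..<m}. N a) = N 0 + (\<Sum>a\<in>{..<m} - {0}. N a)"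
      using m0 by (simp add: sum.remove)
    also have "(\<Sum>a\<in>{..<m} - {0}. N a) = (m - 1) * (\<sigma>\<^sup>2 * 2 ^ T)"
      using m0 by (simp add: N_def)
    also have "N 0 = 2 * l * (\<sigma>\<^sup>2 * 2 ^ T)" by (simp add: N_def power2_eq_square)
    also have "2 * l * (\<sigma>\<^sup>2 * 2 ^ T) + (m - 1) * (\<sigma>\<^sup>2 * 2 ^ T) = (2 * l + (m - 1)) * (\<sigma>\<^sup>2 * 2 ^ T)"
      by (simp add: algebra_simps)
    also have "\<dots> \<le> (3 * m) * (\<sigma>\<^sup>2 * 2 ^ T)" using assms(1) by (intro mult_le_mono1) simp
    finally show ?thesis by (simp add: mult.assoc)
  qed
  ultimately show ?thesis by (rule spanned_on_le)
qed

end

lemma combos_scale: "f \<in> combos S L \<Longrightarrow> (\<And>w. w \<in> S \<Longrightarrow> f' w = c * f w) \<Longrightarrow> f' \<in> combos S L"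
  using combos_lin[of f S L "\<lambda>_. 0" c] by (auto intro: combos.zero combos_cong)

text \<open>A window that does not cross a boundary between blocks of length \<open>l\<close> sees a single function \<open>\<phi> x\<close>.
  Together with the lemmas that follow, this describes windows of the new level in terms of the old
  one, and so allows the descent from an arbitrarily high level to a given one.\<close>

lemma padded_inside:
  assumes "0 < m" "length u + m + length v = l * (K + T)" "length u mod l + m \<le> l"
  shows "\<exists>u2 v1. length u2 = length u mod l \<and> length u2 + m + length v1 = l \<and>
    (\<lambda>w. padded l \<phi> K T c (u @ w @ v)) \<in> combos (bwords m) (range (\<lambda>x w. \<phi> x (u2 @ w @ v1)))"
proof -
  let ?j = "length u div l"
  define u1 u2 v1 v2 where "u1 = take (l * ?j) u" and "u2 = drop (l * ?j) u"
    and "v1 = take (l - (length u mod l + m)) v" and "v2 = drop (l - (length u mod l + m)) v"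
  have l: "0 < l" using assms by (cases l) auto
  have u: "u = u1 @ u2" "length u1 = l * ?j" "length u2 = length u mod l"
    by (simp_all add: u1_def u2_def minus_mult_div_eq_mod)
  have j: "?j < K + T"
  proof -
    have "l * ?j \<le> length u" by simp
    then have "l * ?j < l * (K + T)" using assms by linarith
    then show ?thesis using l by simp
  qed
  have "l * ?j + l \<le> l * (K + T)" using j by (metis Suc_leI mult_Suc_right add.commute mult_le_mono2)
  moreover have "l * ?j + length u mod l + m + length v = l * (K + T)" using assms(2) by simp
  ultimately have lv: "l - (length u mod l + m) \<le> length v" using assms(3) by linarith
  have v: "v = v1 @ v2" "length v1 = l - (length u mod l + m)"
    using lv by (simp_all add: v1_def v2_def)
  have "(\<lambda>w. padded l \<phi> K T c (u @ w @ v)) \<in> combos (bwords m) (range (\<lambda>x w. \<phi> x (u2 @ w @ v1)))"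
  proof (rule combos_sum[OF finite_bools, where h = "\<lambda>e w. blocks l (map \<phi> (replicate K False @ e)) (u @ w @ v)"])
    fix e :: "bool list" assume "e \<in> bools T"
    then have e: "length e = T" by (simp add: bools_def)
    let ?gs = "map \<phi> (replicate K False @ e)"
    have eq: "blocks l ?gs (u @ w @ v) = blocks l (take ?j ?gs) u1 * blocks l (drop (Suc ?j) ?gs) v2
        * \<phi> ((replicate K False @ e) ! ?j) (u2 @ w @ v1)" if "w \<in> bwords m" for w
    proof -
      have "?j < length ?gs" using j e by simp
      moreover have "length (u2 @ w @ v1) = l" using u(3) v(2) assms(3) length_bwords[OF that]
        unfolding length_append by linarith
      ultimately have "blocks l ?gs (u1 @ (u2 @ w @ v1) @ v2)
        = blocks l (take ?j ?gs) u1 * (?gs ! ?j) (u2 @ w @ v1) * blocks l (drop (Suc ?j) ?gs) v2"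
        using u(2) by (intro blocks_nth)
      moreover have "u @ w @ v = u1 @ (u2 @ w @ v1) @ v2" using u(1) v(1) by simp
      moreover have "?gs ! ?j = \<phi> ((replicate K False @ e) ! ?j)" by (rule nth_map) (use j e in simp)
      ultimately show ?thesis by (simp only: mult_ac)
    qed
    show "(\<lambda>w. blocks l ?gs (u @ w @ v)) \<in> combos (bwords m) (range (\<lambda>x w. \<phi> x (u2 @ w @ v1)))"
      by (rule combos_base[where g = "\<lambda>w. \<phi> ((replicate K False @ e) ! ?j) (u2 @ w @ v1)"
          and c = "blocks l (take ?j ?gs) u1 * blocks l (drop (Suc ?j) ?gs) v2"])
        (auto simp only: eq)
  qed (simp add: padded_def)
  moreover have "length u2 + m + length v1 = l" using u(3) v(2) assms(3) by linarith
  ultimately show ?thesis using u(3) by blast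
qed

lemma padded_across:
  assumes "0 < a" "0 < b" "a \<le> l" "b \<le> l" "length u + (a + b) + length v = l * (K + T)" "l dvd length u + a"
  shows "(\<lambda>w. padded l \<phi> K T c (u @ w @ v)) \<in> combos (bwords (a + b)) (tensors a b (suffixes l \<phi> a) (prefixes l \<phi> b))"
proof (rule combos_sum[OF finite_bools, where h = "\<lambda>e w. blocks l (map \<phi> (replicate K False @ e)) (u @ w @ v)"])
  fix e :: "bool list" assume "e \<in> bools T"
  then have e: "length e = T" by (simp add: bools_def)
  let ?xs = "replicate K False @ e"
  have l: "0 < l" using assms by simp
  obtain j where j: "length u + a = l * j" using assms(6) by (elim dvdE)
  have "l * j + (b + length v) = l * (K + T)" using assms(5) j by simp
  then have jk: "j \<le> K + T" "b + length v = l * (K + T - j)"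
    using l by (metis le_add1 nat_mult_le_cancel1, metis add_diff_cancel_left' diff_mult_distrib2)
  have la: "length (take j ?xs) = j" "length (drop j ?xs) = K + T - j" using jk e by auto
  obtain d g where g: "g \<in> suffixes l \<phi> a"
    "\<And>w. w \<in> bwords a \<Longrightarrow> blocks l (map \<phi> (take j ?xs)) (u @ w) = d * g w"
    using blocks_cut_suffix[OF assms(1,3), of u "take j ?xs" \<phi>] unfolding la j by blast
  obtain d' h where h: "h \<in> prefixes l \<phi> b"
    "\<And>w. w \<in> bwords b \<Longrightarrow> blocks l (map \<phi> (drop j ?xs)) (w @ v) = d' * h w"
    using blocks_cut_prefix[OF assms(2,4), of v "drop j ?xs" \<phi>] unfolding la jk(2) by blast
  have eq: "blocks l (map \<phi> ?xs) (u @ (x @ y) @ v) = (d * d') * (g x * h y)"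
    if "x \<in> bwords a" "y \<in> bwords b" for x y
  proof -
    have "blocks l (map \<phi> ?xs) (u @ (x @ y) @ v)
      = blocks l (map \<phi> (take j ?xs) @ map \<phi> (drop j ?xs)) ((u @ x) @ (y @ v))"
      by (simp only: map_append[symmetric] append_take_drop_id append_assoc)
    also have "\<dots> = blocks l (map \<phi> (take j ?xs)) (u @ x) * blocks l (map \<phi> (drop j ?xs)) (y @ v)"
      by (rule blocks_append) (simp only: length_map la length_append length_bwords[OF that(1)] j)
    finally show ?thesis using g(2)[OF that(1)] h(2)[OF that(2)] by (simp only: mult_ac)
  qed
  show "(\<lambda>w. blocks l (map \<phi> ?xs) (u @ w @ v)) \<in> combos (bwords (a + b)) (tensors a b (suffixes l \<phi> a) (prefixes l \<phi> b))"
  proof (rule combos_base[where c = "d * d'" and g = "\<lambda>w. g (take a w) * h (drop a w)"])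
    show "(\<lambda>w. g (take a w) * h (drop a w)) \<in> tensors a b (suffixes l \<phi> a) (prefixes l \<phi> b)"
      unfolding tensors_def using g(1) h(1) by (fastforce simp: length_bwords)
    fix w assume "w \<in> bwords (a + b)"
    then obtain x y where "x \<in> bwords a" "y \<in> bwords b" "w = x @ y" using bwords_split by blast
    then show "blocks l (map \<phi> ?xs) (u @ w @ v) = (d * d') * (g (take a w) * h (drop a w))"
      using eq[of x y] by (simp add: length_bwords)
  qed
qed (simp add: padded_def)

lemma padded_cut_suffix:
  assumes "0 < a" "a \<le> l" "length u + a = l * (K + T)"
  shows "(\<lambda>w. padded l \<phi> K T c (u @ w)) \<in> combos (bwords a) (suffixes l \<phi> a)"
proof (rule combos_sum[OF finite_bools, where h = "\<lambda>e w. blocks l (map \<phi> (replicate K False @ e)) (u @ w)"])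
  fix e :: "bool list" assume "e \<in> bools T"
  then have "length u + a = l * length (replicate K False @ e)" using assms(3) by (simp add: bools_def)
  from blocks_cut_suffix[OF assms(1,2) this, of \<phi>]
  show "(\<lambda>w. blocks l (map \<phi> (replicate K False @ e)) (u @ w)) \<in> combos (bwords a) (suffixes l \<phi> a)"
    by (auto intro: combos_base)
qed (simp add: padded_def)

lemma padded_cut_prefix:
  assumes "0 < a" "a \<le> l" "a + length v = l * (K + T)"
  shows "(\<lambda>w. padded l \<phi> K T c (w @ v)) \<in> combos (bwords a) (prefixes l \<phi> a)"
proof (rule combos_sum[OF finite_bools, where h = "\<lambda>e w. blocks l (map \<phi> (replicate K False @ e)) (w @ v)"])
  fix e :: "bool list" assume "e \<in> bools T"
  then have "a + length v = l * length (replicate K False @ e)" using assms(3) by (simp add: bools_def)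
  from blocks_cut_prefix[OF assms(1,2) this, of \<phi>]
  show "(\<lambda>w. blocks l (map \<phi> (replicate K False @ e)) (w @ v)) \<in> combos (bwords a) (prefixes l \<phi> a)"
    by (auto intro: combos_base)
qed (simp add: padded_def)

section \<open>The tower of block functionals\<close>

text \<open>Take the greatest \<open>T\<close> with \<open>s 2\<^sup>T \<le> l\<^sup>2\<close>, where \<open>s > S\<close>. Then \<open>l\<close> is at most a constant times
  \<open>2\<^bsup>T/2\<^esup>\<close>, so that \<open>2\<^sup>T\<close> exceeds \<open>C (l T + 1)\<close> as soon as \<open>T\<close> is large.\<close>

lemma exponent_choice:
  fixes C S t :: nat
  shows "\<exists>L. \<forall>l\<ge>L. \<exists>T>t. C * (l * T + 1) + 2 \<le> 2 ^ T \<and> S * 2 ^ T \<le> l\<^sup>2"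
proof -
  define s where "s = real S + 1"
  have s: "s > 0" by (simp add: s_def)
  have "eventually (\<lambda>T::nat. real C * (sqrt (2 * s * 2 ^ T) * T + 1) + 2 \<le> 2 ^ T) at_top"
    using s by real_asymp
  then obtain T0 where T0: "\<And>T. T \<ge> T0 \<Longrightarrow> real C * (sqrt (2 * s * 2 ^ T) * T + 1) + 2 \<le> 2 ^ T"
    unfolding eventually_at_top_linorder by blast
  define T1 where "T1 = max T0 (t + 1)"
  obtain L :: nat where L: "s * 2 ^ T1 \<le> L" using real_arch_simple by blast
  have "\<exists>T>t. C * (l * T + 1) + 2 \<le> 2 ^ T \<and> S * 2 ^ T \<le> l\<^sup>2" if l: "l \<ge> max L 1" for l
  proof -
    define good where "good T \<longleftrightarrow> s * 2 ^ T \<le> (real l)\<^sup>2" for T :: nat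
    have "s * 2 ^ T1 \<le> real l" using L l by linarith
    also have "\<dots> \<le> (real l)\<^sup>2" using l by (simp add: power2_eq_square)
    finally have g1: "good T1" by (simp add: good_def)
    have bd: "T \<le> l\<^sup>2" if "good T" for T
    proof -
      have "real T \<le> 2 ^ T" using less_exp[of T] by (metis less_imp_le of_nat_le_iff of_nat_numeral of_nat_power)
      also have "\<dots> \<le> s * 2 ^ T" by (simp add: s_def algebra_simps)
      finally show ?thesis using that unfolding good_def by (metis of_nat_le_iff of_nat_power order_trans)
    qed
    define T where "T = (GREATEST T. good T)"
    have gT: "good T" and Tle: "T1 \<le> T"
      unfolding T_def using GreatestI_nat[of good, OF g1 bd] Greatest_le_nat[of good, OF g1 bd] by auto
    have "\<not> good (Suc T)" using Greatest_le_nat[of good "Suc T", OF _ bd] unfolding T_def[symmetric] by auto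
    then have "(real l)\<^sup>2 < 2 * s * 2 ^ T" by (simp add: good_def)
    then have "real l \<le> sqrt (2 * s * 2 ^ T)"
      by (metis less_imp_le of_nat_0_le_iff real_le_rsqrt)
    then have "real C * (real l * T + 1) + 2 \<le> real C * (sqrt (2 * s * 2 ^ T) * T + 1) + 2"
      by (intro add_mono mult_left_mono mult_right_mono) auto
    also have "\<dots> \<le> 2 ^ T" using T0 Tle by (simp add: T1_def)
    finally have "real (C * (l * T + 1) + 2) \<le> real (2 ^ T)" by (simp add: algebra_simps)
    then have "C * (l * T + 1) + 2 \<le> 2 ^ T" by (simp only: of_nat_le_iff)
    moreover have "real (S * 2 ^ T) \<le> real (l\<^sup>2)"
      using gT by (simp add: good_def s_def algebra_simps)
        (smt (verit) zero_le_power)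
    then have "S * 2 ^ T \<le> l\<^sup>2" by (simp only: of_nat_le_iff)
    ultimately show ?thesis using Tle by (intro exI[of _ T]) (simp add: T1_def)
  qed
  then show ?thesis by blast
qed

definition short_words :: "nat \<Rightarrow> word set" where
  "short_words t = {z. set z \<subseteq> {0, 1} \<and> length z \<le> t}"

lemma finite_short_words: "finite (short_words t)"
  unfolding short_words_def by (rule finite_lists_length_le) simp

context residue_field
begin

text \<open>There are \<open>2\<^sup>T\<close> coefficients. Only \<open>z\<close> and \<open>z'\<close> of length at most \<open>t\<close> give nonzero derivatives, and only
  exponents \<open>q \<le> l T\<close> give words of the length \<open>l T\<close>; this bounds the number of equations.
  A surplus of two unknowns gives two functions that take independent values.\<close>

lemma annihilating_block_sum:
  assumes "\<And>a. homog l (\<phi> a)"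
    and keys: "\<And>w. w \<in> Poly_Mapping.keys r \<Longrightarrow> w \<noteq> [] \<and> w \<in> short_words t"
    and T: "(card (short_words t))\<^sup>2 * (l * T + 1) + 2 \<le> 2 ^ T"
  shows "\<exists>(c :: bool \<Rightarrow> bool list \<Rightarrow> 'k) d. (\<forall>b. d b \<in> bools T) \<and> (\<forall>a b. Z (c a (d b) - of_bool (a = b))) \<and>
    (\<forall>a z q z'. Z (pairing (lder z r * r ^ q * rder z' r) (block_sum l \<phi> T (c a))))"
proof -
  define J where "J = (short_words t \<times> short_words t) \<times> {..l * T}"
  define a where "a j e = pairing (lder (fst (fst j)) r * r ^ snd j * rder (snd (fst j)) r) (blocks l (map \<phi> e))" for j e
  have J: "finite J" by (simp add: J_def finite_short_words)
  have "card J + 2 \<le> card (bools T)"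
    using T by (simp add: J_def card_cartesian_product card_bools power2_eq_square mult.assoc)
  from two_dual_solutions[OF J finite_bools this, of a]
  obtain c :: "bool \<Rightarrow> bool list \<Rightarrow> 'k" and d
    where cd: "\<forall>b. d b \<in> bools T" "\<forall>b b'. Z (c b (d b') - of_bool (b = b'))"
    "\<forall>b. \<forall>j\<in>J. Z (\<Sum>e\<in>bools T. a j e * c b e)" by blast
  have "Z (pairing (lder z r * r ^ q * rder z' r) (block_sum l \<phi> T (c b)))" (is "Z (pairing ?g _)") for b z q z'
  proof (cases "((z, z'), q) \<in> J")
    case True
    have "pairing g (block_sum l \<phi> T (c b)) = (\<Sum>e\<in>bools T. pairing g (blocks l (map \<phi> e)) * c b e)" for g
      unfolding block_sum_def pairing_def sum_distrib_left sum_distrib_right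
      by (subst sum.swap) (simp add: mult_ac)
    then have "pairing ?g (block_sum l \<phi> T (c b)) = (\<Sum>e\<in>bools T. a ((z, z'), q) e * c b e)"
      by (simp add: a_def)
    then show ?thesis using cd(3) True by metis
  next
    case False
    consider "z \<notin> short_words t" | "z' \<notin> short_words t" | "l * T < q"
      using False by (auto simp: J_def)
    then have "pairing ?g (block_sum l \<phi> T (c b)) = 0"
    proof cases
      case 1
      have "Poly_Mapping.keys (lder z r) = {}"
        using 1 keys by (fastforce simp: keys_lder short_words_def)
      then show ?thesis by (simp add: keys_eq_empty)
    next
      case 2
      have "Poly_Mapping.keys (rder z' r) = {}"
        using 2 keys by (fastforce simp: keys_rder short_words_def)
      then show ?thesis by (simp add: keys_eq_empty)
    next
      case 3
      have "block_sum l \<phi> T (c b) w = 0" if w: "w \<in> Poly_Mapping.keys ?g" for w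
      proof -
        obtain x' z1 where "w = x' @ z1" and "x' \<in> Poly_Mapping.keys (lder z r * r ^ q)"
          using subsetD[OF keys_mult_words w] by auto
        moreover obtain x y where "x' = x @ y" and y: "y \<in> Poly_Mapping.keys (r ^ q)"
          using subsetD[OF keys_mult_words calculation(2)] by auto
        moreover have "q * 1 \<le> length y"
        proof (rule length_keys_power[OF _ y])
          fix x assume "x \<in> Poly_Mapping.keys r"
          from keys[OF this] show "1 \<le> length x" by (cases x) auto
        qed
        ultimately have "length w > l * T" using 3 by simp
        then show ?thesis using homog_block_sum[of l \<phi> T "c b", OF assms(1)]
          by (auto simp: homog_def bwords_def)
      qed
      then show ?thesis by (simp add: pairing_def)
    qed
    then show ?thesis by (simp add: Z_0)
  qed
  with cd show ?thesis by blast
qed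

end

text \<open>A level of the tower during the construction, together with the data from which the next level is
  made: the number of free blocks, their coefficients, and the two patterns at which the coefficients
  are dual.\<close>

record 'k stage =
  stage_len :: nat
  stage_fun :: "bool \<Rightarrow> word \<Rightarrow> 'k"
  stage_dual :: "bool \<Rightarrow> word"
  stage_rank :: nat
  stage_tail :: nat
  stage_coeff :: "bool \<Rightarrow> bool list \<Rightarrow> 'k"
  stage_witness :: "bool \<Rightarrow> bool list"

text \<open>\<open>f i\<close> is the element treated at level \<open>i\<close>, of degree at most \<open>t i\<close>; \<open>\<phi> i\<close> are the functions of
  level \<open>i\<close> on words of length \<open>l i\<close>, and \<open>\<sigma> i\<close> bounds the ranks of their prefixes and suffixes. The two
  conditions on \<open>T i\<close> express that it is large enough for \<open>f i\<close> and small enough for slow growth.\<close>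

locale tower = residue_field Z for Z :: "'k::comm_ring_1 \<Rightarrow> bool" +
  fixes f :: "nat \<Rightarrow> word \<Rightarrow>\<^sub>0 'k" and t :: "nat \<Rightarrow> nat"
    and l \<sigma> K T :: "nat \<Rightarrow> nat" and \<phi> :: "nat \<Rightarrow> bool \<Rightarrow> word \<Rightarrow> 'k"
    and p :: "nat \<Rightarrow> bool \<Rightarrow> word" and c :: "nat \<Rightarrow> bool \<Rightarrow> bool list \<Rightarrow> 'k"
  assumes keys_f: "\<And>i w. w \<in> Poly_Mapping.keys (f i) \<Longrightarrow> w \<noteq> [] \<and> w \<in> short_words (t i)"
    and l_pos: "0 < l i"
    and homog_\<phi>: "homog (l i) (\<phi> i a)"
    and dual_\<phi>: "dual_words Z (l i) (\<phi> i) (p i)"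
    and \<sigma>_pos: "1 \<le> \<sigma> i"
    and ranked_\<phi>: "windows_ranked (l i) (\<phi> i) (\<sigma> i)"
    and T_large: "t i < T i"
    and annihilates: "\<And>i a z q z'. Z (pairing (lder z (f i) * f i ^ q * rder z' (f i)) (block_sum (l i) (\<phi> i) (T i) (c i a)))"
    and T_small: "0 < i \<Longrightarrow> 4 * (\<sigma> i)\<^sup>2 * 2 ^ T i \<le> (l i)\<^sup>2"
    and K_pos: "1 \<le> K i"
    and l_Suc: "l (Suc i) = l i * (K i + T i)"
    and \<phi>_Suc: "\<phi> (Suc i) = (\<lambda>a. padded (l i) (\<phi> i) (K i) (T i) (c i a))"

text \<open>The level \<open>i + 1\<close> can satisfy both conditions on \<open>T\<close> once it is long enough
  (\<open>exponent_choice\<close>). How long depends on \<open>\<sigma>\<close> for this level and on the next element, but not on the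
  length of the padding; so the padding is chosen long enough for that.\<close>

lemma (in residue_field) tower_exists:
  assumes keys_f: "\<And>i w. w \<in> Poly_Mapping.keys (f i) \<Longrightarrow> w \<noteq> [] \<and> w \<in> short_words (t i)"
  shows "\<exists>l \<sigma> K T \<phi> p c. tower Z f t l \<sigma> K T \<phi> p c"
proof -
  define P where "P i s \<longleftrightarrow> 0 < stage_len s \<and> (\<forall>a. homog (stage_len s) (stage_fun s a)) \<and> dual_words Z (stage_len s) (stage_fun s) (stage_dual s)
    \<and> 1 \<le> stage_rank s \<and> windows_ranked (stage_len s) (stage_fun s) (stage_rank s) \<and> t i < stage_tail s
    \<and> (\<forall>b. stage_witness s b \<in> bools (stage_tail s)) \<and> (\<forall>a b. Z (stage_coeff s a (stage_witness s b) - of_bool (a = b)))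
    \<and> (\<forall>a z q z'. Z (pairing (lder z (f i) * f i ^ q * rder z' (f i)) (block_sum (stage_len s) (stage_fun s) (stage_tail s) (stage_coeff s a))))
    \<and> (0 < i \<longrightarrow> 4 * (stage_rank s)\<^sup>2 * 2 ^ stage_tail s \<le> (stage_len s)\<^sup>2)" for i and s :: "'k stage"
  define Q where "Q s s' \<longleftrightarrow> (\<exists>K\<ge>1. stage_len s' = stage_len s * (K + stage_tail s) \<and>
    stage_fun s' = (\<lambda>a. padded (stage_len s) (stage_fun s) K (stage_tail s) (stage_coeff s a)))" for s s' :: "'k stage"
  have "\<exists>S. \<forall>n. P n (S n) \<and> Q (S n) (S (Suc n))"
  proof (rule dependent_nat_choice)
    \<comment> \<open>The lowest level consists of the indicator functions of the two letters.\<close>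
    let ?\<phi> = "\<lambda>a w. of_bool (w = [of_bool a]) :: 'k"
    have h: "homog 1 (?\<phi> a)" for a by (auto simp: homog_def bwords_def)
    have "\<exists>T0. \<forall>T\<ge>T0. (card (short_words (t 0)))\<^sup>2 * (1 * T + 1) + 2 \<le> (2::nat) ^ T"
    proof -
      have "eventually (\<lambda>T::nat. real ((card (short_words (t 0)))\<^sup>2) * (real T + 1) + 2 \<le> 2 ^ T) at_top"
        by real_asymp
      then obtain T0 where T0: "\<And>T. T \<ge> T0 \<Longrightarrow> real ((card (short_words (t 0)))\<^sup>2) * (real T + 1) + 2 \<le> 2 ^ T"
        unfolding eventually_at_top_linorder by blast
      have "(card (short_words (t 0)))\<^sup>2 * (1 * T + 1) + 2 \<le> (2::nat) ^ T" if "T \<ge> T0" for T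
      proof -
        have "real ((card (short_words (t 0)))\<^sup>2 * (1 * T + 1) + 2) \<le> real (2 ^ T)"
          using T0[OF that] by (simp add: algebra_simps)
        then show ?thesis by (simp only: of_nat_le_iff)
      qed
      then show ?thesis by blast
    qed
    then obtain T0 where T0: "\<And>T. T \<ge> T0 \<Longrightarrow> (card (short_words (t 0)))\<^sup>2 * (1 * T + 1) + 2 \<le> (2::nat) ^ T"
      by blast
    define T where "T = max T0 (t 0 + 1)"
    have "(card (short_words (t 0)))\<^sup>2 * (1 * T + 1) + 2 \<le> 2 ^ T"
      by (rule T0) (simp add: T_def)
    from annihilating_block_sum[where \<phi> = ?\<phi> and l = 1 and r = "f 0" and t = "t 0", OF h keys_f this]
    obtain c :: "bool \<Rightarrow> bool list \<Rightarrow> 'k" and d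
      where cd: "\<forall>b. d b \<in> bools T" "\<forall>a b. Z (c a (d b) - of_bool (a = b))"
      "\<forall>a z q z'. Z (pairing (lder z (f 0) * f 0 ^ q * rder z' (f 0)) (block_sum 1 ?\<phi> T (c a)))"
      by blast
    have "dual_words Z 1 ?\<phi> (\<lambda>a. [of_bool a])"
      by (auto simp: dual_words_def bwords_def Z_0)
    moreover have "windows_ranked 1 ?\<phi> 2"
      unfolding windows_ranked_def
    proof (intro allI impI)
      fix r :: nat assume "r \<le> 1"
      then have "card (bwords r) \<le> 2" using power_increasing[of r 1 "2::nat"] by (simp add: card_bwords)
      then show "spanned_on (bwords r) (suffixes 1 ?\<phi> r) 2 \<and> spanned_on (bwords r) (prefixes 1 ?\<phi> r) 2"
        by (intro conjI spanned_on_all finite_bwords)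
    qed
    ultimately have "P 0 \<lparr>stage_len = 1, stage_fun = ?\<phi>, stage_dual = (\<lambda>a. [of_bool a]), stage_rank = 2, stage_tail = T, stage_coeff = c, stage_witness = d\<rparr>"
      unfolding P_def using h cd by (simp add: T_def)
    then show "\<exists>x. P 0 x" by blast
  next
    fix s n assume s: "P n s"
    define \<sigma> where "\<sigma> = stage_rank s * 2 ^ stage_tail s"
    obtain L where L: "\<And>l. l \<ge> L \<Longrightarrow> \<exists>T>t (Suc n). (card (short_words (t (Suc n))))\<^sup>2 * (l * T + 1) + 2 \<le> 2 ^ T
        \<and> (4 * \<sigma>\<^sup>2) * 2 ^ T \<le> l\<^sup>2"
      using exponent_choice by blast
    \<comment> \<open>The rank \<open>\<sigma>\<close> has been fixed without \<open>K\<close>, so \<open>K\<close> may depend on it.\<close>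
    define K where "K = L + 1"
    define l where "l = stage_len s * (K + stage_tail s)"
    define \<phi> where "\<phi> a = padded (stage_len s) (stage_fun s) K (stage_tail s) (stage_coeff s a)" for a
    have "1 * L \<le> stage_len s * (K + stage_tail s)" using s by (intro mult_le_mono) (auto simp: P_def K_def)
    then have "L \<le> l" by (simp add: l_def)
    from L[OF this] obtain T where T: "T > t (Suc n)"
      "(card (short_words (t (Suc n))))\<^sup>2 * (l * T + 1) + 2 \<le> 2 ^ T" "4 * \<sigma>\<^sup>2 * 2 ^ T \<le> l\<^sup>2" by blast
    have h: "homog l (\<phi> a)" for a
      unfolding l_def \<phi>_def by (rule homog_padded) (use s in \<open>simp add: P_def\<close>)
    from annihilating_block_sum[where \<phi> = \<phi> and l = l and r = "f (Suc n)" and t = "t (Suc n)", OF h keys_f T(2)]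
    obtain c :: "bool \<Rightarrow> bool list \<Rightarrow> 'k" and d
      where cd: "\<forall>b. d b \<in> bools T" "\<forall>a b. Z (c a (d b) - of_bool (a = b))"
      "\<forall>a z q z'. Z (pairing (lder z (f (Suc n)) * f (Suc n) ^ q * rder z' (f (Suc n))) (block_sum l \<phi> T (c a)))"
      by blast
    define p where "p b = concat (map (stage_dual s) (replicate K False @ stage_witness s b))" for b
    have "dual_words Z l \<phi> p"
      unfolding l_def \<phi>_def[abs_def] p_def[abs_def]
      by (rule padded_dual) (use s in \<open>auto simp: P_def\<close>)
    moreover have "windows_ranked l \<phi> \<sigma>"
      unfolding l_def \<phi>_def[abs_def] \<sigma>_def
      by (rule windows_ranked_padded) (use s in \<open>auto simp: P_def\<close>)
    moreover have "0 < l" "1 \<le> \<sigma>" using s by (auto simp: l_def K_def \<sigma>_def P_def)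
    ultimately have "P (Suc n) \<lparr>stage_len = l, stage_fun = \<phi>, stage_dual = p, stage_rank = \<sigma>, stage_tail = T, stage_coeff = c, stage_witness = d\<rparr>"
      unfolding P_def using h cd T by simp
    moreover have "Q s \<lparr>stage_len = l, stage_fun = \<phi>, stage_dual = p, stage_rank = \<sigma>, stage_tail = T, stage_coeff = c, stage_witness = d\<rparr>"
      unfolding Q_def by (intro exI[of _ K]) (simp add: l_def \<phi>_def[abs_def] K_def)
    ultimately show "\<exists>y. P (Suc n) y \<and> Q s y" by blast
  qed
  then obtain S where S: "\<And>n. P n (S n)" "\<And>n. Q (S n) (S (Suc n))" by blast
  then obtain K where K: "\<And>n. 1 \<le> K n \<and> stage_len (S (Suc n)) = stage_len (S n) * (K n + stage_tail (S n)) \<and>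
    stage_fun (S (Suc n)) = (\<lambda>a. padded (stage_len (S n)) (stage_fun (S n)) (K n) (stage_tail (S n)) (stage_coeff (S n) a))"
    unfolding Q_def by metis
  have "tower Z f t (\<lambda>n. stage_len (S n)) (\<lambda>n. stage_rank (S n)) K (\<lambda>n. stage_tail (S n)) (\<lambda>n. stage_fun (S n)) (\<lambda>n. stage_dual (S n)) (\<lambda>n. stage_coeff (S n))"
  proof
    show "\<And>i w. w \<in> Poly_Mapping.keys (f i) \<Longrightarrow> w \<noteq> [] \<and> w \<in> short_words (t i)" by (rule keys_f)
    fix i a q and z z' :: word
    show "0 < stage_len (S i)" "homog (stage_len (S i)) (stage_fun (S i) a)"
      "dual_words Z (stage_len (S i)) (stage_fun (S i)) (stage_dual (S i))" "1 \<le> stage_rank (S i)"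
      "windows_ranked (stage_len (S i)) (stage_fun (S i)) (stage_rank (S i))" "t i < stage_tail (S i)"
      "0 < i \<Longrightarrow> 4 * (stage_rank (S i))\<^sup>2 * 2 ^ stage_tail (S i) \<le> (stage_len (S i))\<^sup>2"
      "Z (pairing (lder z (f i) * f i ^ q * rder z' (f i)) (block_sum (stage_len (S i)) (stage_fun (S i)) (stage_tail (S i)) (stage_coeff (S i) a)))"
      using S(1)[of i] unfolding P_def by simp_all
    show "1 \<le> K i" "stage_len (S (Suc i)) = stage_len (S i) * (K i + stage_tail (S i))"
      "stage_fun (S (Suc i)) = (\<lambda>a. padded (stage_len (S i)) (stage_fun (S i)) (K i) (stage_tail (S i)) (stage_coeff (S i) a))"
      using K[of i] by blast+
  qed
  then show ?thesis by blast
qed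

section \<open>Growth and nilpotency of the tower\<close>

lemma sum_bwords_add:
  "(\<Sum>w\<in>bwords (a + b). g w) = (\<Sum>u\<in>bwords a. \<Sum>v\<in>bwords b. g (u @ v))"
proof -
  have "(\<Sum>u\<in>bwords a. \<Sum>v\<in>bwords b. g (u @ v)) = (\<Sum>(u, v)\<in>bwords a \<times> bwords b. g (u @ v))"
    by (rule sum.cartesian_product)
  also have "\<dots> = (\<Sum>w\<in>bwords (a + b). g w)"
  proof (rule sum.reindex_bij_witness[where i = "\<lambda>w. (take a w, drop a w)" and j = "\<lambda>(u, v). u @ v"])
    fix w assume "w \<in> bwords (a + b)"
    then obtain x y where "x \<in> bwords a" "y \<in> bwords b" "w = x @ y" using bwords_split by blast
    then show "(take a w, drop a w) \<in> bwords a \<times> bwords b" by (simp add: length_bwords)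
  qed (auto simp: length_bwords append_in_bwords)
  finally show ?thesis by simp
qed

lemma combos_compose:
  assumes "f \<in> combos S L" "\<And>w. w \<in> S' \<Longrightarrow> h w \<in> S"
    and "\<And>g. g \<in> L \<Longrightarrow> (\<lambda>w. g (h w)) \<in> combos S' M"
  shows "(\<lambda>w. f (h w)) \<in> combos S' M"
  using assms(1)
proof induction
  case (zero f)
  then show ?case using assms(2) by (auto intro: combos.zero)
next
  case (add g k f c)
  from combos_lin[OF assms(3)[OF add.hyps(1)] add.IH, of c]
  show ?case by (rule combos_cong) (simp add: add.hyps assms(2))
qed

lemma tensors_mono: "L \<subseteq> L' \<Longrightarrow> M \<subseteq> M' \<Longrightarrow> tensors a b L M \<subseteq> tensors a b L' M'"
  unfolding tensors_def by blast

context tower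
begin

lemma l_double: "2 * l i \<le> l (Suc i)"
proof -
  have "l i * 2 \<le> l i * (K i + T i)" using K_pos[of i] T_large[of i] by (intro mult_le_mono2) linarith
  then show ?thesis by (simp add: l_Suc)
qed

lemma l_mono: "i \<le> n \<Longrightarrow> l i \<le> l n"
  by (rule lift_Suc_mono_le[of l]) (use l_double in \<open>metis add_leD1 mult_2\<close>)

lemma l_unbounded: "n < l n"
proof (induction n)
  case (Suc n)
  then show ?case using l_double[of n] by linarith
qed (rule l_pos)

text \<open>A suffix of a block of level \<open>n\<close> that fits into a block of level \<open>i\<close> is a suffix of the last
  block of level \<open>i\<close>.\<close>

lemma suffixes_descend:
  assumes "i \<le> n" "0 < a" "a \<le> l i" "g \<in> suffixes (l n) (\<phi> n) a"
  shows "g \<in> combos (bwords a) (suffixes (l i) (\<phi> i) a)"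
  using assms(1,4)
proof (induction n arbitrary: g rule: dec_induct)
  case base
  then show ?case by (intro combos_base[where c = 1]) auto
next
  case (step n)
  from step.prems obtain b u where g: "g = (\<lambda>w. \<phi> (Suc n) b (u @ w))" "length u + a = l (Suc n)"
    unfolding suffixes_def by blast
  have "a \<le> l n" using assms(3) l_mono[OF step.hyps(1)] by simp
  from padded_cut_suffix[OF assms(2) this, of u "K n" "T n" "\<phi> n" "c n b"] g
  have "g \<in> combos (bwords a) (suffixes (l n) (\<phi> n) a)" by (simp add: l_Suc \<phi>_Suc)
  then show ?case by (rule combos_subset) (rule step.IH)
qed

lemma prefixes_descend:
  assumes "i \<le> n" "0 < a" "a \<le> l i" "g \<in> prefixes (l n) (\<phi> n) a"
  shows "g \<in> combos (bwords a) (prefixes (l i) (\<phi> i) a)"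
  using assms(1,4)
proof (induction n arbitrary: g rule: dec_induct)
  case base
  then show ?case by (intro combos_base[where c = 1]) auto
next
  case (step n)
  from step.prems obtain b u where g: "g = (\<lambda>w. \<phi> (Suc n) b (w @ u))" "length u + a = l (Suc n)"
    unfolding prefixes_def by blast
  have "a \<le> l n" using assms(3) l_mono[OF step.hyps(1)] by simp
  from padded_cut_prefix[OF assms(2) this, of u "K n" "T n" "\<phi> n" "c n b"] g
  have "g \<in> combos (bwords a) (prefixes (l n) (\<phi> n) a)" by (simp add: l_Suc \<phi>_Suc add.commute)
  then show ?case by (rule combos_subset) (rule step.IH)
qed

text \<open>All windows of length \<open>m\<close> of a concatenation of blocks of level \<open>i\<close>, for \<open>m \<le> l i\<close>.\<close>

abbreviation windows :: "nat \<Rightarrow> nat \<Rightarrow> (word \<Rightarrow> 'k) set" where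
  "windows i m \<equiv> infixes (l i) (\<phi> i) m \<union> (\<Union>a\<in>{1..<m}. straddles (l i) (\<phi> i) m a)"

text \<open>Windows of length at most \<open>l i\<close> of all higher levels are already windows of level \<open>i\<close>, or straddle two
  blocks of it. If a window crosses a boundary of level \<open>n\<close>, its two parts descend separately.\<close>

lemma infix_windows:
  assumes "i \<le> n" "0 < m" "m \<le> l i" "length u + m + length v = l n"
  shows "(\<lambda>w. \<phi> n b (u @ w @ v)) \<in> combos (bwords m) (windows i m)"
  using assms(1,4)
proof (induction n arbitrary: b u v rule: dec_induct)
  case base
  then have "(\<lambda>w. \<phi> i b (u @ w @ v)) \<in> infixes (l i) (\<phi> i) m" unfolding infixes_def by blast
  then show ?case by (intro combos_base[where c = 1]) auto
next
  case (step n)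
  have ln: "l i \<le> l n" by (rule l_mono) (rule step.hyps(1))
  have tot: "length u + m + length v = l n * (K n + T n)" using step.prems by (simp add: l_Suc)
  show ?case
  proof (cases "length u mod l n + m \<le> l n")
    case True
    from padded_inside[OF assms(2) tot True, of "\<phi> n" "c n b"]
    obtain u2 v1 where uv: "length u2 + m + length v1 = l n"
      "(\<lambda>w. \<phi> (Suc n) b (u @ w @ v)) \<in> combos (bwords m) (range (\<lambda>x w. \<phi> n x (u2 @ w @ v1)))"
      by (auto simp: \<phi>_Suc)
    from uv(2) show ?thesis
      by (rule combos_subset) (use step.IH uv(1) in auto)
  next
    case False
    define a where "a = l n - length u mod l n"
    have mod: "length u mod l n < l n" using l_pos[of n] by simp
    have a: "0 < a" "a < m" "a \<le> l n" "m - a \<le> l n"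
      using False mod assms(3) ln by (auto simp: a_def)
    have dvd: "l n dvd length u + a"
    proof -
      have "length u + a = l n * (length u div l n) + l n"
        using mod mult_div_mod_eq[of "l n" "length u"] unfolding a_def by linarith
      then show ?thesis by simp
    qed
    have am: "a + (m - a) = m" using a by simp
    have "(\<lambda>w. padded (l n) (\<phi> n) (K n) (T n) (c n b) (u @ w @ v)) \<in> combos (bwords (a + (m - a)))
        (tensors a (m - a) (suffixes (l n) (\<phi> n) a) (prefixes (l n) (\<phi> n) (m - a)))"
      by (rule padded_across) (use a tot am dvd in auto)
    moreover have "tensors a (m - a) (suffixes (l n) (\<phi> n) a) (prefixes (l n) (\<phi> n) (m - a))
      \<subseteq> straddles (l i) (\<phi> i) m a"
      unfolding straddles_def
      using suffixes_descend[OF step.hyps(1) a(1)] prefixes_descend[OF step.hyps(1), of "m - a"] a assms(3)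
      by (intro tensors_mono subsetI) auto
    ultimately have "(\<lambda>w. \<phi> (Suc n) b (u @ w @ v)) \<in> combos (bwords m) (straddles (l i) (\<phi> i) m a)"
      unfolding am \<phi>_Suc by (rule combos_mono)
    then show ?thesis by (rule combos_mono) (use a in auto)
  qed
qed

text \<open>The length of a block of level \<open>i\<close> divides that of all higher levels, so a block of level \<open>i\<close> at a
  position divisible by \<open>l i\<close> does not cross a boundary at any level.\<close>

lemma aligned_blocks:
  assumes "i \<le> n" "l i dvd length u" "length u + l i + length v = l n"
  shows "(\<lambda>w. \<phi> n b (u @ w @ v)) \<in> combos (bwords (l i)) (range (\<phi> i))"
  using assms
proof (induction n arbitrary: b u v rule: dec_induct)
  case base
  then show ?case by (intro combos_base[where c = 1 and g = "\<phi> i b"]) auto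
next
  case (step n)
  have dvd: "l i dvd l n" using step.hyps(1)
    by (induction n rule: dec_induct) (auto simp: l_Suc)
  have tot: "length u + l i + length v = l n * (K n + T n)" using step.prems by (simp add: l_Suc)
  have mod: "l i dvd length u mod l n" "length u mod l n < l n"
    using step.prems(1) dvd l_pos[of n] by (simp_all add: dvd_mod)
  have le: "length u mod l n + l i \<le> l n"
  proof -
    obtain x where x: "length u mod l n = l i * x" using mod(1) by (elim dvdE)
    obtain y where y: "l n = l i * y" using dvd by (elim dvdE)
    have "l i * x < l i * y" using mod(2) x y by metis
    then have "l i * Suc x \<le> l i * y" by (intro mult_le_mono2) simp
    then show ?thesis using x y by (metis mult_Suc_right add.commute)
  qed
  from padded_inside[OF l_pos[of i] tot le, of "\<phi> n" "c n b"]
  obtain u2 v1 where uv: "length u2 = length u mod l n" "length u2 + l i + length v1 = l n"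
    "(\<lambda>w. \<phi> (Suc n) b (u @ w @ v)) \<in> combos (bwords (l i)) (range (\<lambda>x w. \<phi> n x (u2 @ w @ v1)))"
    by (auto simp: \<phi>_Suc)
  from uv(3) show ?case
    by (rule combos_subset) (use step.IH uv(1,2) mod in auto)
qed

text \<open>The functionals that define the algebra on two letters.\<close>

definition functionals :: "(word \<Rightarrow> 'k) set" where
  "functionals = {\<lambda>w. d * \<phi> n b (u @ w @ v) | d n b u v. True}"

lemma functionals_scale: "g \<in> functionals \<Longrightarrow> (\<lambda>w. d * g w) \<in> functionals"
  unfolding functionals_def by (auto simp: mult.assoc[symmetric]) blast

lemma functionals_Cons: "g \<in> functionals \<Longrightarrow> (\<lambda>w. g (a # w)) \<in> functionals"
proof -
  assume "g \<in> functionals"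
  then obtain d n b u v where "g = (\<lambda>w. d * \<phi> n b (u @ w @ v))" unfolding functionals_def by blast
  then have "(\<lambda>w. g (a # w)) = (\<lambda>w. d * \<phi> n b ((u @ [a]) @ w @ v))" by simp
  then show ?thesis unfolding functionals_def by blast
qed

lemma functionals_snoc: "g \<in> functionals \<Longrightarrow> (\<lambda>w. g (w @ [a])) \<in> functionals"
proof -
  assume "g \<in> functionals"
  then obtain d n b u v where "g = (\<lambda>w. d * \<phi> n b (u @ w @ v))" unfolding functionals_def by blast
  then have "(\<lambda>w. g (w @ [a])) = (\<lambda>w. d * \<phi> n b (u @ w @ (a # v)))" by simp
  then show ?thesis unfolding functionals_def by blast
qed

lemma \<phi>_nonzeroD: "\<phi> n b w \<noteq> 0 \<Longrightarrow> length w = l n \<and> set w \<subseteq> {0, 1}"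
  using homog_\<phi>[of n b] by (auto simp: homog_def bwords_def)

lemma \<phi>_zero: "length w \<noteq> l n \<or> \<not> set w \<subseteq> {0, 1} \<Longrightarrow> \<phi> n b w = 0"
  using \<phi>_nonzeroD by blast

lemma functionals_homog:
  assumes "g \<in> functionals"
  shows "\<exists>k. homog k g"
proof -
  obtain d n b u v where g: "g = (\<lambda>w. d * \<phi> n b (u @ w @ v))"
    using assms unfolding functionals_def by blast
  have "homog (l n - length u - length v) g"
    unfolding homog_def g
  proof (intro allI impI)
    fix w assume w: "w \<notin> bwords (l n - length u - length v)"
    have "\<phi> n b (u @ w @ v) = 0"
    proof (rule ccontr)
      assume "\<phi> n b (u @ w @ v) \<noteq> 0"
      from \<phi>_nonzeroD[OF this] w show False by (auto simp: bwords_def)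
    qed
    then show "d * \<phi> n b (u @ w @ v) = 0" by simp
  qed
  then show ?thesis by blast
qed

lemma functionals_nonzero: "\<exists>g\<in>functionals. \<exists>w\<in>bwords k. \<not> Z (g w)"
proof -
  let ?p = "p k False"
  have "Z (\<phi> k False ?p - of_bool (False = False))" "?p \<in> bwords (l k)"
    using dual_\<phi>[of k] unfolding dual_words_def by blast+
  then have p: "?p \<in> bwords (l k)" "Z (\<phi> k False ?p - 1)" by simp_all
  have "\<not> Z (\<phi> k False ?p)" using Z_cong[OF p(2)] Z_1 by simp
  then have "\<not> Z (1 * \<phi> k False ([] @ take k ?p @ drop k ?p))" by simp
  moreover have "(\<lambda>w. 1 * \<phi> k False ([] @ w @ drop k ?p)) \<in> functionals"
    unfolding functionals_def by blast
  moreover have "take k ?p \<in> bwords k"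
    using p(1) l_unbounded[of k] by (auto simp: bwords_def dest: in_set_takeD)
  ultimately show ?thesis by (intro bexI)
qed

text \<open>Only levels above \<open>i\<close> have words that are long enough; these levels reduce to level \<open>i + 1\<close>.\<close>

lemma spanned_on_functionals:
  assumes "l i < m" "m \<le> l (Suc i)"
  shows "spanned_on (bwords m) functionals (3 * m * (\<sigma> i)\<^sup>2 * 2 ^ T i)"
proof (rule spanned_on_combos)
  show "spanned_on (bwords m) (windows (Suc i) m) (3 * m * (\<sigma> i)\<^sup>2 * 2 ^ T i)"
    unfolding l_Suc \<phi>_Suc
    by (rule spanned_on_padded_windows) (use assms l_pos \<sigma>_pos ranked_\<phi> in \<open>auto simp: l_Suc\<close>)
next
  fix g assume "g \<in> functionals"
  then obtain d n b u v where g: "g = (\<lambda>w. d * \<phi> n b (u @ w @ v))" unfolding functionals_def by blast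
  show "g \<in> combos (bwords m) (windows (Suc i) m)"
  proof (cases "length u + m + length v = l n")
    case True
    have "Suc i \<le> n"
    proof (rule ccontr)
      assume "\<not> Suc i \<le> n"
      then have "l n \<le> l i" by (intro l_mono) simp
      then show False using True assms by simp
    qed
    from infix_windows[OF this _ assms(2) True, of b] assms
    have "(\<lambda>w. \<phi> n b (u @ w @ v)) \<in> combos (bwords m) (windows (Suc i) m)" by simp
    then show ?thesis by (rule combos_scale[where c = d]) (simp add: g)
  next
    case False
    have "g w = 0" if "w \<in> bwords m" for w
    proof -
      have "length (u @ w @ v) \<noteq> l n" using False that by (simp add: length_bwords)
      then have "\<phi> n b (u @ w @ v) = 0" using \<phi>_nonzeroD by blast
      then show ?thesis by (simp add: g)
    qed
    then show ?thesis by (rule combos.zero)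
  qed
qed

text \<open>The rank bound \<open>3 m \<sigma>\<^sup>2 2\<^sup>T\<close> is at most \<open>m\<^sup>3\<close> by the choice of \<open>T\<close>. The constant accounts for
  the short words, where \<open>T 0\<close> has not been bounded in terms of \<open>l 0\<close>.\<close>

lemma growth_functionals: "\<exists>C. \<forall>m\<ge>1. spanned_on (bwords m) functionals (C * m ^ 3)"
proof (intro exI[of _ "2 ^ l 1 + 1"] allI impI)
  fix m :: nat assume m: "1 \<le> m"
  show "spanned_on (bwords m) functionals ((2 ^ l 1 + 1) * m ^ 3)"
  proof (cases "m \<le> l 1")
    case True
    have "(2::nat) ^ m \<le> 2 ^ l 1" by (rule power_increasing[OF True]) simp
    then have "(2::nat) ^ m \<le> (2 ^ l 1 + 1) * 1" unfolding mult_1_right by (rule trans_le_add1)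
    also have "\<dots> \<le> (2 ^ l 1 + 1) * m ^ 3" using m by (intro mult_le_mono2) simp
    finally show ?thesis by (intro spanned_on_all finite_bwords) (simp add: card_bwords)
  next
    case False
    define k where "k = (LEAST k. m \<le> l k)"
    have k: "m \<le> l k" unfolding k_def by (rule LeastI[of _ m]) (use l_unbounded[of m] in simp)
    have "1 < k"
    proof (rule ccontr)
      assume "\<not> 1 < k"
      then have "l k \<le> l 1" by (intro l_mono) simp
      then show False using k False by simp
    qed
    then obtain i where i: "k = Suc i" "0 < i" by (cases k) auto
    have li: "l i < m"
    proof (rule ccontr)
      assume "\<not> l i < m"
      then have "k \<le> i" unfolding k_def by (intro Least_le) simp
      then show False using i by simp
    qed
    have "3 * m * (\<sigma> i)\<^sup>2 * 2 ^ T i \<le> m * (4 * (\<sigma> i)\<^sup>2 * 2 ^ T i)" by simp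
    also have "\<dots> \<le> m * (l i)\<^sup>2" using T_small[OF i(2)] by (rule mult_le_mono2)
    also have "\<dots> \<le> m * m\<^sup>2" using li by (intro mult_le_mono2 power_mono) auto
    also have "\<dots> = m ^ 3" by (simp add: power2_eq_square power3_eq_cube)
    also have "\<dots> \<le> (2 ^ l 1 + 1) * m ^ 3" by simp
    finally show ?thesis
      using spanned_on_functionals[OF li k[unfolded i(1)]] by (rule spanned_on_le[rotated])
  qed
qed

lemma window_annihilated:
  assumes "0 < N"
  shows "Z (\<Sum>w\<in>bwords (l i * T i). Poly_Mapping.lookup (f i ^ N) (x @ w @ y) * block_sum (l i) (\<phi> i) (T i) (c i a) w)"
proof -
  let ?g = "rder y (lder x (f i ^ N))" and ?W = "l i * T i"
  have h: "homog ?W (block_sum (l i) (\<phi> i) (T i) (c i a))" by (rule homog_block_sum) (rule homog_\<phi>)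
  have "T i \<le> ?W" using l_pos[of i] by (cases "l i") auto
  then have "t i < ?W" using T_large[of i] by linarith
  moreover have "Poly_Mapping.lookup (f i) [] = 0" using keys_f[of "[]" i] by (auto simp: in_keys_iff)
  moreover have "length w \<le> t i" if "w \<in> Poly_Mapping.keys (f i)" for w
    using keys_f[OF that] by (simp add: short_words_def)
  ultimately have "?g \<in> two_sided_pieces ?W (f i)" using assms by (intro window_two_sided)
  then have "Z (pairing ?g (block_sum (l i) (\<phi> i) (T i) (c i a)))"
    by (rule two_sided_annihilated) (use h annihilates in \<open>auto simp: homog_def bwords_def\<close>)
  moreover have "pairing ?g (block_sum (l i) (\<phi> i) (T i) (c i a))
    = (\<Sum>w\<in>bwords ?W. Poly_Mapping.lookup ?g w * block_sum (l i) (\<phi> i) (T i) (c i a) w)"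
    by (rule pairing_support[OF finite_bwords]) (use h in \<open>auto simp: homog_def\<close>)
  ultimately show ?thesis by (simp add: lder.rep_eq rder.rep_eq)
qed

text \<open>The exponent is such that all words of the power have length at least \<open>2 l\<^sub>i\<^sub>+\<^sub>1\<close>. A window of this
  length contains a complete block of level \<open>i + 1\<close>, whose last \<open>l\<^sub>i T\<^sub>i\<close> letters are tested by
  functions that annihilate the corresponding part of the power.\<close>

lemma power_annihilated:
  assumes "g \<in> functionals"
  shows "Z (pairing (f i ^ (2 * l (Suc i))) g)"
proof -
  define N where "N = 2 * l (Suc i)"
  obtain d n b u v where g: "g = (\<lambda>w. d * \<phi> n b (u @ w @ v))"
    using assms unfolding functionals_def by blast
  have len: "N \<le> length w" if "w \<in> Poly_Mapping.keys (f i ^ N)" for w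
  proof -
    have "N * 1 \<le> length w"
    proof (rule length_keys_power[OF _ that])
      fix x assume "x \<in> Poly_Mapping.keys (f i)"
      from keys_f[OF this] show "1 \<le> length x" by (cases x) auto
    qed
    then show ?thesis by simp
  qed
  have "Z (pairing (f i ^ N) (\<lambda>w. \<phi> n b (u @ w @ v)))"
  proof (cases "length u + N + length v \<le> l n \<and> set u \<subseteq> {0, 1} \<and> set v \<subseteq> {0, 1}")
    case False
    have "\<phi> n b (u @ w @ v) = 0" if "w \<in> Poly_Mapping.keys (f i ^ N)" for w
      using False len[OF that] by (intro \<phi>_zero) auto
    then have "pairing (f i ^ N) (\<lambda>w. \<phi> n b (u @ w @ v)) = 0" by (simp add: pairing_def)
    then show ?thesis by (simp add: Z_0)
  next
    case True
    define L where "L = l (Suc i)"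
    have L: "0 < L" unfolding L_def by (rule l_pos)
    have n: "Suc i \<le> n"
    proof (rule ccontr)
      assume "\<not> Suc i \<le> n"
      then have "l n \<le> L" unfolding L_def by (intro l_mono) simp
      then show False using True L by (simp add: N_def L_def)
    qed
    \<comment> \<open>Block \<open>k\<close> of level \<open>i + 1\<close> is the first one to begin inside the window.\<close>
    define k where "k = (length u + (L - 1)) div L"
    have k: "length u \<le> L * k" "L * k < length u + L"
    proof -
      have "(length u + (L - 1)) = L * k + (length u + (L - 1)) mod L" by (simp add: k_def)
      moreover have "(length u + (L - 1)) mod L < L" using L by simp
      ultimately show "length u \<le> L * k" "L * k < length u + L" using L by linarith+
    qed
    \<comment> \<open>The window of length \<open>M\<close> is split into \<open>a\<close> letters up to the end of the padding
      of block \<open>k\<close>, the \<open>W\<close> letters that are tested, and \<open>e\<close> remaining letters.\<close>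
    define M W a e where "M = l n - length u - length v" and "W = l i * T i"
      and "a = L * k + l i * K i - length u" and "e = M - (a + W)"
    have LW: "L = l i * K i + W" by (simp add: L_def l_Suc W_def algebra_simps)
    have M: "length u + M + length v = l n" "2 * L \<le> M" using True by (auto simp: M_def N_def L_def)
    have ua: "length u + a = L * k + l i * K i" using k by (simp add: a_def)
    have aWe: "M = a + (W + e)" using M(2) ua k LW by (simp add: e_def)
    have "pairing (f i ^ N) (\<lambda>w. \<phi> n b (u @ w @ v))
      = (\<Sum>w\<in>bwords M. Poly_Mapping.lookup (f i ^ N) w * \<phi> n b (u @ w @ v))"
    proof (rule pairing_support[OF finite_bwords])
      fix w assume "w \<notin> bwords M"
      then show "\<phi> n b (u @ w @ v) = 0"
        using M(1) by (intro \<phi>_zero) (auto simp: bwords_def)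
    qed
    also have "\<dots> = (\<Sum>x\<in>bwords a. \<Sum>w\<in>bwords W. \<Sum>y\<in>bwords e.
        Poly_Mapping.lookup (f i ^ N) (x @ w @ y) * \<phi> n b (u @ (x @ w @ y) @ v))"
      by (simp only: aWe sum_bwords_add)
    also have "\<dots> = (\<Sum>x\<in>bwords a. \<Sum>y\<in>bwords e. \<Sum>w\<in>bwords W.
        Poly_Mapping.lookup (f i ^ N) (x @ w @ y) * \<phi> n b (u @ (x @ w @ y) @ v))"
      by (intro sum.cong refl sum.swap)
    also have "Z \<dots>"
    proof (rule Z_sum, rule Z_sum)
      fix x y assume x: "x \<in> bwords a" and y: "y \<in> bwords e"
      define U z where "U = take (L * k) (u @ x)" and "z = drop (L * k) (u @ x)"
      have Uz: "u @ x = U @ z" unfolding U_def z_def by (rule append_take_drop_id[symmetric])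
      have lux: "length (u @ x) = L * k + l i * K i" using ua x by (simp add: length_bwords)
      have lU: "length U = L * k" "length z = l i * K i" using lux by (simp_all add: U_def z_def)
      have z: "z \<in> bwords (l i * K i)"
        using True x lU(2) unfolding z_def by (auto simp: bwords_def dest!: in_set_dropD)
      have tot: "length U + l (Suc i) + length (y @ v) = l n"
        using lU y M(1) aWe ua LW by (simp add: length_bwords L_def)
      have "(\<lambda>w. \<phi> n b (U @ w @ (y @ v))) \<in> combos (bwords (l (Suc i))) (range (\<phi> (Suc i)))"
        by (rule aligned_blocks[OF n _ tot]) (simp add: lU L_def)
      then have "(\<lambda>w. \<phi> n b (U @ (z @ w) @ (y @ v))) \<in> combos (bwords W)
          (range (\<lambda>a. block_sum (l i) (\<phi> i) (T i) (c i a)))"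
      proof (rule combos_compose)
        fix w assume "w \<in> bwords W"
        then have "z @ w \<in> bwords (l i * K i + W)" using z by (simp add: append_in_bwords length_bwords)
        then show "z @ w \<in> bwords (l (Suc i))" using LW by (simp add: L_def)
      next
        fix g assume "g \<in> range (\<phi> (Suc i))"
        then obtain a' where g: "g = padded (l i) (\<phi> i) (K i) (T i) (c i a')" by (auto simp: \<phi>_Suc)
        show "(\<lambda>w. g (z @ w)) \<in> combos (bwords W) (range (\<lambda>a. block_sum (l i) (\<phi> i) (T i) (c i a)))"
          unfolding g
          by (rule combos_base[where g = "block_sum (l i) (\<phi> i) (T i) (c i a')"])
            (auto simp: padded_append[OF lU(2)])
      qed
      moreover have "Z (\<Sum>w\<in>bwords W. Poly_Mapping.lookup (f i ^ N) (x @ w @ y) * g w)"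
        if "g \<in> range (\<lambda>a. block_sum (l i) (\<phi> i) (T i) (c i a))" for g
      proof -
        have "0 < N" using l_pos[of "Suc i"] by (simp add: N_def)
        from window_annihilated[OF this] that show ?thesis unfolding W_def by blast
      qed
      ultimately have "Z (\<Sum>w\<in>bwords W. Poly_Mapping.lookup (f i ^ N) (x @ w @ y) * \<phi> n b (U @ (z @ w) @ (y @ v)))"
        by (rule Z_sum_combos[where R = "\<lambda>w. Poly_Mapping.lookup (f i ^ N) (x @ w @ y)"])
      moreover have "u @ (x @ w @ y) @ v = U @ (z @ w) @ (y @ v)" for w
        using Uz by (metis append.assoc)
      ultimately show "Z (\<Sum>w\<in>bwords W. Poly_Mapping.lookup (f i ^ N) (x @ w @ y) * \<phi> n b (u @ (x @ w @ y) @ v))"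
        by (simp only:)
    qed
    finally show ?thesis .
  qed
  then show ?thesis unfolding g pairing_fun_scale N_def by (rule Z_mult)
qed

end

context residue_field
begin

lemma Z_pairing_coeff: "(\<And>w. Z (Poly_Mapping.lookup r w)) \<Longrightarrow> Z (pairing r g)"
  unfolding pairing_def by (intro Z_sum Z_mult')

text \<open>An annihilated power of a representative gives one for all elements of its class.\<close>

lemma pairing_power_cong:
  fixes r s :: "word \<Rightarrow>\<^sub>0 'k"
  assumes "\<And>w. Z (Poly_Mapping.lookup r w - Poly_Mapping.lookup s w)"
  shows "Z (pairing (r ^ N) g - pairing (s ^ N) g)"
proof (induction N arbitrary: g)
  case (Suc N)
  let ?R = "\<lambda>u. pairing (r ^ N) (\<lambda>v. g (u @ v))" and ?S = "\<lambda>u. pairing (s ^ N) (\<lambda>v. g (u @ v))"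
  have "pairing (r ^ Suc N) g - pairing (s ^ Suc N) g
    = pairing (r - s) ?R + pairing s (\<lambda>u. ?R u + (- 1) * ?S u)"
    unfolding power_Suc pairing_mult pairing_fun_add pairing_fun_scale pairing_diff by simp
  moreover have "Z (pairing (r - s) ?R)" by (rule Z_pairing_coeff) (simp add: lookup_minus assms)
  moreover have "Z (pairing s (\<lambda>u. ?R u + (- 1) * ?S u))" by (rule Z_pairing) (use Suc in simp)
  ultimately show ?case by (simp only: Z_add)
qed (simp add: Z_0)

text \<open>If the residue field is countable, then so is the free algebra over it. The ring need not be
  countable, so representatives of the classes are chosen.\<close>

lemma countable_representatives:
  assumes "countable D" "\<And>x. \<exists>d\<in>D. Z (x - d)"
  shows "\<exists>E. countable E \<and> (\<forall>r :: word \<Rightarrow>\<^sub>0 'k. \<exists>s\<in>E. Poly_Mapping.keys s \<subseteq> Poly_Mapping.keys r \<and>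
    (\<forall>w. Z (Poly_Mapping.lookup r w - Poly_Mapping.lookup s w)))"
proof -
  define E where "E = (\<lambda>xs. \<Sum>(w, d)\<leftarrow>xs. Poly_Mapping.single w d) ` lists ((UNIV :: word set) \<times> D)"
  have "countable ((UNIV :: word set) \<times> D)" using assms(1) by (intro countable_SIGMA) auto
  then have "countable E" unfolding E_def by (intro countable_image countable_lists)
  moreover have "\<exists>s\<in>E. Poly_Mapping.keys s \<subseteq> Poly_Mapping.keys r \<and>
    (\<forall>w. Z (Poly_Mapping.lookup r w - Poly_Mapping.lookup s w))" for r :: "word \<Rightarrow>\<^sub>0 'k"
  proof -
    obtain h where h: "\<And>x. h x \<in> D" "\<And>x. Z (x - h x)" using assms(2) by metis
    obtain ws where ws: "set ws = Poly_Mapping.keys r" "distinct ws"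
      using finite_distinct_list[OF finite_keys] by metis
    define s where "s = (\<Sum>(w, d)\<leftarrow>map (\<lambda>w. (w, h (Poly_Mapping.lookup r w))) ws. Poly_Mapping.single w d)"
    have s: "s = (\<Sum>w\<in>Poly_Mapping.keys r. Poly_Mapping.single w (h (Poly_Mapping.lookup r w)))"
      unfolding s_def ws(1)[symmetric]
      by (simp add: sum_list_distinct_conv_sum_set[OF ws(2), symmetric] o_def)
    have ls: "Poly_Mapping.lookup s w = (if w \<in> Poly_Mapping.keys r then h (Poly_Mapping.lookup r w) else 0)" for w
      unfolding s by (simp add: lookup_sum lookup_single when_def)
    have "Z (Poly_Mapping.lookup r w - Poly_Mapping.lookup s w)" for w
      unfolding ls using h(2) by (auto simp: in_keys_iff Z_0)
    moreover have "Poly_Mapping.keys s \<subseteq> Poly_Mapping.keys r"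
      using ls by (metis in_keys_iff subsetI)
    moreover have "s \<in> E"
      unfolding s_def E_def by (rule imageI) (use h(1) in auto)
    ultimately show ?thesis by blast
  qed
  ultimately show ?thesis by blast
qed

text \<open>The tower over an enumeration of representatives of all elements without constant term.\<close>

theorem nil_functionals_exist:
  assumes "countable D" "\<And>x. \<exists>d\<in>D. Z (x - d)"
  shows "\<exists>L :: (word \<Rightarrow> 'k) set.
    (\<forall>g\<in>L. \<forall>a. (\<lambda>w. g (a # w)) \<in> L \<and> (\<lambda>w. g (w @ [a])) \<in> L \<and> (\<forall>d. (\<lambda>w. d * g w) \<in> L)) \<and>
    (\<forall>g\<in>L. \<exists>n. homog n g) \<and> (\<forall>n. \<exists>g\<in>L. \<exists>w\<in>bwords n. \<not> Z (g w)) \<and>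
    (\<exists>C. \<forall>m\<ge>1. spanned_on (bwords m) L (C * m ^ 3)) \<and>
    (\<forall>r. (\<forall>w\<in>Poly_Mapping.keys r. w \<noteq> [] \<and> set w \<subseteq> {0, 1}) \<longrightarrow>
      (\<exists>N. \<forall>g\<in>L. Z (pairing (r ^ N) g)))"
proof -
  define good where "good r \<longleftrightarrow> (\<forall>w\<in>Poly_Mapping.keys r. w \<noteq> [] \<and> set w \<subseteq> {0, 1})" for r :: "word \<Rightarrow>\<^sub>0 'k"
  obtain R where R: "countable R" "\<And>r :: word \<Rightarrow>\<^sub>0 'k. \<exists>s\<in>R. Poly_Mapping.keys s \<subseteq> Poly_Mapping.keys r \<and>
    (\<forall>w. Z (Poly_Mapping.lookup r w - Poly_Mapping.lookup s w))"
    using countable_representatives[OF assms] by blast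
  define E where "E = {s \<in> R. good s}"
  have cE: "countable E" unfolding E_def using R(1) by (rule countable_subset[rotated]) auto
  obtain z where "z \<in> R" "Poly_Mapping.keys z \<subseteq> Poly_Mapping.keys (0 :: word \<Rightarrow>\<^sub>0 'k)" using R(2) by blast
  then have "z \<in> E" by (simp add: E_def good_def)
  then have E0: "E \<noteq> {}" by blast
  define f where "f = from_nat_into E"
  have f: "f i \<in> E" for i using from_nat_into[OF E0] by (simp add: f_def)
  define t where "t i = (\<Sum>w\<in>Poly_Mapping.keys (f i). length w)" for i
  have "w \<noteq> [] \<and> w \<in> short_words (t i)" if "w \<in> Poly_Mapping.keys (f i)" for i w
  proof -
    have "length w \<le> t i" unfolding t_def using that by (intro member_le_sum) auto
    then show ?thesis using that f[of i] by (auto simp: E_def good_def short_words_def)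
  qed
  from tower_exists[of f t, OF this]
  obtain l \<sigma> K T \<phi> p c where "tower Z f t l \<sigma> K T \<phi> p c" by blast
  then interpret tower Z f t l \<sigma> K T \<phi> p c .
  have "\<exists>N. \<forall>g\<in>functionals. Z (pairing (r ^ N) g)" if r: "good r" for r
  proof -
    obtain s where s: "s \<in> R" "Poly_Mapping.keys s \<subseteq> Poly_Mapping.keys r"
      and cong: "\<And>w. Z (Poly_Mapping.lookup r w - Poly_Mapping.lookup s w)"
      using R(2)[of r] by blast
    have "s \<in> E" using s r by (auto simp: E_def good_def)
    then obtain i where i: "f i = s" unfolding f_def using cE by (metis from_nat_into_surj)
    have "Z (pairing (r ^ (2 * l (Suc i))) g)" if "g \<in> functionals" for g
      using Z_cong[OF pairing_power_cong[OF cong]] power_annihilated[OF that, of i] i by simp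
    then show ?thesis by blast
  qed
  then show ?thesis unfolding good_def
    using functionals_Cons functionals_snoc functionals_scale functionals_homog functionals_nonzero growth_functionals
    by (intro exI[of _ functionals] conjI ballI allI impI) auto
qed

end

section \<open>Joining functionals by a separator letter\<close>

definition ternary :: "word \<Rightarrow> bool" where "ternary w \<longleftrightarrow> set w \<subseteq> {0, 1, 2}"

text \<open>The product of the functions \<open>gs\<close> over the segments of a word that is cut at the letter \<open>2\<close>, if the
  number of segments is that of the functions, and \<open>0\<close> otherwise (\<open>join_glue\<close>). In this recursive form,
  translations of the word are translations of the first or the last function.\<close>

primrec join :: "word \<Rightarrow> (word \<Rightarrow> 'k::comm_ring_1) list \<Rightarrow> 'k" where
  "join [] gs = (if length gs = 1 then hd gs [] else 0)"
| "join (a # w) gs = (if gs = [] then 0 else if a = 2 then hd gs [] * join w (tl gs)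
     else join w ((\<lambda>v. hd gs (a # v)) # tl gs))"

lemma join_Nil [simp]: "join w [] = 0"
  by (cases w) auto

lemma join_append: "2 \<notin> set u \<Longrightarrow> join (u @ w) (g # gs) = join w ((\<lambda>v. g (u @ v)) # gs)"
  by (induction u arbitrary: g) auto

lemma join_single: "2 \<notin> set u \<Longrightarrow> join u [g] = g u"
  using join_append[of u "[]" g "[]"] by simp

lemma join_separator: "2 \<notin> set u \<Longrightarrow> join (u @ 2 # w) (g # gs) = g u * join w gs"
  using join_append[of u "2 # w" g gs] by simp

lemma join_scale_hd: "join w ((\<lambda>v. d * g v) # gs) = d * join w (g # gs)"
  by (induction w arbitrary: g) (auto simp: mult.assoc)

lemma join_snoc:
  "a \<noteq> 2 \<Longrightarrow> join (w @ [a]) (gs @ [g]) = join w (gs @ [\<lambda>v. g (v @ [a])])"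
  "join (w @ [2]) (gs @ [g]) = join w gs * g []"
proof (induction w arbitrary: gs g)
  case Nil
  { case 1 then show ?case by (cases gs) auto }
  { case 2 show ?case by (cases gs; cases "tl gs") auto }
next
  case (Cons b w)
  { case 1
    show ?case
    proof (cases gs)
      case Nil
      then show ?thesis using Cons.IH(1)[of "[]"] 1 by simp
    next
      case (Cons h t)
      then show ?thesis using Cons.IH(1)[of t g] Cons.IH(1)[of "(\<lambda>v. h (b # v)) # t" g] 1 by simp
    qed }
  { case 2
    show ?case
    proof (cases gs)
      case Nil
      then show ?thesis using Cons.IH(2)[of "[]"] by simp
    next
      case (Cons h t)
      then show ?thesis using Cons.IH(2)[of t g] Cons.IH(2)[of "(\<lambda>v. h (b # v)) # t" g] by (simp add: mult.assoc)
    qed }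
qed

lemma join_scale_last: "join w (gs @ [\<lambda>v. d * g v]) = d * join w (gs @ [g])"
proof (induction w arbitrary: gs g)
  case Nil
  then show ?case by (cases gs) auto
next
  case (Cons b w)
  show ?case
  proof (cases gs)
    case Nil
    then show ?thesis using Cons[of "[]" "\<lambda>v. g (b # v)"] by simp
  next
    case (Cons h t)
    then show ?thesis using Cons.IH[of t g] Cons.IH[of "(\<lambda>v. h (b # v)) # t" g]
      by (simp add: mult.left_commute)
  qed
qed

lemma join_count: "join w gs \<noteq> 0 \<Longrightarrow> Suc (count_list w 2) = length gs"
proof (induction w arbitrary: gs)
  case (Cons a w)
  show ?case
  proof (cases "a = 2")
    case True
    then have "gs \<noteq> []" "join w (tl gs) \<noteq> 0" using Cons.prems by (auto split: if_splits)
    then show ?thesis using Cons.IH[of "tl gs"] True by (cases gs) auto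
  next
    case False
    then have "gs \<noteq> []" "join w ((\<lambda>v. hd gs (a # v)) # tl gs) \<noteq> 0"
      using Cons.prems by (auto split: if_splits)
    then show ?thesis using Cons.IH[of "(\<lambda>v. hd gs (a # v)) # tl gs"] False by (cases gs) auto
  qed
qed (auto split: if_splits)

fun glue :: "word list \<Rightarrow> word" where
  "glue [] = []"
| "glue [u] = u"
| "glue (u # v # us) = u @ 2 # glue (v # us)"

lemma glue_Cons: "us \<noteq> [] \<Longrightarrow> glue (u # us) = u @ 2 # glue us"
  by (cases us) auto

lemma join_glue:
  assumes "\<forall>u\<in>set us. 2 \<notin> set u" "us \<noteq> []"
  shows "join (glue us) gs = (if length us = length gs then prod_list (map2 (\<lambda>g u. g u) gs us) else 0)"
  using assms
proof (induction us arbitrary: gs)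
  case (Cons u us)
  show ?case
  proof (cases gs)
    case Nil
    then show ?thesis by simp
  next
    case gs: (Cons g hs)
    show ?thesis
    proof (cases "us = []")
      case True
      then show ?thesis using Cons.prems gs join_append[of u "[]" g hs] by auto
    next
      case False
      then show ?thesis using Cons gs by (simp add: glue_Cons join_separator)
    qed
  qed
qed simp

lemma glue_exists: "\<exists>us. us \<noteq> [] \<and> (\<forall>u\<in>set us. 2 \<notin> set u) \<and> glue us = w"
proof (induction w)
  case Nil
  then show ?case by (intro exI[of _ "[[]]"]) simp
next
  case (Cons a w)
  then obtain us where us: "us \<noteq> []" "\<forall>u\<in>set us. 2 \<notin> set u" "glue us = w" by blast
  show ?case
  proof (cases "a = 2")
    case True
    then show ?thesis using us by (intro exI[of _ "[] # us"]) (simp add: glue_Cons)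
  next
    case False
    obtain v vs where "us = v # vs" using us(1) by (cases us) auto
    then show ?thesis using us False
      by (intro exI[of _ "(a # v) # vs"]) (cases vs; auto)
  qed
qed

lemma set_glue: "u \<in> set us \<Longrightarrow> set u \<subseteq> set (glue us)"
  by (induction us rule: glue.induct) auto

lemma set_glue_subset: "set (glue us) \<subseteq> insert 2 (\<Union>u\<in>set us. set u)"
  by (induction us rule: glue.induct) auto

lemma length_glue: "us \<noteq> [] \<Longrightarrow> length (glue us) = sum_list (map length us) + (length us - 1)"
  by (induction us rule: glue.induct) auto

lemma glue_inj:
  assumes "glue us = glue vs" "us \<noteq> []" "vs \<noteq> []" "\<forall>u\<in>set us. 2 \<notin> set u" "\<forall>u\<in>set vs. 2 \<notin> set u"
  shows "us = vs"
  using assms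
proof (induction us arbitrary: vs)
  case (Cons u us)
  obtain v vs' where vs: "vs = v # vs'" using Cons.prems(3) by (cases vs) auto
  have split: "u = v \<and> x = y" if "u @ 2 # x = v @ 2 # y" "2 \<notin> set u" "2 \<notin> set v" for u v x y :: word
  proof -
    have "takeWhile (\<lambda>a. a \<noteq> 2) (u @ 2 # x) = u" "takeWhile (\<lambda>a. a \<noteq> 2) (v @ 2 # y) = v"
      using that(2,3) by (subst takeWhile_append2; force)+
    then have "u = v" using that(1) by simp
    then show ?thesis using that(1) by simp
  qed
  consider "us = []" "vs' = []" | "us = []" "vs' \<noteq> []" | "us \<noteq> []" "vs' = []" | "us \<noteq> []" "vs' \<noteq> []"
    by blast
  then show ?case
  proof cases
    case 2
    then have "2 \<in> set u" using Cons.prems(1) vs by (simp add: glue_Cons)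
    then show ?thesis using Cons.prems(4) by simp
  next
    case 3
    then have "v = u @ 2 # glue us" using Cons.prems(1) vs by (simp add: glue_Cons)
    then have "2 \<in> set v" by simp
    then show ?thesis using Cons.prems(5) vs by simp
  next
    case 4
    then have "u @ 2 # glue us = v @ 2 # glue vs'" using Cons.prems(1) vs by (simp add: glue_Cons)
    then have "u = v" "glue us = glue vs'" using split[of u "glue us" v "glue vs'"] Cons.prems(4,5) vs by auto
    then show ?thesis using Cons.IH[of vs'] Cons.prems(4,5) vs 4 by simp
  qed (use Cons.prems vs in auto)
qed simp

definition translation_closed :: "(word \<Rightarrow> 'k) set \<Rightarrow> bool" where
  "translation_closed L \<longleftrightarrow> (\<forall>g\<in>L. \<forall>a. (\<lambda>w. g (a # w)) \<in> L \<and> (\<lambda>w. g (w @ [a])) \<in> L)"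

lemma translation_closed_append:
  assumes "translation_closed L" "g \<in> L"
  shows "(\<lambda>w. g (u @ w)) \<in> L" "(\<lambda>w. g (w @ v)) \<in> L"
proof -
  show "(\<lambda>w. g (u @ w)) \<in> L"
    using assms by (induction u arbitrary: g) (auto simp: translation_closed_def)
  show "(\<lambda>w. g (w @ v)) \<in> L"
    using assms(2)
  proof (induction v arbitrary: g rule: rev_induct)
    case (snoc a v)
    have "(\<lambda>w. g (w @ [a])) \<in> L" using assms(1) snoc.prems by (simp add: translation_closed_def)
    from snoc.IH[OF this] show ?case by simp
  qed simp
qed

context residue_field
begin

text \<open>The elements annihilated by \<open>L\<close>; an ideal if \<open>L\<close> is translation closed.\<close>

definition null :: "(word \<Rightarrow> 'k) set \<Rightarrow> (word \<Rightarrow>\<^sub>0 'k) set" where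
  "null L = {r. \<forall>g\<in>L. Z (pairing r g)}"

lemma null_zero: "0 \<in> null L" by (simp add: null_def Z_0)

lemma null_add: "\<lbrakk>r \<in> null L; s \<in> null L\<rbrakk> \<Longrightarrow> r + s \<in> null L"
  by (simp add: null_def pairing_add Z_add)

lemma null_diff: "\<lbrakk>r \<in> null L; s \<in> null L\<rbrakk> \<Longrightarrow> r - s \<in> null L"
  by (simp add: null_def pairing_diff Z_diff)

lemma null_scalar: "r \<in> null L \<Longrightarrow> scalar c * r \<in> null L"
  by (simp add: null_def pairing_scalar Z_mult)

lemma null_mult_left:
  assumes "translation_closed L" "s \<in> null L"
  shows "r * s \<in> null L"
  unfolding null_def mem_Collect_eq pairing_mult
proof (intro ballI Z_pairing[of r])
  fix g u assume "g \<in> L"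
  from translation_closed_append(1)[OF assms(1) this, of u] assms(2)
  show "Z (pairing s (\<lambda>v. g (u @ v)))" by (simp add: null_def)
qed

lemma pairing_mult': "pairing (r * s) f = pairing s (\<lambda>v. pairing r (\<lambda>u. f (u @ v)))"
  unfolding pairing_mult unfolding pairing_def sum_distrib_left
  by (subst sum.swap) (simp add: mult.left_commute)

lemma null_mult_right:
  assumes "translation_closed L" "r \<in> null L"
  shows "r * s \<in> null L"
  unfolding null_def mem_Collect_eq pairing_mult'
proof (intro ballI Z_pairing[of s])
  fix g v assume "g \<in> L"
  from translation_closed_append(2)[OF assms(1) this, of v] assms(2)
  show "Z (pairing r (\<lambda>u. g (u @ v)))" by (simp add: null_def)
qed

lemma null_power_add:
  assumes "translation_closed L" "z \<in> null L"
  shows "(z + s) ^ n - s ^ n \<in> null L"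
proof (induction n)
  case (Suc n)
  have "(z + s) ^ Suc n - s ^ Suc n = z * (z + s) ^ n + s * ((z + s) ^ n - s ^ n)"
    by (simp add: algebra_simps)
  then show ?case using null_add null_mult_right[OF assms] null_mult_left[OF assms(1) Suc] by simp
qed (simp add: null_zero)

end

text \<open>\<open>L\<close> is the set of functionals over two letters; \<open>e j\<close> is one member of it that does not vanish on
  the word \<open>ew j\<close> of length \<open>j\<close>; \<open>P i\<close> is a basis of the words of length \<open>i\<close> modulo the ideal
  annihilated by \<open>L\<close>. The set \<open>J\<close> and the number \<open>m\<close> will control the growth.\<close>

locale layered = residue_field Z for Z :: "'k::comm_ring_1 \<Rightarrow> bool" +
  fixes L :: "(word \<Rightarrow> 'k) set" and e :: "nat \<Rightarrow> word \<Rightarrow> 'k" and ew :: "nat \<Rightarrow> word"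
    and P :: "nat \<Rightarrow> word set" and J :: "nat set" and m :: nat
  assumes L_closed: "translation_closed L"
    and L_scale: "g \<in> L \<Longrightarrow> (\<lambda>w. d * g w) \<in> L"
    and L_homog: "g \<in> L \<Longrightarrow> \<exists>n. homog n g"
    and L_nil: "(\<And>w. w \<in> Poly_Mapping.keys r \<Longrightarrow> w \<noteq> [] \<and> set w \<subseteq> {0, 1}) \<Longrightarrow> \<exists>N. r ^ N \<in> null L"
    and e_L: "e j \<in> L" and ew: "ew j \<in> bwords j" and e_ew: "\<not> Z (e j (ew j))"
    and P_bwords: "P i \<subseteq> bwords i" and P_indep: "indep L (P i)"
    and P_spans: "w \<in> bwords i \<Longrightarrow> \<exists>c. \<forall>g\<in>L. Z (g w - (\<Sum>p\<in>P i. c p * g p))"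
begin

lemma e_zero: "u \<notin> bwords j \<Longrightarrow> e j u = 0"
proof -
  assume u: "u \<notin> bwords j"
  obtain n where n: "homog n (e j)" using L_homog[OF e_L] by blast
  have "e j (ew j) \<noteq> 0" using e_ew Z_0 by metis
  then have "ew j \<in> bwords n" using n by (auto simp: homog_def)
  then have "n = j" using ew length_bwords by metis
  then show ?thesis using n u by (simp add: homog_def)
qed

text \<open>The first and the last segment are tested by arbitrary members of \<open>L\<close>, those in between by
  the fixed functions \<open>e j\<close> only. Cutting off letters at either end makes an inner segment the first or
  the last one. This keeps the set translation closed, since \<open>e j \<in> L\<close>.\<close>

definition layers :: "(word \<Rightarrow> 'k) set" where
  "layers = {\<lambda>w. join w [g] | g. g \<in> L} \<union>
     {\<lambda>w. join w (g # map e js @ [h]) | g js h. g \<in> L \<and> h \<in> L \<and> set js \<subseteq> J \<and> length js \<le> m}"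

lemma layers1: "g \<in> L \<Longrightarrow> (\<lambda>w. join w [g]) \<in> layers"
  unfolding layers_def by blast

lemma layers2: "\<lbrakk>g \<in> L; h \<in> L; set js \<subseteq> J; length js \<le> m\<rbrakk> \<Longrightarrow> (\<lambda>w. join w (g # map e js @ [h])) \<in> layers"
  unfolding layers_def by blast

lemma layersE:
  assumes "f \<in> layers"
  obtains g where "g \<in> L" "f = (\<lambda>w. join w [g])"
  | g js h where "g \<in> L" "h \<in> L" "set js \<subseteq> J" "length js \<le> m" "f = (\<lambda>w. join w (g # map e js @ [h]))"
  using assms unfolding layers_def by blast

lemma L_translate: "g \<in> L \<Longrightarrow> (\<lambda>w. g (a # w)) \<in> L" "g \<in> L \<Longrightarrow> (\<lambda>w. g (w @ [a])) \<in> L"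
  using L_closed by (auto simp: translation_closed_def)

lemma layers_closed: "translation_closed layers"
  unfolding translation_closed_def
proof (intro ballI allI conjI)
  fix f a assume "f \<in> layers"
  then show "(\<lambda>w. f (a # w)) \<in> layers"
  proof (cases rule: layersE)
    case (1 g)
    show ?thesis
    proof (cases "a = 2")
      case True
      then have "(\<lambda>w. f (a # w)) = (\<lambda>w. join w [\<lambda>v. 0 * g v])"
        unfolding join_scale_hd using 1 by simp
      then show ?thesis using layers1[OF L_scale[OF 1(1), of 0]] by simp
    next
      case False
      then show ?thesis using 1 layers1[OF L_translate(1)[OF 1(1), of a]] by simp
    qed
  next
    case (2 g js h)
    show ?thesis
    proof (cases "a = 2")
      case True
      show ?thesis
      proof (cases js)
        case Nil
        then have "(\<lambda>w. f (a # w)) = (\<lambda>w. join w [\<lambda>v. g [] * h v])"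
          unfolding join_scale_hd using 2 True by simp
        then show ?thesis using layers1[OF L_scale[OF 2(2), of "g []"]] by simp
      next
        case (Cons j js')
        then have "(\<lambda>w. f (a # w)) = (\<lambda>w. join w ((\<lambda>v. g [] * e j v) # map e js' @ [h]))"
          unfolding join_scale_hd using 2 True by simp
        then show ?thesis using layers2[OF L_scale[OF e_L[of j], of "g []"] 2(2), of js'] 2 Cons by simp
      qed
    next
      case False
      then show ?thesis using 2 layers2[OF L_translate(1)[OF 2(1), of a] 2(2-4)] by simp
    qed
  qed
next
  fix f a assume "f \<in> layers"
  then show "(\<lambda>w. f (w @ [a])) \<in> layers"
  proof (cases rule: layersE)
    case (1 g)
    show ?thesis
    proof (cases "a = 2")
      case True
      then have "(\<lambda>w. f (w @ [a])) = (\<lambda>w. join w [\<lambda>v. 0 * g v])"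
        unfolding join_scale_hd using 1 join_snoc(2)[of _ "[]" g] by simp
      then show ?thesis using layers1[OF L_scale[OF 1(1), of 0]] by simp
    next
      case False
      then show ?thesis using 1 layers1[OF L_translate(2)[OF 1(1), of a]] join_snoc(1)[of a _ "[]" g] by simp
    qed
  next
    case (2 g js h)
    show ?thesis
    proof (cases "a = 2")
      case True
      then have f: "(\<lambda>w. f (w @ [a])) = (\<lambda>w. h [] * join w (g # map e js))"
        using 2 join_snoc(2)[of _ "g # map e js" h] by (simp add: mult.commute)
      show ?thesis
      proof (cases js rule: rev_cases)
        case Nil
        then have "(\<lambda>w. f (w @ [a])) = (\<lambda>w. join w [\<lambda>v. h [] * g v])"
          unfolding join_scale_hd using f by simp
        then show ?thesis using layers1[OF L_scale[OF 2(1), of "h []"]] by simp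
      next
        case (snoc js' j)
        then have "(\<lambda>w. f (w @ [a])) = (\<lambda>w. join w (g # map e js' @ [\<lambda>v. h [] * e j v]))"
          using f join_scale_last[of _ "g # map e js'" "h []" "e j"] by simp
        then show ?thesis using layers2[OF 2(1) L_scale[OF e_L[of j], of "h []"], of js'] 2 snoc by simp
      qed
    next
      case False
      then show ?thesis using 2 layers2[OF 2(1) L_translate(2)[OF 2(2), of a] 2(3,4)]
          join_snoc(1)[of a _ "g # map e js" h] by simp
    qed
  qed
qed

text \<open>Let \<open>r\<^sub>0\<close> be the part of \<open>r\<close> on words without separator. Some power \<open>r\<^sub>0\<^sup>N\<close> is annihilated, as on such words
  \<open>layers\<close> agrees with \<open>L\<close>. Modulo the ideal, \<open>r\<^sup>N\<close> therefore has a separator in each of its words, and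
  its power with exponent \<open>m + 2\<close> has more separators than any functional allows.\<close>

lemma layers_nil:
  assumes keys: "\<And>w. w \<in> Poly_Mapping.keys r \<Longrightarrow> w \<noteq> [] \<and> ternary w"
  shows "\<exists>N. r ^ N \<in> null layers"
proof -
  define r0 where "r0 = (\<Sum>w\<in>{w \<in> Poly_Mapping.keys r. 2 \<notin> set w}. Poly_Mapping.single w (Poly_Mapping.lookup r w))"
  define r1 where "r1 = (\<Sum>w\<in>{w \<in> Poly_Mapping.keys r. 2 \<in> set w}. Poly_Mapping.single w (Poly_Mapping.lookup r w))"
  have l0: "Poly_Mapping.lookup r0 w = (if 2 \<in> set w then 0 else Poly_Mapping.lookup r w)" for w
    unfolding r0_def by (auto simp: lookup_sum lookup_single when_def in_keys_iff)
  have l1: "Poly_Mapping.lookup r1 w = (if 2 \<in> set w then Poly_Mapping.lookup r w else 0)" for w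
    unfolding r1_def by (auto simp: lookup_sum lookup_single when_def in_keys_iff)
  have r: "r = r0 + r1" by (rule poly_mapping_eqI) (simp add: lookup_add l0 l1)
  have k1: "2 \<in> set w" if "w \<in> Poly_Mapping.keys r1" for w
    using that by (auto simp: in_keys_iff l1 split: if_splits)
  have k0: "w \<noteq> [] \<and> set w \<subseteq> {0, 1}" if "w \<in> Poly_Mapping.keys r0" for w
    using that keys[of w] by (auto simp: in_keys_iff l0 ternary_def split: if_splits)
  obtain N where N: "r0 ^ N \<in> null L" using L_nil[OF k0] by blast
  have split: "\<exists>s. r ^ n = r0 ^ n + s \<and> (\<forall>w\<in>Poly_Mapping.keys s. 2 \<in> set w)" for n
  proof (induction n)
    case 0
    show ?case by (intro exI[of _ 0]) simp
  next
    case (Suc n)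
    then obtain s where s: "r ^ n = r0 ^ n + s" "\<forall>w\<in>Poly_Mapping.keys s. 2 \<in> set w" by blast
    have "r ^ Suc n = r0 ^ Suc n + (r0 * s + r1 * r ^ n)"
      using r s(1) by (simp add: algebra_simps)
    moreover have "2 \<in> set w" if wk: "w \<in> Poly_Mapping.keys (r0 * s + r1 * r ^ n)" for w
    proof -
      consider "w \<in> Poly_Mapping.keys (r0 * s)" | "w \<in> Poly_Mapping.keys (r1 * r ^ n)"
        using subsetD[OF Poly_Mapping.keys_add wk] by blast
      then show ?thesis
      proof cases
        case 1
        then show ?thesis using subsetD[OF keys_mult_words 1] s(2) by auto
      next
        case 2
        then show ?thesis using subsetD[OF keys_mult_words 2] k1 by auto
      qed
    qed
    ultimately show ?case by blast
  qed
  obtain s where s: "r ^ N = r0 ^ N + s" "\<forall>w\<in>Poly_Mapping.keys s. 2 \<in> set w" using split by blast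
  have z: "r0 ^ N \<in> null layers"
    unfolding null_def
  proof (intro CollectI ballI)
    fix f assume "f \<in> layers"
    have free: "2 \<notin> set w" if "w \<in> Poly_Mapping.keys (r0 ^ N)" for w
    proof -
      have "set w \<subseteq> {0, 1}" by (rule set_keys_power[OF _ that]) (use k0 in blast)
      then show ?thesis by auto
    qed
    from \<open>f \<in> layers\<close> show "Z (pairing (r0 ^ N) f)"
    proof (cases rule: layersE)
      case (1 g)
      have "pairing (r0 ^ N) f = pairing (r0 ^ N) g"
        unfolding pairing_def 1(2) by (intro sum.cong refl) (simp add: free join_single)
      then show ?thesis using N 1(1) by (simp add: null_def)
    next
      case (2 g js h)
      have "f w = 0" if "w \<in> Poly_Mapping.keys (r0 ^ N)" for w
        using free[OF that] join_count[of w "g # map e js @ [h]"] 2(5) by (auto simp: count_list_0_iff)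
      then show ?thesis by (simp add: pairing_def Z_0)
    qed
  qed
  have count: "n \<le> count_list w 2" if "w \<in> Poly_Mapping.keys (s ^ n)" for w n
    using that
  proof (induction n arbitrary: w)
    case (Suc n)
    then obtain u v where uv: "w = u @ v" "u \<in> Poly_Mapping.keys s" "v \<in> Poly_Mapping.keys (s ^ n)"
      using subsetD[OF keys_mult_words[of s "s ^ n"], of w] by auto
    have "count_list u 2 \<noteq> 0" using s(2) uv(2) by (auto simp: count_list_0_iff)
    then show ?case using Suc.IH[OF uv(3)] uv(1) by simp
  qed simp
  have "s ^ (m + 2) \<in> null layers"
    unfolding null_def
  proof (intro CollectI ballI)
    fix f assume "f \<in> layers"
    then have "f w = 0" if "w \<in> Poly_Mapping.keys (s ^ (m + 2))" for w
    proof (cases rule: layersE)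
      case (1 g)
      then show ?thesis using count[OF that] join_count[of w "[g]"] by auto
    next
      case (2 g js h)
      then show ?thesis using count[OF that] join_count[of w "g # map e js @ [h]"] by auto
    qed
    then show "Z (pairing (s ^ (m + 2)) f)" by (simp add: pairing_def Z_0)
  qed
  from null_add[OF null_power_add[OF layers_closed z, of s "m + 2"] this]
  have "(r ^ N) ^ (m + 2) \<in> null layers" by (simp add: s(1))
  then show ?thesis by (metis power_mult)
qed

text \<open>The basis of the part of the binary algebra up to length \<open>n\<close>. Its size determines the growth.\<close>

definition base_words :: "nat \<Rightarrow> word set" where "base_words n = (\<Union>i\<le>n. P i)"

lemma finite_P: "finite (P i)"
  using P_bwords finite_bwords finite_subset by blast

lemma finite_base_words: "finite (base_words n)"
  by (simp add: base_words_def finite_P)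

lemma base_words_binary: "p \<in> base_words n \<Longrightarrow> length p \<le> n \<and> set p \<subseteq> {0, 1}"
  using P_bwords by (fastforce simp: base_words_def bwords_def)

lemma base_words_free: "p \<in> base_words n \<Longrightarrow> 2 \<notin> set p"
  using base_words_binary[of p n] by auto

text \<open>The functionals are homogeneous, so that a linear relation splits into relations of each length.\<close>

lemma indep_base_words: "indep L (base_words n)"
  unfolding indep_def
proof (intro conjI allI impI ballI finite_base_words)
  fix c p assume c: "\<forall>g\<in>L. Z (\<Sum>p\<in>base_words n. c p * g p)" and "p \<in> base_words n"
  then obtain i where i: "i \<le> n" "p \<in> P i" by (auto simp: base_words_def)
  show "Z (c p)"
  proof (rule indepD[OF P_indep _ i(2)])
    fix g assume g: "g \<in> L"
    obtain k where k: "homog k g" using L_homog[OF g] by blast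
    show "Z (\<Sum>p\<in>P i. c p * g p)"
    proof (cases "k = i")
      case True
      have "(\<Sum>p\<in>base_words n. c p * g p) = (\<Sum>p\<in>P i. c p * g p)"
      proof (rule sum.mono_neutral_right[OF finite_base_words])
        show "P i \<subseteq> base_words n" using i by (auto simp: base_words_def)
        show "\<forall>q\<in>base_words n - P i. c q * g q = 0"
        proof
          fix q assume "q \<in> base_words n - P i"
          then obtain i' where "q \<in> P i'" "i' \<noteq> i" by (auto simp: base_words_def)
          then have "q \<notin> bwords k" using P_bwords length_bwords True by blast
          then show "c q * g q = 0" using k by (simp add: homog_def)
        qed
      qed
      then show ?thesis using c g by metis
    next
      case False
      have "g q = 0" if "q \<in> P i" for q
      proof -
        have "q \<notin> bwords k" using that P_bwords length_bwords False by blast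
        then show ?thesis using k by (simp add: homog_def)
      qed
      then show ?thesis by (simp add: Z_0)
    qed
  qed
qed

definition middle :: "nat list \<Rightarrow> word list \<Rightarrow> 'k" where
  "middle js us = prod_list (map2 e js us)"

text \<open>As \<open>e j\<close> is concentrated in length \<open>j\<close>, the lengths of the inner segments determine which functional
  can be nonzero on them.\<close>

lemma middle_zero: "length us = length js \<Longrightarrow> js \<noteq> map length us \<Longrightarrow> middle js us = 0"
  unfolding middle_def
  by (induction js us rule: list_induct2') (auto simp: e_zero bwords_def)

lemma middle_nonzero: "\<not> Z (middle js (map ew js))"
  unfolding middle_def by (induction js) (auto simp: Z_1 Z_mult_iff e_ew)

lemma join_glue_layers:
  assumes "2 \<notin> set u" "2 \<notin> set v" "\<forall>x\<in>set us. 2 \<notin> set x"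
  shows "join (glue (u # us @ [v])) (g # map e js @ [h])
    = (if js = map length us then g u * middle js us * h v else 0)"
proof -
  have "join (glue (u # us @ [v])) (g # map e js @ [h])
    = (if length us = length js then g u * (middle js us * h v) else 0)"
  proof -
    have "prod_list (map2 (\<lambda>g u. g u) (map e js @ [h]) (us @ [v])) = middle js us * h v"
      if "length us = length js"
      using that[symmetric] unfolding middle_def
      by (induction js us rule: list_induct2) (auto simp: mult.assoc)
    then show ?thesis using assms by (subst join_glue) auto
  qed
  then show ?thesis using middle_zero[of us js] by (auto simp: mult.assoc)
qed

lemma ew_free: "2 \<notin> set (ew j)"
  using ew[of j] by (auto simp: bwords_def)

lemma length_ew: "length (ew j) = j"
  using ew length_bwords by blast

lemma map_length_ew: "map length (map ew js) = js"
  by (induction js) (auto simp: length_ew)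

text \<open>The word \<open>p 2 u\<^sub>1 2 \<dots> 2 u\<^sub>k 2 q\<close> with \<open>u\<^sub>i = ew j\<^sub>i\<close>. Up to scalars, the functionals see no other inner
  segments.\<close>

definition layer_word :: "word \<times> nat list \<times> word \<Rightarrow> word" where
  "layer_word = (\<lambda>(p, js, q). glue (p # map ew js @ [q]))"

definition J_lists :: "nat \<Rightarrow> nat list set" where
  "J_lists n = {js. set js \<subseteq> J \<inter> {..n} \<and> length js \<le> m}"

definition spanning_words :: "nat \<Rightarrow> word set" where
  "spanning_words n = (\<Union>i\<in>{1..n}. P i) \<union> layer_word ` (base_words n \<times> J_lists n \<times> base_words n)"

lemma finite_J_lists: "finite (J_lists n)"
  unfolding J_lists_def by (rule finite_lists_length_le) simp

lemma finite_spanning_words: "finite (spanning_words n)"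
  unfolding spanning_words_def by (simp add: finite_P finite_base_words finite_J_lists)

lemma glue_ternary: "(\<And>u. u \<in> set us \<Longrightarrow> set u \<subseteq> {0, 1}) \<Longrightarrow> ternary (glue us)"
  using set_glue_subset[of us] by (fastforce simp: ternary_def)

lemma layer_word_ternary:
  assumes "p \<in> base_words n" "q \<in> base_words k"
  shows "ternary (layer_word (p, js, q))"
proof -
  have "set u \<subseteq> {0, 1}" if "u \<in> set (p # map ew js @ [q])" for u
    using that base_words_binary[OF assms(1)] base_words_binary[OF assms(2)] ew by (auto simp: bwords_def)
  then show ?thesis unfolding layer_word_def by (simp only: case_prod_conv glue_ternary)
qed

lemma layer_word_two: "2 \<in> set (layer_word t)"
  by (cases t) (simp add: layer_word_def glue_Cons)

lemma spanning_words_words: "q \<in> spanning_words n \<Longrightarrow> q \<noteq> [] \<and> ternary q"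
proof -
  assume "q \<in> spanning_words n"
  then consider i where "1 \<le> i" "q \<in> P i" | p js p' where "p \<in> base_words n" "p' \<in> base_words n" "q = layer_word (p, js, p')"
    unfolding spanning_words_def by auto
  then show ?thesis
  proof cases
    case 1
    then show ?thesis using P_bwords[of i] by (auto simp: bwords_def ternary_def)
  next
    case 2
    then show ?thesis using layer_word_ternary layer_word_two[of "(p, js, p')"] by force
  qed
qed

lemma card_spanning_words:
  assumes "J \<inter> {..n} \<noteq> {}" "base_words n \<noteq> {}"
  shows "card (spanning_words n) \<le> (m + 2) * (card (base_words n))\<^sup>2 * card (J \<inter> {..n}) ^ m"
proof -
  let ?H = "card (base_words n)" and ?k = "card (J \<inter> {..n})"
  have k: "1 \<le> ?k" using assms(1) by (simp add: Suc_leI card_gt_0_iff)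
  have H: "1 \<le> ?H" using assms(2) finite_base_words by (simp add: Suc_leI card_gt_0_iff)
  have cJ: "card (J_lists n) \<le> (m + 1) * ?k ^ m"
  proof -
    have "card (J_lists n) = (\<Sum>i\<le>m. ?k ^ i)"
      unfolding J_lists_def by (rule card_lists_length_le) simp
    also have "\<dots> \<le> (\<Sum>i\<le>m. ?k ^ m)" using k by (intro sum_mono power_increasing) auto
    finally show ?thesis by simp
  qed
  have "card (\<Union>i\<in>{1..n}. P i) \<le> ?H" by (intro card_mono finite_base_words) (auto simp: base_words_def)
  also have "\<dots> \<le> ?H\<^sup>2 * ?k ^ m"
    using H k by (metis mult_le_mono one_le_power power2_eq_square mult.right_neutral le_square le_trans nat_le_iff_add one_le_mult_iff)
  finally have 1: "card (\<Union>i\<in>{1..n}. P i) \<le> ?H\<^sup>2 * ?k ^ m" .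
  have "card (layer_word ` (base_words n \<times> J_lists n \<times> base_words n)) \<le> card (base_words n \<times> J_lists n \<times> base_words n)"
    by (intro card_image_le) (simp add: finite_base_words finite_J_lists)
  also have "\<dots> = ?H * (card (J_lists n) * ?H)" by (simp add: card_cartesian_product)
  also have "\<dots> \<le> ?H * (((m + 1) * ?k ^ m) * ?H)" by (intro mult_le_mono2 mult_le_mono1 cJ)
  also have "\<dots> = (m + 1) * (?H\<^sup>2 * ?k ^ m)" by (simp only: power2_eq_square mult_ac)
  finally have 2: "card (layer_word ` (base_words n \<times> J_lists n \<times> base_words n)) \<le> (m + 1) * (?H\<^sup>2 * ?k ^ m)" .
  have "card (spanning_words n) \<le> ?H\<^sup>2 * ?k ^ m + (m + 1) * (?H\<^sup>2 * ?k ^ m)"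
    unfolding spanning_words_def by (rule le_trans[OF card_Un_le add_le_mono[OF 1 2]])
  then show ?thesis by (simp add: algebra_simps)
qed

lemma layer_word_inj: "inj_on layer_word (base_words n \<times> UNIV \<times> base_words n)"
proof (rule inj_onI)
  fix x y assume x: "x \<in> base_words n \<times> UNIV \<times> base_words n" and y: "y \<in> base_words n \<times> UNIV \<times> base_words n"
    and eq: "layer_word x = layer_word y"
  obtain p js q p' js' q' where xy: "x = (p, js, q)" "y = (p', js', q')" by (cases x; cases y)
  have "p # map ew js @ [q] = p' # map ew js' @ [q']"
    using eq x y unfolding xy layer_word_def
    by (intro glue_inj) (auto simp: base_words_free ew_free)
  then have *: "p = p'" "map ew js = map ew js'" "q = q'" by auto
  from *(2) have "js = js'" by (metis map_length_ew)
  with * xy show "x = y" by simp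
qed

text \<open>The outer segments are expanded in the bases \<open>P\<close>; the inner segments may be replaced by the
  words \<open>ew j\<close> of the same lengths, at the cost of a scalar.\<close>

lemma words_spanned:
  assumes w: "ternary w" "w \<noteq> []" "length w \<le> n"
  shows "\<exists>c. \<forall>f\<in>layers. Z (f w - (\<Sum>q\<in>spanning_words n. c q * f q))"
proof -
  obtain us where us: "us \<noteq> []" "\<forall>u\<in>set us. 2 \<notin> set u" "glue us = w"
    using glue_exists by blast
  have bin: "u \<in> bwords (length u)" if "u \<in> set us" for u
    using set_glue[OF that] us(2,3) that w(1) by (fastforce simp: bwords_def ternary_def)
  have len: "length u \<le> n" if "u \<in> set us" for u
  proof -
    have "length u \<le> sum_list (map length us)" using that by (intro member_le_sum_list) auto
    then show ?thesis using length_glue[OF us(1)] us(3) w(3) by simp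
  qed
  obtain u us' where u: "us = u # us'" using us(1) by (cases us) auto
  show ?thesis
  proof (cases us' rule: rev_cases)
    case Nil
    then have wu: "w = u" using us u by simp
    then have i: "length u \<in> {1..n}" using w by (cases u) auto
    obtain c where c: "\<And>g. g \<in> L \<Longrightarrow> Z (g u - (\<Sum>p\<in>P (length u). c p * g p))"
      using P_spans[OF bin[of u]] u by auto
    define c' where "c' q = (if q \<in> P (length u) then c q else 0)" for q
    have free: "2 \<notin> set q" if "q \<in> P (length u)" for q
      using that P_bwords by (fastforce simp: bwords_def)
    have sum: "(\<Sum>q\<in>spanning_words n. c' q * f q) = (\<Sum>q\<in>P (length u). c q * f q)" for f
      using i finite_spanning_words
      by (intro sum.mono_neutral_cong_right) (auto simp: c'_def spanning_words_def)
    show ?thesis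
    proof (intro exI[of _ c'] ballI)
      fix f assume "f \<in> layers"
      then show "Z (f w - (\<Sum>q\<in>spanning_words n. c' q * f q))"
      proof (cases rule: layersE)
        case (1 g)
        have "(\<Sum>q\<in>P (length u). c q * f q) = (\<Sum>q\<in>P (length u). c q * g q)"
          using free by (intro sum.cong refl) (simp add: 1(2) join_single)
        then show ?thesis using c[OF 1(1)] us u unfolding sum by (simp add: wu 1(2) join_single)
      next
        case (2 g js h)
        have "f q = 0" if "2 \<notin> set q" for q
          using that join_count[of q "g # map e js @ [h]"] by (auto simp: 2(5) count_list_0_iff)
        then show ?thesis using free us u by (simp add: sum wu Z_0)
      qed
    qed
  next
    case (snoc mids v)
    have usv: "us = u # mids @ [v]" using u snoc by simp
    have two: "2 \<in> set w" using us(3) usv by (auto simp: glue_Cons)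
    have f1: "join w [g] = 0" for g :: "word \<Rightarrow> 'k"
    proof (rule ccontr)
      assume "join w [g] \<noteq> 0"
      from join_count[OF this] two show False by (simp add: count_list_0_iff)
    qed
    have f2: "join w (g # map e js @ [h]) = (if js = map length mids then g u * middle js mids * h v else 0)"
      for g h :: "word \<Rightarrow> 'k" and js
      unfolding us(3)[symmetric] usv by (rule join_glue_layers) (use us(2) usv in auto)
    define js where "js = map length mids"
    show ?thesis
    proof (cases "set js \<subseteq> J \<and> length js \<le> m")
      case False
      have z: "f w = 0" if "f \<in> layers" for f
        using that
      proof (cases rule: layersE)
        case (1 g)
        then show ?thesis using f1 by simp
      next
        case (2 g js' h)
        then show ?thesis using f2[of g js' h] False by (auto simp: js_def)
      qed
      have "Z (f w - (\<Sum>q\<in>spanning_words n. 0 * f q))" if "f \<in> layers" for f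
        using z[OF that] Z_0 by simp
      then show ?thesis by (intro exI[of _ "\<lambda>_. 0"]) blast
    next
      case True
      have jl: "js \<in> J_lists n"
        using True len usv by (auto simp: J_lists_def js_def)
      obtain c where c: "\<And>g. g \<in> L \<Longrightarrow> Z (g u - (\<Sum>p\<in>P (length u). c p * g p))"
        using P_spans[OF bin[of u]] usv by auto
      obtain d where d: "\<And>g. g \<in> L \<Longrightarrow> Z (g v - (\<Sum>p\<in>P (length v). d p * g p))"
        using P_spans[OF bin[of v]] usv by auto
      obtain y where y: "Z (middle js (map ew js) * y - 1)" using Z_inv[OF middle_nonzero] by blast
      let ?I = "P (length u) \<times> P (length v)"
      let ?word = "\<lambda>x. layer_word (fst x, js, snd x)"
      have sub: "P (length u) \<subseteq> base_words n" "P (length v) \<subseteq> base_words n"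
        using len usv by (auto simp: base_words_def)
      have inj: "inj_on ?word ?I"
      proof (rule inj_onI)
        fix x x' assume x: "x \<in> ?I" "x' \<in> ?I" and eq: "?word x = ?word x'"
        have "(fst x, js, snd x) = (fst x', js, snd x')"
          by (rule inj_onD[OF layer_word_inj[of n] eq]) (use x sub in auto)
        then show "x = x'" by (simp add: prod_eq_iff)
      qed
      have im: "?word ` ?I \<subseteq> spanning_words n"
        using sub jl unfolding spanning_words_def by auto
      \<comment> \<open>The factor \<open>y * middle js mids\<close> is the ratio of the values of the functionals on
        the inner segments of \<open>w\<close> and on the words that replace them.\<close>
      define C where "C q = (if q \<in> ?word ` ?I then
        (let x = inv_into ?I ?word q in c (fst x) * d (snd x) * (y * middle js mids)) else 0)" for q
      have sum: "(\<Sum>q\<in>spanning_words n. C q * f q)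
        = (\<Sum>x\<in>?I. c (fst x) * d (snd x) * (y * middle js mids) * f (?word x))" for f
      proof -
        have "(\<Sum>q\<in>spanning_words n. C q * f q) = (\<Sum>q\<in>?word ` ?I. C q * f q)"
          by (rule sum.mono_neutral_right[OF finite_spanning_words im]) (simp add: C_def)
        also have "\<dots> = (\<Sum>x\<in>?I. C (?word x) * f (?word x))"
          by (rule sum.reindex_cong[OF inj refl refl])
        also have "\<dots> = (\<Sum>x\<in>?I. c (fst x) * d (snd x) * (y * middle js mids) * f (?word x))"
        proof (intro sum.cong refl)
          fix x assume x: "x \<in> ?I"
          then have "?word x \<in> ?word ` ?I" by (rule imageI)
          then have "C (?word x) = c (fst x) * d (snd x) * (y * middle js mids)"
            using inv_into_f_f[OF inj x] by (simp only: C_def Let_def if_True)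
          then show "C (?word x) * f (?word x) = c (fst x) * d (snd x) * (y * middle js mids) * f (?word x)"
            by (simp only:)
        qed
        finally show ?thesis .
      qed
      show ?thesis
      proof (intro exI[of _ C] ballI)
        fix f assume "f \<in> layers"
        then show "Z (f w - (\<Sum>q\<in>spanning_words n. C q * f q))"
        proof (cases rule: layersE)
          case (1 g)
          have "f (layer_word t) = 0" for t
          proof (rule ccontr)
            assume "f (layer_word t) \<noteq> 0"
            then show False using join_count[of "layer_word t" "[g]"] layer_word_two[of t]
              by (simp add: 1(2) count_list_0_iff)
          qed
          then show ?thesis unfolding sum using f1 1(2) by (simp add: Z_0)
        next
          case (2 g js' h)
          have fx: "f (?word x) = (if js' = js then g (fst x) * middle js (map ew js) * h (snd x) else 0)"
            if "x \<in> ?I" for x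
          proof -
            have "2 \<notin> set (fst x)" "2 \<notin> set (snd x)" using that sub base_words_free by auto
            then show ?thesis
              unfolding 2(5) layer_word_def case_prod_conv
              by (subst join_glue_layers) (auto simp: ew_free map_length_ew simp del: map_map)
          qed
          show ?thesis
          proof (cases "js' = js")
            case False
            then have "f w = 0" using f2[of g js' h] by (simp add: 2(5) js_def)
            moreover have "(\<Sum>q\<in>spanning_words n. C q * f q) = 0"
              unfolding sum using fx False by (intro sum.neutral) auto
            ultimately show ?thesis by (simp add: Z_0)
          next
            case True
            define gs hs M M0 where "gs = (\<Sum>p\<in>P (length u). c p * g p)"
              and "hs = (\<Sum>p\<in>P (length v). d p * h p)" and "M = middle js mids"
              and "M0 = middle js (map ew js)"
            have "(\<Sum>q\<in>spanning_words n. C q * f q)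
              = (\<Sum>x\<in>?I. (M * (y * M0)) * ((c (fst x) * g (fst x)) * (d (snd x) * h (snd x))))"
              unfolding sum using fx True by (intro sum.cong refl) (simp add: M_def M0_def mult_ac)
            also have "\<dots> = M * (y * M0) * (\<Sum>x\<in>?I. (c (fst x) * g (fst x)) * (d (snd x) * h (snd x)))"
              by (rule sum_distrib_left[symmetric])
            also have "(\<Sum>x\<in>?I. (c (fst x) * g (fst x)) * (d (snd x) * h (snd x))) = gs * hs"
              unfolding gs_def hs_def sum_product sum.cartesian_product by (simp add: case_prod_beta)
            finally have s: "(\<Sum>q\<in>spanning_words n. C q * f q) = M * (y * M0) * (gs * hs)" .
            have fw: "f w = g u * M * h v" using f2[of g js' h] True by (simp add: 2(5) js_def M_def)
            have z1: "Z ((g u - gs) * (M * h v))" using c[OF 2(1)] unfolding gs_def by (rule Z_mult')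
            have z2: "Z ((gs * M) * (h v - hs))" using d[OF 2(2)] unfolding hs_def by (rule Z_mult)
            have z3: "Z ((M * gs * hs) * (M0 * y - 1))" using y unfolding M0_def by (rule Z_mult)
            have "Z ((g u - gs) * (M * h v) + (gs * M) * (h v - hs) - (M * gs * hs) * (M0 * y - 1))"
              by (rule Z_diff[OF Z_add[OF z1 z2] z3])
            then show ?thesis unfolding s fw by (simp add: algebra_simps)
          qed
        qed
      qed
    qed
  qed
qed

text \<open>Restricting to exactly \<open>m\<close> inner segments makes the number of lists \<open>js\<close> a pure power, which already
  matches the upper bound.\<close>

definition independent_words :: "nat \<Rightarrow> word set" where
  "independent_words n = layer_word ` (base_words n \<times> {js. set js \<subseteq> J \<inter> {..n} \<and> length js = m} \<times> base_words n)"

lemma card_independent_words: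
  "card (independent_words n) = (card (base_words n))\<^sup>2 * card (J \<inter> {..n}) ^ m"
proof -
  have "card (independent_words n)
    = card (base_words n \<times> {js. set js \<subseteq> J \<inter> {..n} \<and> length js = m} \<times> base_words n)"
    unfolding independent_words_def
    by (rule card_image) (rule inj_on_subset[OF layer_word_inj[of n]], auto)
  moreover have "card {js. set js \<subseteq> J \<inter> {..n} \<and> length js = m} = card (J \<inter> {..n}) ^ m"
    by (rule card_lists_length_eq) simp
  ultimately show ?thesis by (simp only: card_cartesian_product power2_eq_square mult_ac)
qed

lemma independent_words_words:
  assumes "q \<in> independent_words n"
  shows "q \<noteq> []" "ternary q" "length q \<le> (m + 2) * n + m + 1"
proof -
  obtain p js p' where q: "p \<in> base_words n" "p' \<in> base_words n" "set js \<subseteq> {..n}" "length js = m" "q = layer_word (p, js, p')"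
    using assms unfolding independent_words_def by auto
  show "ternary q" using q layer_word_ternary by blast
  show "q \<noteq> []" using layer_word_two[of "(p, js, p')"] q(5) by force
  have "sum_list js \<le> length js * n" using q(3) by (induction js) auto
  moreover have "sum_list (map length (map ew js)) = sum_list js" by (simp only: map_length_ew)
  moreover have "length p \<le> n" "length p' \<le> n" using q base_words_binary by blast+
  ultimately show "length q \<le> (m + 2) * n + m + 1"
    using q(4) unfolding q(5) layer_word_def case_prod_conv
    by (subst length_glue) (simp_all add: algebra_simps)
qed

text \<open>A functional with inner part \<open>e\<^sub>j\<^sub>1 \<dots> e\<^sub>j\<^sub>m\<close> isolates the words with these lengths of inner segments. What
  remains is the independence of the words \<open>p \<otimes> q\<close>, which follows from that of the words in \<open>base_words\<close>.\<close>

lemma indep_independent_words: "indep layers (independent_words n)"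
  unfolding indep_def
proof (intro conjI allI impI ballI)
  let ?A = "{js. set js \<subseteq> J \<inter> {..n} \<and> length js = m}"
  have finA: "finite ?A" by (rule finite_lists_length_eq) simp
  show "finite (independent_words n)"
    unfolding independent_words_def using finA finite_base_words by (intro finite_imageI finite_cartesian_product) auto
  fix c q assume c: "\<forall>f\<in>layers. Z (\<Sum>q\<in>independent_words n. c q * f q)" and "q \<in> independent_words n"
  then obtain p0 js0 q0 where q: "p0 \<in> base_words n" "js0 \<in> ?A" "q0 \<in> base_words n" "q = layer_word (p0, js0, q0)"
    unfolding independent_words_def by auto
  define C where "C p p' = c (layer_word (p, js0, p'))" for p p'
  have main: "Z (\<Sum>p'\<in>base_words n. (\<Sum>p\<in>base_words n. C p p' * g p) * h p')" if g: "g \<in> L" and h: "h \<in> L" for g h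
  proof -
    define f where "f w = join w (g # map e js0 @ [h])" for w
    have "f \<in> layers" unfolding f_def[abs_def] using q(2) by (intro layers2 g h) auto
    have inj: "inj_on layer_word (base_words n \<times> ?A \<times> base_words n)"
      by (rule inj_on_subset[OF layer_word_inj[of n]]) auto
    define M where "M = middle js0 (map ew js0)"
    have fx: "f (layer_word (p, js, p')) = (if js = js0 then g p * M * h p' else 0)"
      if "p \<in> base_words n" "p' \<in> base_words n" for p js p'
    proof -
      have "f (layer_word (p, js, p')) = (if js0 = js then g p * middle js0 (map ew js) * h p' else 0)"
        unfolding f_def layer_word_def case_prod_conv using that base_words_free
        by (subst join_glue_layers) (auto simp: ew_free map_length_ew simp del: map_map)
      then show ?thesis by (auto simp: M_def)
    qed
    have "(\<Sum>q\<in>independent_words n. c q * f q)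
      = (\<Sum>x\<in>base_words n \<times> ?A \<times> base_words n. c (layer_word x) * f (layer_word x))"
      unfolding independent_words_def by (rule sum.reindex_cong[OF inj refl refl])
    also have "\<dots> = (\<Sum>p\<in>base_words n. \<Sum>js\<in>?A. \<Sum>p'\<in>base_words n. c (layer_word (p, js, p')) * f (layer_word (p, js, p')))"
      by (simp add: sum.cartesian_product case_prod_beta)
    also have "\<dots> = (\<Sum>p\<in>base_words n. \<Sum>js\<in>?A. if js = js0 then (\<Sum>p'\<in>base_words n. C p p' * (g p * M * h p')) else 0)"
      by (intro sum.cong refl) (auto simp: fx C_def)
    also have "\<dots> = (\<Sum>p\<in>base_words n. \<Sum>p'\<in>base_words n. C p p' * (g p * M * h p'))"
      using finA q(2) by simp
    also have "\<dots> = (\<Sum>p'\<in>base_words n. \<Sum>p\<in>base_words n. C p p' * (g p * M * h p'))" by (rule sum.swap)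
    also have "\<dots> = M * (\<Sum>p'\<in>base_words n. (\<Sum>p\<in>base_words n. C p p' * g p) * h p')"
      unfolding sum_distrib_left sum_distrib_right by (intro sum.cong refl) (simp add: mult_ac)
    finally have "Z (M * (\<Sum>p'\<in>base_words n. (\<Sum>p\<in>base_words n. C p p' * g p) * h p'))"
      using c \<open>f \<in> layers\<close> by metis
    then show ?thesis using middle_nonzero[of js0] by (simp add: Z_mult_iff M_def)
  qed
  have "Z (\<Sum>p\<in>base_words n. C p q0 * g p)" if "g \<in> L" for g
    using indepD[OF indep_base_words, of "\<lambda>p'. \<Sum>p\<in>base_words n. C p p' * g p"] main[OF that] q(3) by blast
  then have "Z (C p0 q0)" using indepD[OF indep_base_words, of "\<lambda>p. C p q0"] q(1) by blast
  then show "Z (c q)" by (simp add: C_def q(4))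
qed

end

section \<open>Prescribing the exponent of growth\<close>

text \<open>\<open>J\<close> consists of the places where \<open>\<lfloor>n\<^sup>\<theta>\<rfloor>\<close> increases. As \<open>\<theta> \<le> 1\<close>, it increases by steps of one.\<close>

lemma set_with_power_count:
  fixes \<theta> :: real
  assumes "0 \<le> \<theta>" "\<theta> \<le> 1"
  shows "\<exists>J. \<forall>n\<ge>1. real n powr \<theta> / 2 \<le> card (J \<inter> {..n}) \<and> card (J \<inter> {..n}) \<le> real n powr \<theta> \<and> J \<inter> {..n} \<noteq> {}"
proof -
  define F where "F n = nat \<lfloor>real n powr \<theta>\<rfloor>" for n :: nat
  define J where "J = {j. 1 \<le> j \<and> F j \<noteq> F (j - 1)}"
  have step: "F (Suc n) = F n \<or> F (Suc n) = Suc (F n)" for n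
  proof -
    have "real (Suc n) powr \<theta> \<le> real n powr \<theta> + 1"
    proof (cases "n = 0")
      case False
      then have n: "real n \<ge> 1" by simp
      have "real (Suc n) = real n * (1 + 1 / real n)" using n by (simp add: distrib_left)
      then have "real (Suc n) powr \<theta> = (real n * (1 + 1 / real n)) powr \<theta>" by (simp only:)
      also have "\<dots> = real n powr \<theta> * (1 + 1 / real n) powr \<theta>"
        by (rule powr_mult)
      also have "\<dots> \<le> real n powr \<theta> * (1 + 1 / real n) powr 1"
        using assms n by (intro mult_left_mono powr_mono) auto
      also have "\<dots> = real n powr \<theta> + real n powr \<theta> / real n"
        using n by (simp add: field_simps)
      also have "real n powr \<theta> / real n \<le> 1"
      proof -
        have "real n powr \<theta> \<le> real n powr 1" using assms n by (intro powr_mono) auto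
        then show ?thesis using n by (simp add: field_simps)
      qed
      finally show ?thesis by simp
    qed simp
    moreover have "real n powr \<theta> \<le> real (Suc n) powr \<theta>" using assms by (intro powr_mono2) auto
    ultimately have "\<lfloor>real n powr \<theta>\<rfloor> \<le> \<lfloor>real (Suc n) powr \<theta>\<rfloor>"
      "\<lfloor>real (Suc n) powr \<theta>\<rfloor> \<le> \<lfloor>real n powr \<theta>\<rfloor> + 1"
      by (simp_all add: floor_mono) linarith
    then show ?thesis unfolding F_def by (smt (verit) Suc_nat_eq_nat_zadd1 zero_le_floor powr_ge_zero)
  qed
  have card: "card (J \<inter> {..n}) = F n" for n
  proof (induction n)
    case 0
    have "J \<inter> {..0} = {}" by (auto simp: J_def)
    then show ?case by (simp add: F_def)
  next
    case (Suc n)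
    have "J \<inter> {..Suc n} = (if F (Suc n) = F n then J \<inter> {..n} else insert (Suc n) (J \<inter> {..n}))"
      by (auto simp: J_def le_Suc_eq)
    then show ?case using Suc step[of n] by auto
  qed
  have "real n powr \<theta> / 2 \<le> F n \<and> F n \<le> real n powr \<theta> \<and> J \<inter> {..n} \<noteq> {}" if n: "1 \<le> n" for n
  proof -
    have ge1: "1 \<le> real n powr \<theta>" using n assms(1) by (simp add: ge_one_powr_ge_zero)
    then have F: "real (F n) = of_int \<lfloor>real n powr \<theta>\<rfloor>" "1 \<le> F n" unfolding F_def by (auto simp: le_nat_iff)
    have "J \<inter> {..n} \<noteq> {}" using F(2) card[of n] by auto
    moreover have "real n powr \<theta> / 2 \<le> of_int \<lfloor>real n powr \<theta>\<rfloor>"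
    proof -
      have "1 \<le> \<lfloor>real n powr \<theta>\<rfloor>" using ge1 by simp
      then have "(1::real) \<le> of_int \<lfloor>real n powr \<theta>\<rfloor>" by (simp only: of_int_1_le_iff)
      moreover have "real n powr \<theta> < of_int \<lfloor>real n powr \<theta>\<rfloor> + 1" using floor_correct[of "real n powr \<theta>"] by simp
      ultimately show ?thesis by linarith
    qed
    ultimately show ?thesis unfolding F by simp
  qed
  then show ?thesis using card by (intro exI[of _ J]) simp
qed

context residue_field
begin

text \<open>The words of length up to \<open>n\<close> span at most \<open>C n\<^sup>\<alpha>\<close> dimensions in the quotient. The spanning words may be
  longer than \<open>n\<close>.\<close>

definition spanned_within :: "(word \<Rightarrow> 'k) set \<Rightarrow> real \<Rightarrow> bool" where
  "spanned_within L \<alpha> \<longleftrightarrow> (\<exists>C. \<forall>n\<ge>1. \<exists>S. finite S \<and> (\<forall>q\<in>S. q \<noteq> [] \<and> ternary q) \<and> card S \<le> C * real n powr \<alpha> \<and>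
    (\<forall>w. w \<noteq> [] \<and> ternary w \<and> length w \<le> n \<longrightarrow> (\<exists>c. \<forall>f\<in>L. Z (f w - (\<Sum>q\<in>S. c q * f q)))))"

definition indep_within :: "(word \<Rightarrow> 'k) set \<Rightarrow> real \<Rightarrow> bool" where
  "indep_within L \<alpha> \<longleftrightarrow> (\<exists>C. \<forall>n\<ge>1. \<forall>S. indep L S \<and> (\<forall>q\<in>S. q \<noteq> [] \<and> ternary q \<and> length q \<le> n) \<longrightarrow>
    card S \<le> C * real n powr \<alpha>)"

text \<open>Here the exponent is adjusted. The bounds \<open>H(n)\<^sup>2 |J \<inter> {..n}|\<^sup>m\<close> from above and below agree up to constants
  and rescaling of \<open>n\<close>, so the exponent of growth is \<open>\<tau> + \<theta> m\<close>, where \<open>\<tau>\<close> is the exponent of \<open>H\<^sup>2\<close>.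
  Because of \<open>\<tau> \<le> 8\<close>, every \<open>d \<ge> 8\<close> is of this form with \<open>\<theta> \<in> [0, 1]\<close> and some \<open>m\<close>.\<close>

theorem functionals_of_dimension:
  fixes d :: real
  assumes "countable D" "\<And>x. \<exists>c\<in>D. Z (x - c)" and d: "8 \<le> d"
  shows "\<exists>L. translation_closed L \<and>
    (\<forall>r. (\<forall>w\<in>Poly_Mapping.keys r. w \<noteq> [] \<and> ternary w) \<longrightarrow> (\<exists>N. r ^ N \<in> null L)) \<and>
    (\<forall>\<alpha>>d. spanned_within L \<alpha>) \<and> (\<forall>\<alpha>. indep_within L \<alpha> \<longrightarrow> d \<le> \<alpha>)"
proof -
  obtain L :: "(word \<Rightarrow> 'k) set" and C0 where
    L1: "\<forall>g\<in>L. \<forall>a. (\<lambda>w. g (a # w)) \<in> L \<and> (\<lambda>w. g (w @ [a])) \<in> L \<and> (\<forall>d. (\<lambda>w. d * g w) \<in> L)" and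
    L2: "\<forall>g\<in>L. \<exists>n. homog n g" and L3: "\<forall>n. \<exists>g\<in>L. \<exists>w\<in>bwords n. \<not> Z (g w)" and
    L4: "\<forall>m\<ge>1. spanned_on (bwords m) L (C0 * m ^ 3)" and
    L5: "\<forall>r. (\<forall>w\<in>Poly_Mapping.keys r. w \<noteq> [] \<and> set w \<subseteq> {0, 1}) \<longrightarrow> (\<exists>N. \<forall>g\<in>L. Z (pairing (r ^ N) g))"
    using nil_functionals_exist[OF assms(1,2)] by blast
  obtain e ew where e: "\<And>j. e j \<in> L" "\<And>j. ew j \<in> bwords j" "\<And>j. \<not> Z (e j (ew j))"
    using L3 by metis
  have "\<forall>i. \<exists>P\<subseteq>bwords i. indep L P \<and> (\<forall>w\<in>bwords i. \<exists>c. \<forall>g\<in>L. Z (g w - (\<Sum>p\<in>P. c p * g p)))"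
    using maximal_indep[OF finite_bwords] by blast
  then obtain P where P: "\<And>i. P i \<subseteq> bwords i" "\<And>i. indep L (P i)"
    "\<And>i w. w \<in> bwords i \<Longrightarrow> \<exists>c. \<forall>g\<in>L. Z (g w - (\<Sum>p\<in>P i. c p * g p))"
    by metis
  have lay: "layered Z L e ew P"
    using L1 L2 L5 e P by unfold_locales (auto simp: translation_closed_def null_def)
  define H where "H n = card (\<Union>i\<le>n. P i)" for n
  have finP: "finite (P i)" for i using P(1) finite_bwords finite_subset by blast
  have Pne: "P i \<noteq> {}" for i
  proof
    assume "P i = {}"
    then show False using P(3)[OF e(2)[of i]] e(1,3)[of i] by auto
  qed
  have H1: "1 \<le> H n" for n
  proof -
    have "(\<Union>i\<le>n. P i) \<noteq> {}" using Pne by auto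
    then show ?thesis using finP by (simp add: H_def Suc_leI card_gt_0_iff)
  qed
  have Hub: "H n \<le> (C0 + 1) * n ^ 4" if n: "1 \<le> n" for n
  proof -
    have "H n \<le> (\<Sum>i\<le>n. card (P i))" unfolding H_def by (rule card_UN_le) simp
    also have "\<dots> \<le> (\<Sum>i\<le>n. if i = 0 then 1 else C0 * n ^ 3)"
    proof (rule sum_mono)
      fix i assume i: "i \<in> {..n}"
      show "card (P i) \<le> (if i = 0 then 1 else C0 * n ^ 3)"
      proof (cases "i = 0")
        case True
        then show ?thesis using card_mono[OF finite_bwords P(1)[of 0]] by simp
      next
        case False
        then have "card (P i) \<le> C0 * i ^ 3"
          using L4 by (intro card_indep_le[OF _ P(2) P(1)]) simp
        also have "\<dots> \<le> C0 * n ^ 3" using i by (intro mult_le_mono2 power_mono) auto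
        finally show ?thesis using False by simp
      qed
    qed
    also have "\<dots> = 1 + n * (C0 * n ^ 3)"
    proof -
      have "(\<Sum>i\<le>n. if i = 0 then 1 else C0 * n ^ 3)
        = (if (0::nat) = 0 then 1 else C0 * n ^ 3) + (\<Sum>i\<in>{..n} - {0}. if i = 0 then 1 else C0 * n ^ 3)"
        by (rule sum.remove) auto
      also have "(\<Sum>i\<in>{..n} - {0}. if i = 0 then 1 else C0 * n ^ 3) = n * (C0 * n ^ 3)" by simp
      finally show ?thesis by simp
    qed
    also have "\<dots> \<le> n ^ 4 + C0 * n ^ 4" using n by (simp add: power_Suc numeral_eq_Suc)
    finally show ?thesis by (simp add: algebra_simps)
  qed
  define S where "S = {\<beta>. \<exists>C::real. \<forall>n\<ge>1. (real (H n))\<^sup>2 \<le> C * real n powr \<beta>}"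
  have S8: "8 \<in> S"
  proof -
    have "(real (H n))\<^sup>2 \<le> (real (C0 + 1))\<^sup>2 * real n powr 8" if n: "1 \<le> n" for n
    proof -
      have "real (H n) \<le> real ((C0 + 1) * n ^ 4)" using Hub[OF n] by (simp only: of_nat_le_iff)
      then have "(real (H n))\<^sup>2 \<le> (real ((C0 + 1) * n ^ 4))\<^sup>2" by (intro power_mono) auto
      also have "\<dots> = (real (C0 + 1))\<^sup>2 * (real n ^ 4)\<^sup>2"
        by (simp only: of_nat_mult of_nat_power power_mult_distrib)
      also have "(real n ^ 4)\<^sup>2 = real n powr 8" using n by (simp flip: power_mult)
      finally show ?thesis .
    qed
    then show ?thesis unfolding S_def by blast
  qed
  have S0: "0 \<le> \<beta>" if "\<beta> \<in> S" for \<beta>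
  proof (rule ccontr)
    assume neg: "\<not> 0 \<le> \<beta>"
    obtain C :: real where C: "\<forall>n\<ge>1. (real (H n))\<^sup>2 \<le> C * real n powr \<beta>" using \<open>\<beta> \<in> S\<close> unfolding S_def by blast
    have "1 \<le> C * real n powr \<beta>" if "1 \<le> n" for n
    proof -
      have "1 \<le> (real (H n))\<^sup>2" using H1[of n] by simp
      then show ?thesis using C that by (meson order_trans)
    qed
    moreover have "((\<lambda>n. C * real n powr \<beta>) \<longlongrightarrow> C * 0) sequentially"
      using neg by (intro tendsto_mult_left tendsto_neg_powr filterlim_real_sequentially) simp
    then have "\<forall>\<^sub>F n in sequentially. C * real n powr \<beta> < 1" by (rule order_tendstoD) simp
    then obtain N where "\<And>n. n \<ge> N \<Longrightarrow> C * real n powr \<beta> < 1" unfolding eventually_sequentially by blast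
    then have "C * real (max N 1) powr \<beta> < 1" by simp
    ultimately show False by (metis max.cobounded2 not_le)
  qed
  define \<tau> where "\<tau> = Inf S"
  have bdd: "bdd_below S" using S0 by (intro bdd_belowI[of _ 0])
  have \<tau>: "\<tau> \<le> 8" "0 \<le> \<tau>" unfolding \<tau>_def using S8 S0 bdd by (auto intro: cInf_lower cInf_greatest)
  define \<gamma> where "\<gamma> = d - \<tau>"
  have \<gamma>: "0 \<le> \<gamma>" using d \<tau> by (simp add: \<gamma>_def)
  \<comment> \<open>\<open>m\<close> is chosen at least \<open>\<gamma>\<close>, so that the exponent \<open>\<theta>\<close> of \<open>J\<close> is at most \<open>1\<close>,
    and positive, so that \<open>\<theta>\<close> is defined.\<close>
  define m where "m = nat \<lceil>\<gamma>\<rceil> + 1"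
  define \<theta> where "\<theta> = \<gamma> / m"
  have m: "\<gamma> \<le> m" "0 < m" using \<gamma> by (auto simp: m_def) linarith
  have \<theta>: "0 \<le> \<theta>" "\<theta> \<le> 1" "\<theta> * m = \<gamma>" using m \<gamma> by (auto simp: \<theta>_def)
  obtain J where J: "\<And>n. 1 \<le> n \<Longrightarrow> real n powr \<theta> / 2 \<le> card (J \<inter> {..n})"
    "\<And>n. 1 \<le> n \<Longrightarrow> card (J \<inter> {..n}) \<le> real n powr \<theta>" "\<And>n. 1 \<le> n \<Longrightarrow> J \<inter> {..n} \<noteq> {}"
    using set_with_power_count[OF \<theta>(1,2)] by blast
  interpret layered Z L e ew P J m by (rule lay)
  have low: "card (base_words n) = H n" for n by (simp add: base_words_def H_def)
  have low_ne: "base_words n \<noteq> {}" for n using Pne by (auto simp: base_words_def)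
  have powm: "(real n powr \<theta>) ^ m = real n powr \<gamma>" if "1 \<le> n" for n
    using that by (simp add: powr_powr \<theta>(3) flip: powr_realpow)
  show ?thesis
  proof (intro exI[of _ layers] conjI allI impI)
    show "translation_closed layers" by (rule layers_closed)
  next
    fix r :: "word \<Rightarrow>\<^sub>0 'k" assume "\<forall>w\<in>Poly_Mapping.keys r. w \<noteq> [] \<and> ternary w"
    then show "\<exists>N. r ^ N \<in> null layers" by (intro layers_nil) blast
  next
    fix \<alpha> assume "d < \<alpha>"
    then have "Inf S < \<alpha> - \<gamma>" by (simp add: \<gamma>_def \<tau>_def)
    then obtain \<beta> where \<beta>: "\<beta> \<in> S" "\<beta> < \<alpha> - \<gamma>" using cInf_lessD[of S "\<alpha> - \<gamma>"] S8 by blast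
    obtain C :: real where C: "\<And>n. 1 \<le> n \<Longrightarrow> (real (H n))\<^sup>2 \<le> C * real n powr \<beta>"
      using \<beta>(1) unfolding S_def by blast
    have C0: "0 \<le> C" using C[of 1] by (simp add: order_trans[OF zero_le_power2])
    show "spanned_within layers \<alpha>"
      unfolding spanned_within_def
    proof (intro exI[of _ "real (m + 2) * C"] allI impI)
      fix n :: nat assume n: "1 \<le> n"
      have "real (card (spanning_words n)) \<le> real ((m + 2) * (H n)\<^sup>2 * card (J \<inter> {..n}) ^ m)"
        using card_spanning_words[OF J(3)[OF n] low_ne] unfolding low by (simp only: of_nat_le_iff)
      also have "\<dots> = real (m + 2) * (real (H n))\<^sup>2 * real (card (J \<inter> {..n})) ^ m"
        by (simp only: of_nat_mult of_nat_power)
      also have "\<dots> \<le> real (m + 2) * (C * real n powr \<beta>) * (real n powr \<theta>) ^ m"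
        using C[OF n] J(2)[OF n] C0 by (intro mult_mono power_mono mult_left_mono) auto
      also have "\<dots> = real (m + 2) * C * real n powr (\<beta> + \<gamma>)"
        unfolding powm[OF n] using n by (simp add: powr_add)
      also have "\<dots> \<le> real (m + 2) * C * real n powr \<alpha>"
        using \<beta>(2) n C0 by (intro mult_left_mono powr_mono) auto
      finally have card: "real (card (spanning_words n)) \<le> real (m + 2) * C * real n powr \<alpha>" .
      show "\<exists>Q. finite Q \<and> (\<forall>q\<in>Q. q \<noteq> [] \<and> ternary q) \<and> card Q \<le> real (m + 2) * C * real n powr \<alpha> \<and>
        (\<forall>w. w \<noteq> [] \<and> ternary w \<and> length w \<le> n \<longrightarrow> (\<exists>c. \<forall>f\<in>layers. Z (f w - (\<Sum>q\<in>Q. c q * f q))))"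
        using card finite_spanning_words spanning_words_words words_spanned
        by (intro exI[of _ "spanning_words n"] conjI ballI allI impI) blast+
    qed
  next
    fix \<alpha> assume "indep_within layers \<alpha>"
    then obtain C where C: "\<forall>n\<ge>1. \<forall>Q. indep layers Q \<and> (\<forall>q\<in>Q. q \<noteq> [] \<and> ternary q \<and> length q \<le> n) \<longrightarrow> card Q \<le> C * real n powr \<alpha>"
      unfolding indep_within_def by (elim exE)
    define K where "K = real (2 * m + 3)"
    have "(real (H N))\<^sup>2 \<le> (2 ^ m * \<bar>C\<bar> * (K powr \<alpha> + 1)) * real N powr (\<alpha> - \<gamma>)" if N: "1 \<le> N" for N
    proof -
      \<comment> \<open>The independent words built from words of length \<open>N\<close> have at most this length.\<close>
      define n where "n = (m + 2) * N + m + 1"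
      have nN: "N \<le> n" "real n \<le> K * real N" "1 \<le> n"
      proof -
        have "(m + 1) * 1 \<le> (m + 1) * N" using N by (rule mult_le_mono2)
        then have "n \<le> (2 * m + 3) * N" using N by (simp add: n_def algebra_simps)
        then have "real n \<le> real ((2 * m + 3) * N)" by (simp only: of_nat_le_iff)
        then show "real n \<le> K * real N" by (simp only: K_def of_nat_mult)
      qed (auto simp: n_def)
      have pw: "real n powr \<alpha> \<le> (K powr \<alpha> + 1) * real N powr \<alpha>"
      proof (cases "0 \<le> \<alpha>")
        case True
        have "real n powr \<alpha> \<le> (K * real N) powr \<alpha>" using True nN by (intro powr_mono2) auto
        also have "\<dots> = K powr \<alpha> * real N powr \<alpha>" by (simp add: powr_mult K_def)
        also have "\<dots> \<le> (K powr \<alpha> + 1) * real N powr \<alpha>" by (intro mult_right_mono) auto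
        finally show ?thesis .
      next
        case False
        have "real n powr \<alpha> \<le> real N powr \<alpha>" using False nN N by (intro powr_mono2') auto
        also have "\<dots> \<le> (K powr \<alpha> + 1) * real N powr \<alpha>" using powr_ge_zero[of K \<alpha>]
          by (simp add: algebra_simps)
        finally show ?thesis .
      qed
      have "real (card (independent_words N)) \<le> C * real n powr \<alpha>"
        using C[rule_format, of n "independent_words N"] indep_independent_words independent_words_words nN(3)
        unfolding n_def by blast
      also have "\<dots> \<le> \<bar>C\<bar> * ((K powr \<alpha> + 1) * real N powr \<alpha>)"
        using pw by (intro mult_mono) auto
      finally have "(real (H N))\<^sup>2 * real (card (J \<inter> {..N})) ^ m \<le> \<bar>C\<bar> * ((K powr \<alpha> + 1) * real N powr \<alpha>)"
        unfolding card_independent_words low by simp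
      moreover have "(real (H N))\<^sup>2 * (real N powr \<theta> / 2) ^ m \<le> (real (H N))\<^sup>2 * real (card (J \<inter> {..N})) ^ m"
        using J(1)[OF N] by (intro mult_left_mono power_mono) auto
      ultimately have "(real (H N))\<^sup>2 * (real N powr \<gamma> / 2 ^ m) \<le> \<bar>C\<bar> * ((K powr \<alpha> + 1) * real N powr \<alpha>)"
        unfolding power_divide powm[OF N] by linarith
      then have "(real (H N))\<^sup>2 \<le> 2 ^ m * \<bar>C\<bar> * (K powr \<alpha> + 1) * real N powr \<alpha> / real N powr \<gamma>"
        using N by (simp add: field_simps)
      then show ?thesis using N by (simp add: powr_diff)
    qed
    then have "\<alpha> - \<gamma> \<in> S" unfolding S_def by blast
    then have "\<tau> \<le> \<alpha> - \<gamma>" unfolding \<tau>_def using bdd by (rule cInf_lower)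
    then show "d \<le> \<alpha>" by (simp add: \<gamma>_def)
  qed
qed

end

section \<open>A criterion for the Gelfand-Kirillov dimension\<close>

text \<open>By the exchange lemma, independent subsets of \<open>W\<close> have at most \<open>card B\<close> elements; a maximal one is
  a basis of \<open>W\<close>.\<close>

lemma (in vectorspace) dim_subspace_le:
  assumes W: "VectorSpace.subspace K W V" and B: "finite B" "B \<subseteq> carrier V" "W \<subseteq> span B"
  shows "vectorspace.fin_dim K (vs W)" "vectorspace.dim K (vs W) \<le> card B"
proof -
  have sub: "LinearCombinations.submodule K W V" using W by (simp add: VectorSpace.subspace_def)
  interpret W: vectorspace K "vs W" using W by (rule subspace_is_vs)
  have bound: "card A \<le> card B" if A: "finite A" "A \<subseteq> W" "W.lin_indpt A" for A
  proof -
    have li: "lin_indpt A" using span_li_not_depend(2)[OF A(2) sub] A(3) by simp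
    have "A \<subseteq> span B" using A(2) B(3) by blast
    from replacement[OF A(1) B(1,2) li this]
    obtain C where "C \<subseteq> carrier V" "int (card C) \<le> int (card B) - int (card A)" by blast
    then show ?thesis by linarith
  qed
  have "finite A \<and> card A \<le> card B" if A: "A \<subseteq> carrier (vs W) \<and> W.lin_indpt A" for A
  proof -
    have "finite A"
    proof (rule ccontr)
      assume "infinite A"
      then obtain A' where A': "A' \<subseteq> A" "finite A'" "card A' = Suc (card B)"
        using infinite_arbitrarily_large by blast
      then have "W.lin_indpt A'" using W.subset_li_is_li[of A A'] A by blast
      then show False using bound[of A'] A' A by auto
    qed
    then show ?thesis using bound[of A] A by simp
  qed
  moreover have "{} \<subseteq> carrier (vs W) \<and> W.lin_indpt {}" by (simp add: W.lin_dep_def)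
  ultimately obtain A where A: "finite A" "maximal A (\<lambda>S. S \<subseteq> carrier (vs W) \<and> W.lin_indpt S)"
    using maximal_exists[of "\<lambda>S. S \<subseteq> carrier (vs W) \<and> W.lin_indpt S" "card B" "{}"] by blast
  have gen: "W.gen_set A" by (rule W.max_li_is_gen[OF A(2)])
  have Ac: "A \<subseteq> carrier (vs W)" "W.lin_indpt A" using A(2) by (auto simp: maximal_def)
  show "W.fin_dim" unfolding W.fin_dim_def using A(1) Ac(1) gen by blast
  have "W.dim = card A" by (rule W.dim_basis[OF A(1)]) (use gen Ac in \<open>simp add: W.basis_def\<close>)
  then show "W.dim \<le> card B" using bound[OF A(1)] Ac by simp
qed

lemma (in vectorspace) card_le_dim_subspace:
  assumes W: "VectorSpace.subspace K W V" and fd: "vectorspace.fin_dim K (vs W)"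
    and A: "A \<subseteq> W" "lin_indpt A"
  shows "card A \<le> vectorspace.dim K (vs W)"
proof -
  have sub: "LinearCombinations.submodule K W V" using W by (simp add: VectorSpace.subspace_def)
  interpret W: vectorspace K "vs W" using W by (rule subspace_is_vs)
  have "W.lin_indpt A" using span_li_not_depend(2)[OF A(1) sub] A(2) by simp
  then show ?thesis using W.li_le_dim(2)[OF fd] A(1) by simp
qed

context nonunital_algebra
begin

lemma submodule_span: "S \<subseteq> carrier A \<Longrightarrow> LinearCombinations.submodule K (span S) A"
  by (rule span_is_submodule)

lemma span_sub_submodule: "\<lbrakk>S \<subseteq> N; LinearCombinations.submodule K N A\<rbrakk> \<Longrightarrow> span S \<subseteq> N"
  by (rule span_is_subset)

lemma product_closed: "\<lbrakk>v \<in> carrier A; set xs \<subseteq> carrier A\<rbrakk> \<Longrightarrow> product v xs \<in> carrier A"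
  unfolding product_def by (induction xs arbitrary: v) (auto simp: mult_closed)

lemma product_snoc: "product v (xs @ [x]) = product v xs \<otimes>\<^bsub>A\<^esub> x"
  by (simp add: product_def)

lemma mult_product:
  assumes "v \<in> carrier A" "w \<in> carrier A" "set ys \<subseteq> carrier A"
  shows "v \<otimes>\<^bsub>A\<^esub> product w ys = product v (w # ys)"
  using assms(3)
proof (induction ys rule: rev_induct)
  case Nil
  then show ?case by (simp add: product_def)
next
  case (snoc y ys)
  have "v \<otimes>\<^bsub>A\<^esub> product w (ys @ [y]) = (v \<otimes>\<^bsub>A\<^esub> product w ys) \<otimes>\<^bsub>A\<^esub> y"
    using snoc.prems assms(1,2) by (simp add: product_snoc mult_assoc product_closed)
  then show ?case using snoc by (metis append_Cons le_sup_iff product_snoc set_append)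
qed

lemma product_append:
  "product v (xs @ w # ys) = product (product v xs) (w # ys)"
  by (simp add: product_def)

abbreviation words_in :: "'c set \<Rightarrow> nat \<Rightarrow> 'c set" where
  "words_in V n \<equiv> {product v xs | v xs. v \<in> V \<and> set xs \<subseteq> V \<and> Suc (length xs) \<le> n}"

lemma words_in_carrier: "V \<subseteq> carrier A \<Longrightarrow> words_in V n \<subseteq> carrier A"
  using product_closed by blast

lemma power_space_submodule: "V \<subseteq> carrier A \<Longrightarrow> LinearCombinations.submodule K (power_space V n) A"
  unfolding power_space_def by (rule submodule_span) (rule words_in_carrier)

lemma subspaceI: "LinearCombinations.submodule K N A \<Longrightarrow> VectorSpace.subspace K N A"
  by (simp add: VectorSpace.subspace_def vectorspace_axioms)

lemma words_in_power_space: "V \<subseteq> carrier A \<Longrightarrow> words_in V n \<subseteq> power_space V n"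
  unfolding power_space_def by (rule in_own_span) (rule words_in_carrier)

lemma power_space_mono: "n \<le> k \<Longrightarrow> power_space V n \<subseteq> power_space V k"
  unfolding power_space_def by (rule span_is_monotone) (blast intro: le_trans)

lemma left_mult_submodule:
  assumes N: "LinearCombinations.submodule K N A" and y: "y \<in> carrier A"
  shows "LinearCombinations.submodule K {x \<in> carrier A. x \<otimes>\<^bsub>A\<^esub> y \<in> N} A"
proof -
  have z: "\<zero>\<^bsub>A\<^esub> \<otimes>\<^bsub>A\<^esub> y = \<zero>\<^bsub>A\<^esub>"
    using mult_l_distr[of "\<zero>\<^bsub>A\<^esub>" "\<zero>\<^bsub>A\<^esub>" y] y mult_closed[of "\<zero>\<^bsub>A\<^esub>" y] by (simp add: M.add.l_cancel_one)
  show ?thesis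
    using N y z unfolding LinearCombinations.submodule_def
    by (auto simp: mult_l_distr smult_mult_left)
qed

lemma right_mult_submodule:
  assumes N: "LinearCombinations.submodule K N A" and S: "S \<subseteq> carrier A"
  shows "LinearCombinations.submodule K {y \<in> carrier A. \<forall>x\<in>S. x \<otimes>\<^bsub>A\<^esub> y \<in> N} A"
proof -
  have z: "x \<otimes>\<^bsub>A\<^esub> \<zero>\<^bsub>A\<^esub> = \<zero>\<^bsub>A\<^esub>" if "x \<in> carrier A" for x
    using mult_r_distr[of "\<zero>\<^bsub>A\<^esub>" "\<zero>\<^bsub>A\<^esub>" x] that mult_closed[of x "\<zero>\<^bsub>A\<^esub>"] by (simp add: M.add.l_cancel_one)
  show ?thesis
    using N S z unfolding LinearCombinations.submodule_def
    by (auto simp: mult_r_distr smult_mult_right subset_iff)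
qed

text \<open>By bilinearity, it suffices to multiply generators.\<close>

lemma span_mult_closed:
  assumes S: "S \<subseteq> carrier A" and T: "T \<subseteq> carrier A" and N: "LinearCombinations.submodule K N A"
    and "\<And>x y. \<lbrakk>x \<in> S; y \<in> T\<rbrakk> \<Longrightarrow> x \<otimes>\<^bsub>A\<^esub> y \<in> N"
    and x: "x \<in> span S" and y: "y \<in> span T"
  shows "x \<otimes>\<^bsub>A\<^esub> y \<in> N"
proof -
  have 1: "y \<in> {y \<in> carrier A. \<forall>x\<in>S. x \<otimes>\<^bsub>A\<^esub> y \<in> N}"
    using span_sub_submodule[OF _ right_mult_submodule[OF N S], of T] y T assms(4) by blast
  then have "y \<in> carrier A" by blast
  from span_sub_submodule[OF _ left_mult_submodule[OF N this], of S] x S 1 show ?thesis by blast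
qed

lemma power_space_mult:
  assumes "V \<subseteq> carrier A" "x \<in> power_space V a" "y \<in> power_space V b"
  shows "x \<otimes>\<^bsub>A\<^esub> y \<in> power_space V (a + b)"
proof (rule span_mult_closed[where S = "words_in V a" and T = "words_in V b"])
  fix x y assume "x \<in> words_in V a" "y \<in> words_in V b"
  then obtain v xs w ys where *: "x = product v xs" "v \<in> V" "set xs \<subseteq> V" "Suc (length xs) \<le> a"
    "y = product w ys" "w \<in> V" "set ys \<subseteq> V" "Suc (length ys) \<le> b" by blast
  have "x \<otimes>\<^bsub>A\<^esub> y = product v (xs @ w # ys)"
    unfolding * product_append using * assms(1)
    by (intro mult_product product_closed) auto
  moreover have "product v (xs @ w # ys) \<in> words_in V (a + b)"
  proof -
    have "v \<in> V" "set (xs @ w # ys) \<subseteq> V" "Suc (length (xs @ w # ys)) \<le> a + b" using * by auto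
    then show ?thesis by blast
  qed
  ultimately show "x \<otimes>\<^bsub>A\<^esub> y \<in> power_space V (a + b)"
    using words_in_power_space[OF assms(1), of "a + b"] by auto
qed (use assms words_in_carrier power_space_submodule in \<open>auto simp: power_space_def\<close>)

lemma power_space_exhausts:
  assumes "generated_by V"
  shows "carrier A = (\<Union>n. power_space V n)"
proof -
  have V: "V \<subseteq> carrier A" using assms by (simp add: generated_by_def)
  have sub: "LinearCombinations.submodule K (\<Union>n. power_space V n) A"
  proof (rule nested_union_vs[where I = UNIV and N = "power_space V"])
    show "\<exists>k. k \<in> UNIV \<and> power_space V i \<subseteq> power_space V k \<and> power_space V j \<subseteq> power_space V k" for i j
      by (intro exI[of _ "max i j"]) (simp add: power_space_mono)
  qed (use power_space_submodule[OF V] in auto)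
  have "is_subalgebra (\<Union>n. power_space V n)"
    unfolding is_subalgebra_def
    using subspaceI[OF sub] power_space_mult[OF V] by blast
  moreover have "V \<subseteq> (\<Union>n. power_space V n)"
  proof
    fix v assume "v \<in> V"
    then have "product v [] \<in> words_in V 1" by fastforce
    then show "v \<in> (\<Union>n. power_space V n)"
      using words_in_power_space[OF V, of 1] by (auto simp: product_def)
  qed
  ultimately show ?thesis using assms unfolding generated_by_def by blast
qed

lemma finite_in_power_space:
  assumes "generated_by V" "finite S" "S \<subseteq> carrier A"
  shows "\<exists>c\<ge>1. S \<subseteq> power_space V c"
  using assms(2,3)
proof (induction S rule: finite_induct)
  case (insert x S)
  then obtain c where c: "c \<ge> 1" "S \<subseteq> power_space V c" by auto
  obtain n where "x \<in> power_space V n" using insert.prems power_space_exhausts[OF assms(1)] by blast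
  then show ?case using c power_space_mono[of c "max c n" V] power_space_mono[of n "max c n" V]
    by (intro exI[of _ "max c n"]) auto
qed auto

text \<open>This comparison of the powers of two generating spaces is the reason why the dimension does not
  depend on the choice of the generating space.\<close>

lemma power_space_nested:
  assumes V: "V \<subseteq> carrier A" and X: "X \<subseteq> carrier A" and sub: "V \<subseteq> power_space X c"
  shows "power_space V n \<subseteq> power_space X (c * n)"
proof -
  have "product v xs \<in> power_space X (c * Suc (length xs))" if "v \<in> V" "set xs \<subseteq> V" for v xs
    using that(2)
  proof (induction xs rule: rev_induct)
    case Nil
    then show ?case using sub that(1) by (auto simp: product_def)
  next
    case (snoc x xs)
    then have "product v xs \<otimes>\<^bsub>A\<^esub> x \<in> power_space X (c * Suc (length xs) + c)"
      using sub by (intro power_space_mult[OF X]) auto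
    then show ?case by (simp add: product_snoc algebra_simps)
  qed
  moreover have "power_space X (c * Suc k) \<subseteq> power_space X (c * n)" if "Suc k \<le> n" for k
    using that by (intro power_space_mono mult_le_mono2)
  ultimately have "words_in V n \<subseteq> power_space X (c * n)" by blast
  then show ?thesis unfolding power_space_def[of V]
    by (rule span_sub_submodule) (rule power_space_submodule[OF X])
qed

lemma fin_dim_in_power_space:
  assumes "fin_dim_generating_space V" "generated_by X"
  shows "\<exists>c\<ge>1. V \<subseteq> power_space X c"
proof -
  have VS: "VectorSpace.subspace K V A" and fd: "vectorspace.fin_dim K (vs V)"
    using assms(1) by (auto simp: fin_dim_generating_space_def)
  have sub: "LinearCombinations.submodule K V A" using VS by (simp add: VectorSpace.subspace_def)
  interpret V: vectorspace K "vs V" using VS by (rule subspace_is_vs)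
  obtain B where B: "finite B" "B \<subseteq> V" "V.span B = V" using fd unfolding V.fin_dim_def by auto
  have VB: "span B = V" using span_li_not_depend(1)[OF B(2) sub] B(3) by simp
  have "B \<subseteq> carrier A" using B(2) sub by (auto simp: LinearCombinations.submodule_def)
  then obtain c where c: "c \<ge> 1" "B \<subseteq> power_space X c"
    using finite_in_power_space[OF assms(2) B(1)] by blast
  have "X \<subseteq> carrier A" using assms(2) by (simp add: generated_by_def)
  then have "V \<subseteq> power_space X c"
    using span_sub_submodule[OF c(2) power_space_submodule] VB by simp
  then show ?thesis using c(1) by blast
qed

lemma fin_dim_generating_space_span:
  assumes "finite X" "generated_by X"
  shows "fin_dim_generating_space (span X)"
proof -
  have X: "X \<subseteq> carrier A" using assms(2) by (simp add: generated_by_def)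
  have sub: "VectorSpace.subspace K (span X) A" using X by (rule span_is_subspace)
  have "generated_by (span X)"
    using assms(2) in_own_span[OF X] span_is_subset2[OF X] unfolding generated_by_def by blast
  then show ?thesis unfolding fin_dim_generating_space_def
    using sub dim_subspace_le(1)[OF sub assms(1) X] by simp
qed

text \<open>The dimension can be computed from a finite generating set: from above by spanning sets and
  from below by independent sets, each for the powers of that set.\<close>

theorem GKdim_eqI:
  fixes d :: real
  assumes X: "finite X" "generated_by X" and d: "0 \<le> d"
    and upper: "\<And>\<alpha>. d < \<alpha> \<Longrightarrow> \<exists>C. \<forall>n\<ge>1. \<exists>B. finite B \<and> B \<subseteq> carrier A \<and> card B \<le> C * real n powr \<alpha> \<and>
      power_space X n \<subseteq> span B"
    and lower: "\<And>\<alpha> C. (\<And>n B. \<lbrakk>1 \<le> n; finite B; B \<subseteq> power_space X n; lin_indpt B\<rbrakk> \<Longrightarrow> card B \<le> C * real n powr \<alpha>)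
      \<Longrightarrow> d \<le> \<alpha>"
  shows "GKdim = ereal d"
proof -
  define V where "V = (SOME V. fin_dim_generating_space V)"
  have V: "fin_dim_generating_space V"
    unfolding V_def by (rule someI[where P = fin_dim_generating_space]) (rule fin_dim_generating_space_span[OF X])
  have Xc: "X \<subseteq> carrier A" using X(2) by (simp add: generated_by_def)
  have Vg: "generated_by V" using V by (simp add: fin_dim_generating_space_def)
  then have Vc: "V \<subseteq> carrier A" by (simp add: generated_by_def)
  obtain c where c: "c \<ge> 1" "V \<subseteq> power_space X c" using fin_dim_in_power_space[OF V X(2)] by blast
  obtain c' where c': "c' \<ge> 1" "X \<subseteq> power_space V c'" using finite_in_power_space[OF Vg X(1) Xc] by blast
  have VX: "power_space V n \<subseteq> power_space X (c * n)" for n by (rule power_space_nested[OF Vc Xc c(2)])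
  have XV: "power_space X n \<subseteq> power_space V (c' * n)" for n by (rule power_space_nested[OF Xc Vc c'(2)])
  have subV: "VectorSpace.subspace K (power_space V n) A" for n
    by (rule subspaceI) (rule power_space_submodule[OF Vc])
  have fd: "vectorspace.fin_dim K (vs (power_space V n))" for n
  proof -
    obtain C where C: "\<forall>n\<ge>1. \<exists>B. finite B \<and> B \<subseteq> carrier A \<and> card B \<le> C * real n powr (d + 1) \<and>
      power_space X n \<subseteq> span B" using upper[of "d + 1"] by auto
    have "1 \<le> c * (n + 1)" using c(1) by simp
    then obtain B where B: "finite B" "B \<subseteq> carrier A" "power_space X (c * (n + 1)) \<subseteq> span B"
      using C by blast
    have "power_space V n \<subseteq> span B" using VX[of "n + 1"] B(3) power_space_mono[of n "n + 1" V] by auto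
    then show ?thesis by (rule dim_subspace_le(1)[OF subV B(1,2)])
  qed
  define S where "S = {ereal \<alpha> | \<alpha>. \<alpha> > 0 \<and> growth_le (\<lambda>n. real (growth V n)) (\<lambda>n. real n powr \<alpha>)}"
  have mem: "ereal \<alpha> \<in> S" if \<alpha>: "d < \<alpha>" for \<alpha>
  proof -
    obtain C where C: "\<And>n. 1 \<le> n \<Longrightarrow> \<exists>B. finite B \<and> B \<subseteq> carrier A \<and> card B \<le> C * real n powr \<alpha> \<and>
      power_space X n \<subseteq> span B" using upper[OF \<alpha>] by blast
    define k where "k = max c (nat \<lceil>C\<rceil>)"
    have k: "C \<le> real k" "c \<le> k" unfolding k_def by linarith+
    have "real (growth V n) \<le> real k * real (k * n) powr \<alpha>" for n
    proof (cases "n = 0")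
      case True
      have "power_space V 0 \<subseteq> span {}" by (simp add: power_space_def)
      from dim_subspace_le(2)[OF subV _ _ this] have "growth V 0 = 0" by (simp add: growth_def)
      then show ?thesis using True by simp
    next
      case False
      then have "1 \<le> c * n" using c(1) by (metis One_nat_def Suc_leI mult_is_0 neq0_conv not_one_le_zero)
      then obtain B where B: "finite B" "B \<subseteq> carrier A" "card B \<le> C * real (c * n) powr \<alpha>"
        "power_space X (c * n) \<subseteq> span B" using C by blast
      have "growth V n \<le> card B"
        unfolding growth_def using VX[of n] B(4) by (intro dim_subspace_le(2)[OF subV B(1,2)]) auto
      then have "real (growth V n) \<le> C * real (c * n) powr \<alpha>" using B(3) by linarith
      also have "\<dots> \<le> real k * real (c * n) powr \<alpha>" using k(1) by (intro mult_right_mono) auto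
      also have "\<dots> \<le> real k * real (k * n) powr \<alpha>"
        using k(2) \<alpha> d by (intro mult_left_mono powr_mono2) (auto intro!: mult_right_mono)
      finally show ?thesis .
    qed
    then show ?thesis unfolding S_def growth_le_def using \<alpha> d by auto
  qed
  have ge: "ereal d \<le> x" if xS: "x \<in> S" for x
  proof -
    obtain \<alpha> k where \<alpha>: "x = ereal \<alpha>" "\<And>n. real (growth V n) \<le> real k * real (k * n) powr \<alpha>"
    proof -
      obtain \<alpha> where \<alpha>: "x = ereal \<alpha>" "growth_le (\<lambda>n. real (growth V n)) (\<lambda>n. real n powr \<alpha>)"
        using xS unfolding S_def by blast
      obtain k :: nat where "\<forall>n. real (growth V n) \<le> real k * real (k * n) powr \<alpha>"
        using \<alpha>(2) unfolding growth_le_def by blast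
      then show thesis using \<alpha>(1) that by blast
    qed
    have "card B \<le> (real k * real (k * c') powr \<alpha>) * real n powr \<alpha>"
      if B: "1 \<le> n" "finite B" "B \<subseteq> power_space X n" "lin_indpt B" for n B
    proof -
      have "card B \<le> growth V (c' * n)"
        unfolding growth_def using XV[of n] B by (intro card_le_dim_subspace subV fd) auto
      then have "real (card B) \<le> real k * real (k * (c' * n)) powr \<alpha>" using \<alpha>(2)[of "c' * n"] by linarith
      also have "real (k * (c' * n)) powr \<alpha> = real (k * c') powr \<alpha> * real n powr \<alpha>"
        by (simp add: powr_mult mult.assoc)
      finally show ?thesis by (simp add: mult.assoc)
    qed
    from lower[OF this] show ?thesis using \<alpha>(1) by simp
  qed
  have "Inf S \<le> ereal d"
  proof (rule ereal_le_epsilon2)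
    fix e :: real assume "0 < e"
    then have "Inf S \<le> ereal (d + e)" by (intro Inf_lower mem) simp
    then show "Inf S \<le> ereal d + ereal e" by simp
  qed
  moreover have "ereal d \<le> Inf S" by (rule Inf_greatest) (rule ge)
  ultimately show ?thesis unfolding GKdim_def GKdim_wrt_def V_def[symmetric] S_def[symmetric] by (rule antisym)
qed

end

section \<open>The quotient algebra\<close>

text \<open>A field presented as a quotient of a ring type; the kernel of \<open>ev\<close> is the maximal ideal of the
  preceding sections.\<close>

locale presentation = field F for F :: "('f, 'm) ring_scheme" (structure) +
  fixes ev :: "'k::comm_ring_1 \<Rightarrow> 'f"
  assumes ev_closed: "ev x \<in> carrier F"
    and ev_add: "ev (x + y) = ev x \<oplus> ev y"
    and ev_mult: "ev (x * y) = ev x \<otimes> ev y"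
    and ev_one: "ev 1 = \<one>"
    and ev_surj: "c \<in> carrier F \<Longrightarrow> \<exists>x. ev x = c"
begin

lemma ev_zero: "ev 0 = \<zero>"
  using ev_add[of 0 0] ev_closed[of 0] by (simp add: add.l_cancel_one)

lemma ev_diff_zero_iff: "ev (x - y) = \<zero> \<longleftrightarrow> ev x = ev y"
  using ev_add[of "x - y" y] ev_closed[of "x - y"] ev_closed[of y] ev_closed[of x]
  by (simp add: add.r_cancel_one)

end

sublocale presentation \<subseteq> residue_field "\<lambda>x. ev x = \<zero>\<^bsub>F\<^esub>"
proof
  show "\<exists>y. ev (x * y - 1) = \<zero>" if nz: "ev x \<noteq> \<zero>" for x
  proof -
    have "ev x \<in> Units F" using nz ev_closed by (simp add: field_Units)
    then obtain c where c: "c \<in> carrier F" "ev x \<otimes> c = \<one>" using Units_r_inv_ex by blast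
    obtain y where "ev y = c" using ev_surj[OF c(1)] by blast
    then show ?thesis using c by (intro exI[of _ y]) (simp add: ev_diff_zero_iff ev_mult ev_one)
  qed
qed (simp_all add: ev_zero ev_add ev_mult ev_one ev_closed)

text \<open>Without the empty word, since the algebra has no identity. A constant term could not be nilpotent.\<close>

definition free_algebra :: "(word \<Rightarrow>\<^sub>0 'k::comm_ring_1) set" where
  "free_algebra = {r. \<forall>w\<in>Poly_Mapping.keys r. w \<noteq> [] \<and> ternary w}"

lemma free_zero: "0 \<in> free_algebra" by (simp add: free_algebra_def)

lemma free_add: "\<lbrakk>r \<in> free_algebra; s \<in> free_algebra\<rbrakk> \<Longrightarrow> r + s \<in> free_algebra"
  using Poly_Mapping.keys_add[of r s] by (auto simp: free_algebra_def)

lemma free_mult: "\<lbrakk>r \<in> free_algebra; s \<in> free_algebra\<rbrakk> \<Longrightarrow> r * s \<in> free_algebra"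
  unfolding free_algebra_def
proof (intro CollectI ballI)
  fix w assume r: "r \<in> {r. \<forall>w\<in>Poly_Mapping.keys r. w \<noteq> [] \<and> ternary w}"
    and s: "s \<in> {r. \<forall>w\<in>Poly_Mapping.keys r. w \<noteq> [] \<and> ternary w}" and "w \<in> Poly_Mapping.keys (r * s)"
  then obtain u v where "w = u @ v" "u \<in> Poly_Mapping.keys r" "v \<in> Poly_Mapping.keys s"
    using keys_mult_words[of r s] by auto
  then show "w \<noteq> [] \<and> ternary w" using r s by (auto simp: ternary_def)
qed

lemma free_scalar: "r \<in> free_algebra \<Longrightarrow> scalar c * r \<in> free_algebra"
  unfolding free_algebra_def by (auto simp: in_keys_iff lookup_scalar_mult)

lemma free_single: "\<lbrakk>w \<noteq> []; ternary w\<rbrakk> \<Longrightarrow> Poly_Mapping.single w c \<in> free_algebra"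
  by (auto simp: free_algebra_def in_keys_iff lookup_single when_def split: if_splits)

lemma free_sum: "(\<And>i. i \<in> I \<Longrightarrow> r i \<in> free_algebra) \<Longrightarrow> sum r I \<in> free_algebra"
  by (induction I rule: infinite_finite_induct) (auto simp: free_zero free_add)

lemma free_uminus: "r \<in> free_algebra \<Longrightarrow> - r \<in> free_algebra"
  by (simp add: free_algebra_def)

text \<open>The carrier of the quotient is to be a set of natural numbers. So the classes are represented
  by numbers rather than by sets, with \<open>code r\<close> as the number of the class of \<open>r\<close>.\<close>

locale quotient_algebra = presentation F ev for F :: "('f, 'm) ring_scheme" (structure)
    and ev :: "'k::comm_ring_1 \<Rightarrow> 'f" +
  fixes L :: "(word \<Rightarrow> 'k) set" and code :: "(word \<Rightarrow>\<^sub>0 'k) \<Rightarrow> nat"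
  assumes closed: "translation_closed L"
    and code_eq: "\<lbrakk>r \<in> free_algebra; s \<in> free_algebra\<rbrakk> \<Longrightarrow> code r = code s \<longleftrightarrow> r - s \<in> null L"
begin

definition rep :: "nat \<Rightarrow> (word \<Rightarrow>\<^sub>0 'k)" where "rep = inv_into free_algebra code"

definition lift :: "'f \<Rightarrow> 'k" where "lift c = (SOME x. ev x = c)"

text \<open>Operations are carried out on arbitrary representatives.\<close>

definition Q :: "('f, nat) module" where
  "Q = \<lparr>carrier = code ` free_algebra, monoid.mult = (\<lambda>x y. code (rep x * rep y)), one = code 0,
    zero = code 0, add = (\<lambda>x y. code (rep x + rep y)), smult = (\<lambda>c x. code (scalar (lift c) * rep x))\<rparr>"

lemma ev_lift: "c \<in> carrier F \<Longrightarrow> ev (lift c) = c"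
  unfolding lift_def by (rule someI_ex) (rule ev_surj)

lemma carrier_Q: "carrier Q = code ` free_algebra" by (simp add: Q_def)

lemma zero_Q: "\<zero>\<^bsub>Q\<^esub> = code 0" by (simp add: Q_def)

lemma code_in [simp]: "r \<in> free_algebra \<Longrightarrow> code r \<in> carrier Q" by (simp add: Q_def)

lemma rep_code:
  assumes "r \<in> free_algebra"
  shows "rep (code r) \<in> free_algebra" "rep (code r) - r \<in> null L"
proof -
  have "code r \<in> code ` free_algebra" using assms by blast
  then have "rep (code r) \<in> free_algebra" "code (rep (code r)) = code r"
    unfolding rep_def by (rule inv_into_into, rule f_inv_into_f)
  then show "rep (code r) \<in> free_algebra" "rep (code r) - r \<in> null L"
    using code_eq[of "rep (code r)" r] assms by auto
qed

lemma scalar_null: "ev x = \<zero> \<Longrightarrow> scalar x * r \<in> null L"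
  unfolding null_def by (auto simp: pairing_scalar Z_mult')

lemma add_Q:
  assumes "r \<in> free_algebra" "s \<in> free_algebra"
  shows "code r \<oplus>\<^bsub>Q\<^esub> code s = code (r + s)"
proof -
  have "rep (code r) + rep (code s) - (r + s) = (rep (code r) - r) + (rep (code s) - s)" by simp
  also have "\<dots> \<in> null L" by (intro null_add rep_code assms)
  finally show ?thesis unfolding Q_def using assms by (simp add: code_eq free_add rep_code)
qed

lemma mult_Q:
  assumes "r \<in> free_algebra" "s \<in> free_algebra"
  shows "code r \<otimes>\<^bsub>Q\<^esub> code s = code (r * s)"
proof -
  have "rep (code r) * rep (code s) - r * s
    = (rep (code r) - r) * rep (code s) + r * (rep (code s) - s)" by (simp add: algebra_simps)
  also have "\<dots> \<in> null L"
    by (intro null_add null_mult_left null_mult_right closed rep_code assms)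
  finally show ?thesis unfolding Q_def using assms by (simp add: code_eq free_mult rep_code)
qed

lemma smult_Q:
  assumes "r \<in> free_algebra" "ev x = c"
  shows "c \<odot>\<^bsub>Q\<^esub> code r = code (scalar x * r)"
proof -
  have c: "c \<in> carrier F" using assms(2) ev_closed by blast
  have "scalar (lift c) * rep (code r) - scalar x * r
    = scalar (lift c) * (rep (code r) - r) + scalar (lift c - x) * r"
    by (simp add: algebra_simps single_diff)
  also have "\<dots> \<in> null L"
    using assms c by (intro null_add null_scalar scalar_null rep_code) (simp_all add: ev_diff_zero_iff ev_lift)
  finally show ?thesis unfolding Q_def using assms by (simp add: code_eq free_scalar rep_code)
qed

lemma Q_cases: "x \<in> carrier Q \<Longrightarrow> (\<And>r. \<lbrakk>r \<in> free_algebra; x = code r\<rbrakk> \<Longrightarrow> thesis) \<Longrightarrow> thesis"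
  by (auto simp: carrier_Q)

lemma code_zero_iff: "r \<in> free_algebra \<Longrightarrow> code r = \<zero>\<^bsub>Q\<^esub> \<longleftrightarrow> r \<in> null L"
  by (simp add: zero_Q code_eq free_zero)

lemma Q_abelian_group: "abelian_group Q"
proof (rule abelian_groupI)
  fix x y z assume "x \<in> carrier Q" "y \<in> carrier Q" "z \<in> carrier Q"
  then obtain r s t where *: "r \<in> free_algebra" "s \<in> free_algebra" "t \<in> free_algebra"
    "x = code r" "y = code s" "z = code t" by (meson Q_cases)
  then show "x \<oplus>\<^bsub>Q\<^esub> y \<oplus>\<^bsub>Q\<^esub> z = x \<oplus>\<^bsub>Q\<^esub> (y \<oplus>\<^bsub>Q\<^esub> z)" by (simp add: add_Q free_add add.assoc)
next
  fix x y assume "x \<in> carrier Q" "y \<in> carrier Q"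
  then obtain r s where *: "r \<in> free_algebra" "s \<in> free_algebra" "x = code r" "y = code s"
    by (meson Q_cases)
  then show "x \<oplus>\<^bsub>Q\<^esub> y \<in> carrier Q" "x \<oplus>\<^bsub>Q\<^esub> y = y \<oplus>\<^bsub>Q\<^esub> x"
    by (simp_all add: add_Q free_add Groups.add.commute)
next
  fix x assume "x \<in> carrier Q"
  then obtain r where r: "r \<in> free_algebra" "x = code r" by (meson Q_cases)
  then show "\<zero>\<^bsub>Q\<^esub> \<oplus>\<^bsub>Q\<^esub> x = x" unfolding zero_Q by (simp add: add_Q free_zero)
  show "\<exists>y\<in>carrier Q. y \<oplus>\<^bsub>Q\<^esub> x = \<zero>\<^bsub>Q\<^esub>"
    using r unfolding zero_Q by (intro bexI[of _ "code (- r)"]) (simp_all add: add_Q free_uminus)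
qed (simp add: zero_Q free_zero)

lemma Q_module: "Module.module F Q"
proof (rule Module.moduleI)
  show "cring F" by (rule is_cring)
  show "abelian_group Q" by (rule Q_abelian_group)
  fix a b x y assume ab: "a \<in> carrier F" "b \<in> carrier F" and "x \<in> carrier Q" "y \<in> carrier Q"
  then obtain r s where *: "r \<in> free_algebra" "s \<in> free_algebra" "x = code r" "y = code s"
    by (meson Q_cases)
  obtain p q where pq: "ev p = a" "ev q = b" using ab ev_surj by metis
  note eqs = smult_Q[of _ p a] smult_Q[of _ q b] smult_Q[of _ "p + q" "a \<oplus> b"] smult_Q[of _ "p * q" "a \<otimes> b"]
  show "(a \<oplus> b) \<odot>\<^bsub>Q\<^esub> x = a \<odot>\<^bsub>Q\<^esub> x \<oplus>\<^bsub>Q\<^esub> b \<odot>\<^bsub>Q\<^esub> x"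
    using * pq by (simp add: eqs ev_add add_Q free_scalar single_add distrib_right)
  show "a \<odot>\<^bsub>Q\<^esub> (x \<oplus>\<^bsub>Q\<^esub> y) = a \<odot>\<^bsub>Q\<^esub> x \<oplus>\<^bsub>Q\<^esub> a \<odot>\<^bsub>Q\<^esub> y"
    using * pq by (simp add: eqs add_Q free_scalar free_add distrib_left)
  have "scalar (p * q) * r = scalar p * (scalar q * r)" by (simp add: single_times_single flip: mult.assoc)
  then show "a \<otimes> b \<odot>\<^bsub>Q\<^esub> x = a \<odot>\<^bsub>Q\<^esub> (b \<odot>\<^bsub>Q\<^esub> x)"
    using * pq by (simp add: eqs ev_mult free_scalar)
next
  fix a x assume "a \<in> carrier F" "x \<in> carrier Q"
  then obtain r p where *: "r \<in> free_algebra" "x = code r" "ev p = a" by (meson Q_cases ev_surj)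
  then show "a \<odot>\<^bsub>Q\<^esub> x \<in> carrier Q" by (simp add: smult_Q[of _ p] free_scalar)
next
  fix x assume "x \<in> carrier Q"
  then obtain r where "r \<in> free_algebra" "x = code r" by (meson Q_cases)
  then show "\<one> \<odot>\<^bsub>Q\<^esub> x = x" by (simp add: smult_Q[of _ 1] ev_one scalar_1)
qed

lemma Q_algebra: "nonunital_algebra F Q"
proof (intro nonunital_algebra.intro vectorspace.intro Q_module nonunital_algebra_axioms.intro)
  show "field F" by (rule field_axioms)
  fix x y assume "x \<in> carrier Q" "y \<in> carrier Q"
  then obtain r s where rs: "r \<in> free_algebra" "s \<in> free_algebra" "x = code r" "y = code s"
    by (meson Q_cases)
  then show "x \<otimes>\<^bsub>Q\<^esub> y \<in> carrier Q" by (simp add: mult_Q free_mult)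
  { fix z assume "z \<in> carrier Q"
    then obtain t where t: "t \<in> free_algebra" "z = code t" by (meson Q_cases)
    show "(x \<otimes>\<^bsub>Q\<^esub> y) \<otimes>\<^bsub>Q\<^esub> z = x \<otimes>\<^bsub>Q\<^esub> (y \<otimes>\<^bsub>Q\<^esub> z)"
      using rs t by (simp add: mult_Q free_mult mult.assoc)
    show "(x \<oplus>\<^bsub>Q\<^esub> y) \<otimes>\<^bsub>Q\<^esub> z = x \<otimes>\<^bsub>Q\<^esub> z \<oplus>\<^bsub>Q\<^esub> y \<otimes>\<^bsub>Q\<^esub> z"
      using rs t by (simp add: mult_Q add_Q free_mult free_add distrib_right)
    show "z \<otimes>\<^bsub>Q\<^esub> (x \<oplus>\<^bsub>Q\<^esub> y) = z \<otimes>\<^bsub>Q\<^esub> x \<oplus>\<^bsub>Q\<^esub> z \<otimes>\<^bsub>Q\<^esub> y"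
      using rs t by (simp add: mult_Q add_Q free_mult free_add distrib_left) }
  fix c assume "c \<in> carrier F"
  then obtain p where p: "ev p = c" using ev_surj by blast
  show "(c \<odot>\<^bsub>Q\<^esub> x) \<otimes>\<^bsub>Q\<^esub> y = c \<odot>\<^bsub>Q\<^esub> (x \<otimes>\<^bsub>Q\<^esub> y)"
    using rs p by (simp add: smult_Q[of _ p] mult_Q free_mult free_scalar mult.assoc)
  have "r * (scalar p * s) = scalar p * (r * s)" by (metis mult.assoc scalar_commute)
  then show "x \<otimes>\<^bsub>Q\<^esub> (c \<odot>\<^bsub>Q\<^esub> y) = c \<odot>\<^bsub>Q\<^esub> (x \<otimes>\<^bsub>Q\<^esub> y)"
    using rs p by (simp add: smult_Q[of _ p] mult_Q free_mult free_scalar)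
qed

interpretation Q: nonunital_algebra F Q by (rule Q_algebra)

definition gen :: "word \<Rightarrow> nat" where "gen w = code (Poly_Mapping.single w 1)"

definition letters :: "nat set" where "letters = (\<lambda>a. gen [a]) ` {0, 1, 2}"

lemma gen_in: "\<lbrakk>w \<noteq> []; ternary w\<rbrakk> \<Longrightarrow> gen w \<in> carrier Q"
  unfolding gen_def by (simp add: free_single)

lemma gen_append: "\<lbrakk>u \<noteq> []; ternary u; v \<noteq> []; ternary v\<rbrakk> \<Longrightarrow> gen u \<otimes>\<^bsub>Q\<^esub> gen v = gen (u @ v)"
  unfolding gen_def by (simp add: mult_Q free_single single_times_single)

lemma smult_gen: "\<lbrakk>w \<noteq> []; ternary w\<rbrakk> \<Longrightarrow> code (Poly_Mapping.single w x) = ev x \<odot>\<^bsub>Q\<^esub> gen w"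
  unfolding gen_def by (simp add: smult_Q[of _ x] free_single single_times_single)

lemma code_sum_single:
  assumes "finite S" "\<And>w. w \<in> S \<Longrightarrow> w \<noteq> [] \<and> ternary w"
  shows "code (\<Sum>w\<in>S. Poly_Mapping.single w (x w)) = (\<Oplus>\<^bsub>Q\<^esub>w\<in>S. ev (x w) \<odot>\<^bsub>Q\<^esub> gen w)"
  using assms
proof (induction S rule: finite_induct)
  case empty
  then show ?case by (simp add: zero_Q)
next
  case (insert w S)
  have "(\<Oplus>\<^bsub>Q\<^esub>w\<in>insert w S. ev (x w) \<odot>\<^bsub>Q\<^esub> gen w)
    = ev (x w) \<odot>\<^bsub>Q\<^esub> gen w \<oplus>\<^bsub>Q\<^esub> (\<Oplus>\<^bsub>Q\<^esub>w\<in>S. ev (x w) \<odot>\<^bsub>Q\<^esub> gen w)"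
    using insert by (intro Q.M.finsum_insert) (auto simp: gen_in ev_closed)
  also have "\<dots> = code (Poly_Mapping.single w (x w)) \<oplus>\<^bsub>Q\<^esub> code (\<Sum>w\<in>S. Poly_Mapping.single w (x w))"
    using insert by (simp add: smult_gen)
  also have "\<dots> = code (\<Sum>w\<in>insert w S. Poly_Mapping.single w (x w))"
    using insert by (subst add_Q) (auto intro!: free_single free_sum)
  finally show ?case by simp
qed

lemma code_in_submodule:
  assumes N: "LinearCombinations.submodule F N Q" and S: "finite S"
    and "\<And>w. w \<in> S \<Longrightarrow> w \<noteq> [] \<and> ternary w" "\<And>w. w \<in> S \<Longrightarrow> gen w \<in> N"
  shows "code (\<Sum>w\<in>S. Poly_Mapping.single w (x w)) \<in> N"
  using S assms(3,4)
proof (induction S rule: finite_induct)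
  case empty
  then show ?case using N by (simp add: LinearCombinations.submodule_def zero_Q)
next
  case (insert w S)
  have "code (\<Sum>w\<in>insert w S. Poly_Mapping.single w (x w))
    = ev (x w) \<odot>\<^bsub>Q\<^esub> gen w \<oplus>\<^bsub>Q\<^esub> code (\<Sum>w\<in>S. Poly_Mapping.single w (x w))"
    using insert by (simp add: smult_gen[symmetric] add_Q free_single free_sum)
  moreover have "ev (x w) \<odot>\<^bsub>Q\<^esub> gen w \<in> N" "code (\<Sum>w\<in>S. Poly_Mapping.single w (x w)) \<in> N"
    using N insert ev_closed by (auto simp: LinearCombinations.submodule_def)
  ultimately show ?case using N by (simp add: LinearCombinations.submodule_def)
qed

lemma ternary_Cons: "ternary (a # w) \<longleftrightarrow> a \<in> {0, 1, 2} \<and> ternary w"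
  by (auto simp: ternary_def)

lemma letters_in: "letters \<subseteq> carrier Q"
  unfolding letters_def by (auto intro!: gen_in simp: ternary_def)

lemma generated_by_letters: "Q.generated_by letters"
  unfolding Q.generated_by_def
proof (intro conjI allI impI letters_in)
  fix B assume B: "Q.is_subalgebra B \<and> letters \<subseteq> B"
  have sub: "LinearCombinations.submodule F B Q"
    using B by (simp add: Q.is_subalgebra_def VectorSpace.subspace_def)
  have gen: "gen w \<in> B" if "w \<noteq> []" "ternary w" for w
    using that
  proof (induction w)
    case (Cons a w)
    have a: "gen [a] \<in> B" using Cons.prems B by (auto simp: letters_def ternary_Cons)
    show ?case
    proof (cases "w = []")
      case False
      then have "gen (a # w) = gen [a] \<otimes>\<^bsub>Q\<^esub> gen w"
        using Cons.prems gen_append[of "[a]" w] by (simp add: ternary_Cons ternary_def)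
      moreover have "gen w \<in> B" using Cons False by (simp add: ternary_Cons)
      ultimately show ?thesis using a B by (simp add: Q.is_subalgebra_def)
    qed (use a in simp)
  qed simp
  show "B = carrier Q"
  proof
    show "B \<subseteq> carrier Q" using sub by (simp add: LinearCombinations.submodule_def)
    show "carrier Q \<subseteq> B"
    proof
      fix y assume "y \<in> carrier Q"
      then obtain r where r: "r \<in> free_algebra" "y = code r" by (meson Q_cases)
      have "code (\<Sum>w\<in>Poly_Mapping.keys r. Poly_Mapping.single w (Poly_Mapping.lookup r w)) \<in> B"
        using r(1) gen by (intro code_in_submodule[OF sub]) (auto simp: free_algebra_def)
      then show "y \<in> B" using r(2) poly_mapping_eq_sum_single[of r] by simp
    qed
  qed
qed

lemma finitely_generated_Q: "Q.finitely_generated"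
  unfolding Q.finitely_generated_def by (intro exI[of _ letters] conjI generated_by_letters) (simp add: letters_def)

lemma product_power:
  assumes "r \<in> free_algebra"
  shows "r ^ Suc k \<in> free_algebra \<and> Q.product (code r) (replicate k (code r)) = code (r ^ Suc k)"
proof (induction k)
  case 0
  then show ?case using assms by (simp add: Q.product_def)
next
  case (Suc k)
  have "Q.product (code r) (replicate (Suc k) (code r))
    = Q.product (code r) (replicate k (code r)) \<otimes>\<^bsub>Q\<^esub> code r"
    by (simp only: Q.product_snoc[symmetric] replicate_append_same replicate_Suc)
  also have "\<dots> = code (r ^ Suc k * r)" using Suc assms by (simp add: mult_Q del: power_Suc)
  finally show ?case using Suc assms by (metis free_mult power_Suc2)
qed

lemma nil_Q:
  assumes "\<And>r. r \<in> free_algebra \<Longrightarrow> \<exists>N. r ^ N \<in> null L"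
  shows "Q.nil_algebra"
  unfolding Q.nil_algebra_def Q.nilpotent_elem_def
proof
  fix x assume "x \<in> carrier Q"
  then obtain r where r: "r \<in> free_algebra" "x = code r" by (meson Q_cases)
  obtain N where "r ^ N \<in> null L" using assms[OF r(1)] by blast
  then have "r ^ Suc N \<in> null L" using null_mult_left[OF closed] by simp
  then show "\<exists>k. Q.product x (replicate k x) = \<zero>\<^bsub>Q\<^esub>"
    using product_power[OF r(1), of N] r(2) code_zero_iff by metis
qed

lemma product_letters:
  assumes "v \<in> letters" "set xs \<subseteq> letters"
  shows "\<exists>w. ternary w \<and> length w = Suc (length xs) \<and> Q.product v xs = gen w"
  using assms(2)
proof (induction xs rule: rev_induct)
  case Nil
  from assms(1) obtain a where "v = gen [a]" "a \<in> {0, 1, 2}" by (auto simp: letters_def)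
  then show ?case by (intro exI[of _ "[a]"]) (simp add: Q.product_def ternary_def)
next
  case (snoc x xs)
  then obtain w where w: "ternary w" "length w = Suc (length xs)" "Q.product v xs = gen w" by auto
  obtain a where a: "x = gen [a]" "a \<in> {0, 1, 2}" using snoc.prems by (auto simp: letters_def)
  have "w \<noteq> []" using w(2) by auto
  then have "Q.product v (xs @ [x]) = gen (w @ [a])"
    using w a by (simp add: Q.product_snoc gen_append ternary_def)
  then show ?case using w a by (intro exI[of _ "w @ [a]"]) (auto simp: ternary_def)
qed

lemma gen_product: "\<lbrakk>w \<noteq> []; ternary w\<rbrakk> \<Longrightarrow> \<exists>v xs. v \<in> letters \<and> set xs \<subseteq> letters \<and> Suc (length xs) = length w \<and>
   gen w = Q.product v xs"
proof (induction w rule: rev_induct)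
  case (snoc a w)
  have a: "gen [a] \<in> letters" using snoc.prems by (auto simp: letters_def ternary_def)
  show ?case
  proof (cases "w = []")
    case True
    then show ?thesis using a by (intro exI[of _ "gen [a]"] exI[of _ "[]"]) (simp add: Q.product_def)
  next
    case False
    then obtain v xs where vx: "v \<in> letters" "set xs \<subseteq> letters" "Suc (length xs) = length w" "gen w = Q.product v xs"
      using snoc by (auto simp: ternary_def)
    have "gen (w @ [a]) = gen w \<otimes>\<^bsub>Q\<^esub> gen [a]"
      using False snoc.prems by (subst gen_append) (auto simp: ternary_def)
    then show ?thesis using vx a
      by (intro exI[of _ v] exI[of _ "xs @ [gen [a]]"]) (simp add: Q.product_snoc)
  qed
qed simp

text \<open>A product of at most \<open>n\<close> letters is the image of a word of length at most \<open>n\<close>.\<close>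

lemma power_space_upper:
  assumes S: "finite S" "\<And>q. q \<in> S \<Longrightarrow> q \<noteq> [] \<and> ternary q"
    and spans: "\<And>w. \<lbrakk>w \<noteq> []; ternary w; length w \<le> n\<rbrakk> \<Longrightarrow> \<exists>c. \<forall>f\<in>L. ev (f w - (\<Sum>q\<in>S. c q * f q)) = \<zero>"
  shows "Q.power_space letters n \<subseteq> Q.span (gen ` S)"
proof -
  have gS: "gen ` S \<subseteq> carrier Q" using S(2) gen_in by auto
  have sub: "LinearCombinations.submodule F (Q.span (gen ` S)) Q" by (rule Q.span_is_submodule[OF gS])
  have "gen w \<in> Q.span (gen ` S)" if w: "w \<noteq> []" "ternary w" "length w \<le> n" for w
  proof -
    obtain c where c: "\<forall>f\<in>L. ev (f w - (\<Sum>q\<in>S. c q * f q)) = \<zero>" using spans[OF w] by blast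
    have "Poly_Mapping.single w 1 - (\<Sum>q\<in>S. Poly_Mapping.single q (c q)) \<in> null L"
      using c by (auto simp: null_def pairing_diff pairing_sum)
    then have "gen w = code (\<Sum>q\<in>S. Poly_Mapping.single q (c q))"
      unfolding gen_def using w S(2) by (subst code_eq) (auto intro!: free_single free_sum)
    moreover have "code (\<Sum>q\<in>S. Poly_Mapping.single q (c q)) \<in> Q.span (gen ` S)"
      using S Q.in_own_span[OF gS] by (intro code_in_submodule[OF sub]) auto
    ultimately show ?thesis by simp
  qed
  then have "Q.words_in letters n \<subseteq> Q.span (gen ` S)"
    using product_letters by (smt (verit) length_0_conv mem_Collect_eq nat.distinct(1) subsetI)
  then show ?thesis unfolding Q.power_space_def by (rule Q.span_is_subset[OF _ sub])
qed

text \<open>A relation between the images of words is a relation between the words modulo the annihilated ideal.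
  Applied to the difference of two words, this shows first that they have different images.\<close>

lemma independent_generators:
  assumes ind: "indep L S" and S: "\<And>q. q \<in> S \<Longrightarrow> q \<noteq> [] \<and> ternary q \<and> length q \<le> n"
  shows "card (gen ` S) = card S" "finite (gen ` S)" "gen ` S \<subseteq> Q.power_space letters n" "Q.lin_indpt (gen ` S)"
proof -
  have fin: "finite S" using ind by (rule indep_finite)
  then show fg: "finite (gen ` S)" by simp
  have zero: "ev (x q) = \<zero>" if "code (\<Sum>q\<in>S. Poly_Mapping.single q (x q)) = \<zero>\<^bsub>Q\<^esub>" "q \<in> S" for x q
  proof -
    have "(\<Sum>q\<in>S. Poly_Mapping.single q (x q)) \<in> null L"
      using that(1) S by (subst (asm) code_zero_iff) (auto intro!: free_single free_sum)
    then have "ev (\<Sum>q\<in>S. x q * f q) = \<zero>" if "f \<in> L" for f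
      using that by (simp add: null_def pairing_sum)
    then show ?thesis using indepD[OF ind] that(2) by blast
  qed
  have inj: "inj_on gen S"
  proof (rule inj_onI, rule ccontr)
    fix q q' assume q: "q \<in> S" "q' \<in> S" "gen q = gen q'" "q \<noteq> q'"
    define x :: "word \<Rightarrow> 'k" where "x p = of_bool (p = q) - of_bool (p = q')" for p
    have "(\<Sum>p\<in>S. Poly_Mapping.single p (x p))
      = (\<Sum>p\<in>S. (if p = q then Poly_Mapping.single q 1 else 0) - (if p = q' then Poly_Mapping.single q' 1 else 0))"
      by (intro sum.cong refl) (auto simp: x_def single_uminus)
    also have "\<dots> = Poly_Mapping.single q 1 - Poly_Mapping.single q' 1"
      using q fin by (simp add: sum_subtractf)
    also have "code \<dots> = \<zero>\<^bsub>Q\<^esub>"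
    proof -
      have f: "Poly_Mapping.single q 1 \<in> free_algebra" "Poly_Mapping.single q' 1 \<in> free_algebra"
        using q S by (auto intro!: free_single)
      then have "Poly_Mapping.single q 1 - Poly_Mapping.single q' 1 \<in> null L"
        using code_eq q(3) unfolding gen_def by blast
      moreover have "Poly_Mapping.single q 1 - Poly_Mapping.single q' (1 :: 'k) \<in> free_algebra"
        using free_add[OF f(1) free_uminus[OF f(2)]] by simp
      ultimately show ?thesis by (simp add: code_zero_iff)
    qed
    finally have "ev (x q) = \<zero>" using q(1) by (rule zero)
    then show False using q(4) ev_one by (simp add: x_def)
  qed
  then show "card (gen ` S) = card S" by (rule card_image)
  have lc: "letters \<subseteq> carrier Q" by (rule letters_in)
  show "gen ` S \<subseteq> Q.power_space letters n"
  proof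
    fix y assume "y \<in> gen ` S"
    then obtain q where q: "q \<in> S" "y = gen q" by blast
    obtain v xs where "v \<in> letters" "set xs \<subseteq> letters" "Suc (length xs) = length q" "gen q = Q.product v xs"
      using gen_product[of q] S[OF q(1)] by blast
    then have "y \<in> Q.words_in letters n" using q S[OF q(1)] by force
    then show "y \<in> Q.power_space letters n" using Q.words_in_power_space[OF lc] by blast
  qed
  have gc: "gen ` S \<subseteq> carrier Q" using S gen_in by auto
  show "Q.lin_indpt (gen ` S)"
  proof (rule Q.finite_lin_indpt2[OF fg gc])
    fix a assume a: "a \<in> gen ` S \<rightarrow> carrier F" "Q.lincomb a (gen ` S) = \<zero>\<^bsub>Q\<^esub>"
    define x where "x q = lift (a (gen q))" for q
    have x: "ev (x q) = a (gen q)" if "q \<in> S" for q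
      unfolding x_def using a(1) that by (intro ev_lift) auto
    have gc': "(\<lambda>q. a (gen q) \<odot>\<^bsub>Q\<^esub> gen q) \<in> S \<rightarrow> carrier Q"
      using a(1) gc by (intro Pi_I Q.smult_closed) auto
    have "code (\<Sum>q\<in>S. Poly_Mapping.single q (x q)) = (\<Oplus>\<^bsub>Q\<^esub>q\<in>S. ev (x q) \<odot>\<^bsub>Q\<^esub> gen q)"
      using fin S by (intro code_sum_single) auto
    also have "\<dots> = (\<Oplus>\<^bsub>Q\<^esub>q\<in>S. a (gen q) \<odot>\<^bsub>Q\<^esub> gen q)"
      using x by (intro Q.M.finsum_cong' gc') simp_all
    also have "\<dots> = (\<Oplus>\<^bsub>Q\<^esub>v\<in>gen ` S. a v \<odot>\<^bsub>Q\<^esub> v)"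
      using inj gc' by (subst Q.M.finsum_reindex) auto
    also have "\<dots> = \<zero>\<^bsub>Q\<^esub>" using a(2) by (simp add: Q.lincomb_def)
    finally show "\<forall>v\<in>gen ` S. a v = \<zero>" using zero x by fastforce
  qed
qed

lemma GKdim_Q:
  fixes d :: real
  assumes d: "0 \<le> d"
    and upper: "\<And>\<alpha>. d < \<alpha> \<Longrightarrow> spanned_within L \<alpha>"
    and lower: "\<And>\<alpha>. indep_within L \<alpha> \<Longrightarrow> d \<le> \<alpha>"
  shows "Q.GKdim = ereal d"
proof (rule Q.GKdim_eqI[OF _ generated_by_letters d])
  show "finite letters" by (simp add: letters_def)
next
  fix \<alpha> assume "d < \<alpha>"
  then obtain C where C: "\<And>n. 1 \<le> n \<Longrightarrow> \<exists>S. finite S \<and> (\<forall>q\<in>S. q \<noteq> [] \<and> ternary q) \<and> card S \<le> C * real n powr \<alpha> \<and>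
      (\<forall>w. w \<noteq> [] \<and> ternary w \<and> length w \<le> n \<longrightarrow> (\<exists>c. \<forall>f\<in>L. ev (f w - (\<Sum>q\<in>S. c q * f q)) = \<zero>))"
    using upper[of \<alpha>] unfolding spanned_within_def by (elim exE meta_impE) auto
  show "\<exists>C. \<forall>n\<ge>1. \<exists>B. finite B \<and> B \<subseteq> carrier Q \<and> card B \<le> C * real n powr \<alpha> \<and>
      Q.power_space letters n \<subseteq> Q.span B"
  proof (intro exI[of _ C] allI impI)
    fix n :: nat assume "1 \<le> n"
    from C[OF this] obtain S where S: "finite S" "\<forall>q\<in>S. q \<noteq> [] \<and> ternary q" "card S \<le> C * real n powr \<alpha>"
      "\<forall>w. w \<noteq> [] \<and> ternary w \<and> length w \<le> n \<longrightarrow> (\<exists>c. \<forall>f\<in>L. ev (f w - (\<Sum>q\<in>S. c q * f q)) = \<zero>)" by blast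
    have "real (card (gen ` S)) \<le> C * real n powr \<alpha>" using card_image_le[OF S(1), of gen] S(3) by linarith
    moreover have "Q.power_space letters n \<subseteq> Q.span (gen ` S)"
      by (rule power_space_upper) (use S in auto)
    moreover have "gen ` S \<subseteq> carrier Q" using S(2) gen_in by auto
    ultimately show "\<exists>B. finite B \<and> B \<subseteq> carrier Q \<and> card B \<le> C * real n powr \<alpha> \<and>
      Q.power_space letters n \<subseteq> Q.span B" using S(1) by (intro exI[of _ "gen ` S"]) simp
  qed
next
  fix \<alpha> C assume *: "\<And>n B. \<lbrakk>1 \<le> n; finite B; B \<subseteq> Q.power_space letters n; Q.lin_indpt B\<rbrakk> \<Longrightarrow> card B \<le> C * real n powr \<alpha>"
  have "card S \<le> C * real n powr \<alpha>"
    if "1 \<le> n" "indep L S" "\<forall>q\<in>S. q \<noteq> [] \<and> ternary q \<and> length q \<le> n" for n S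
    using *[OF that(1), of "gen ` S"] independent_generators[OF that(2), of n] that(3) by simp
  then have "indep_within L \<alpha>" unfolding indep_within_def by (intro exI[of _ C]) blast
  then show "d \<le> \<alpha>" by (rule lower)
qed

end

lemma (in presentation) countable_section:
  assumes "countable (carrier F)"
  obtains D where "countable D" "\<And>x. \<exists>d\<in>D. ev (x - d) = \<zero>"
proof
  show "countable ((\<lambda>c. SOME x. ev x = c) ` carrier F)" using assms by simp
  fix x
  have "ev (SOME y. ev y = ev x) = ev x" by (rule someI) (rule refl)
  then have "ev (x - (SOME y. ev y = ev x)) = \<zero>" by (simp add: ev_diff_zero_iff)
  then show "\<exists>d\<in>(\<lambda>c. SOME x. ev x = c) ` carrier F. ev (x - d) = \<zero>" using ev_closed[of x] by blast
qed

text \<open>The quotient is countable because every class has a representative with coefficients in a countable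
  set.\<close>

lemma (in presentation) code_exists:
  assumes closed: "translation_closed L" and countable: "countable (carrier F)"
  shows "\<exists>code :: (word \<Rightarrow>\<^sub>0 'k) \<Rightarrow> nat. \<forall>r\<in>free_algebra. \<forall>s\<in>free_algebra. code r = code s \<longleftrightarrow> r - s \<in> null L"
proof -
  obtain D where D: "countable D" "\<And>x. \<exists>d\<in>D. ev (x - d) = \<zero>"
    using countable_section[OF countable] by metis
  obtain E where E: "countable E" "\<forall>r :: word \<Rightarrow>\<^sub>0 'k. \<exists>s\<in>E. Poly_Mapping.keys s \<subseteq> Poly_Mapping.keys r \<and>
    (\<forall>w. ev (Poly_Mapping.lookup r w - Poly_Mapping.lookup s w) = \<zero>)"
    using countable_representatives[OF D] by (elim exE conjE)
  define cls where "cls r = {s \<in> free_algebra. r - s \<in> null L}" for r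
  have cls: "cls r = cls s \<longleftrightarrow> r - s \<in> null L" if "r \<in> free_algebra" "s \<in> free_algebra" for r s
  proof
    assume eq: "cls r = cls s"
    have "s \<in> cls r" unfolding eq using that by (simp add: cls_def null_zero)
    then show "r - s \<in> null L" by (simp add: cls_def)
  next
    assume rs: "r - s \<in> null L"
    have "r - t \<in> null L \<longleftrightarrow> s - t \<in> null L" for t
      using null_add[OF rs, of "s - t"] null_diff[OF _ rs, of "r - t"] by auto
    then show "cls r = cls s" by (simp add: cls_def)
  qed
  have "cls ` free_algebra \<subseteq> cls ` (E \<inter> free_algebra)"
  proof
    fix X assume "X \<in> cls ` free_algebra"
    then obtain r where r: "r \<in> free_algebra" "X = cls r" by blast
    obtain s where s: "s \<in> E" "Poly_Mapping.keys s \<subseteq> Poly_Mapping.keys r"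
      "\<forall>w. ev (Poly_Mapping.lookup r w - Poly_Mapping.lookup s w) = \<zero>" using E(2) by blast
    have "s \<in> free_algebra" using r(1) s(2) by (auto simp: free_algebra_def)
    moreover have "r - s \<in> null L"
      unfolding null_def using s(3) by (auto intro!: Z_pairing_coeff simp: lookup_minus)
    ultimately show "X \<in> cls ` (E \<inter> free_algebra)" using cls r s(1) by auto
  qed
  moreover have "countable (cls ` (E \<inter> free_algebra))" using E(1) by (intro countable_image) auto
  ultimately have count: "countable (cls ` free_algebra)" by (rule countable_subset)
  define code where "code r = to_nat_on (cls ` free_algebra) (cls r)" for r
  have "code r = code s \<longleftrightarrow> r - s \<in> null L" if "r \<in> free_algebra" "s \<in> free_algebra" for r s
    unfolding code_def using cls[OF that] inj_on_to_nat_on[OF count] that by (auto dest: inj_onD)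
  then show ?thesis by blast
qed

lemma (in presentation) nil_algebra_exists:
  fixes d :: real
  assumes countable: "countable (carrier F)" and d: "8 \<le> d"
  shows "\<exists>A :: ('f, nat) module. nonunital_algebra F A \<and> nonunital_algebra.finitely_generated F A \<and>
    nonunital_algebra.nil_algebra A \<and> nonunital_algebra.GKdim F A = ereal d"
proof -
  obtain D where D: "countable D" "\<And>x. \<exists>d\<in>D. ev (x - d) = \<zero>"
    using countable_section[OF countable] by metis
  obtain L where L: "translation_closed L"
    "\<forall>r. (\<forall>w\<in>Poly_Mapping.keys r. w \<noteq> [] \<and> ternary w) \<longrightarrow> (\<exists>N. r ^ N \<in> null L)"
    "\<forall>\<alpha>>d. spanned_within L \<alpha>" "\<forall>\<alpha>. indep_within L \<alpha> \<longrightarrow> d \<le> \<alpha>"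
    using functionals_of_dimension[OF D d] by (elim exE conjE)
  obtain code :: "(word \<Rightarrow>\<^sub>0 'k) \<Rightarrow> nat" where
    code: "\<forall>r\<in>free_algebra. \<forall>s\<in>free_algebra. code r = code s \<longleftrightarrow> r - s \<in> null L"
    using code_exists[OF L(1) countable] by blast
  interpret quotient_algebra F ev L code
    by unfold_locales (use L(1) code in auto)
  have "nonunital_algebra.nil_algebra Q" by (rule nil_Q) (use L(2) in \<open>auto simp: free_algebra_def\<close>)
  moreover have "nonunital_algebra.GKdim F Q = ereal d"
    by (rule GKdim_Q) (use d L(3,4) in auto)
  ultimately show ?thesis using Q_algebra finitely_generated_Q by blast
qed

text \<open>The ring type was defined by rings without additional record fields.\<close>

lemma cring_truncate:
  assumes "cring F"
  shows "cring (ring.truncate F)"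
proof -
  interpret cring F by (rule assms)
  have g: "abelian_group (ring.truncate F)"
    by (rule abelian_groupI) (auto simp: ring.truncate_def a_ac intro: add.r_inv_ex add.l_inv_ex)
  have m: "comm_monoid (ring.truncate F)"
    by (rule comm_monoidI) (auto simp: ring.truncate_def m_ac)
  show ?thesis
    by (rule cringI[OF g m]) (auto simp: ring.truncate_def l_distr)
qed

theorem theorem6p1:
  fixes F :: "('f, 'm) ring_scheme" and d :: real
  assumes "field F" and "countable (carrier F)" and "d \<ge> 8"
  shows "\<exists>A :: ('f, nat) module.
           nonunital_algebra F A \<and>
           nonunital_algebra.finitely_generated F A \<and>
           nonunital_algebra.nil_algebra A \<and>
           nonunital_algebra.GKdim F A = ereal d"
proof -
  interpret field F by (rule assms(1))
  have R: "cring (ring.truncate F)" by (rule cring_truncate) (rule is_cring)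
  interpret presentation F "component (ring.truncate F)"
  proof
    fix c assume "c \<in> carrier F"
    then show "\<exists>x. component (ring.truncate F) x = c"
      by (intro component_surj[OF R]) (simp add: ring.truncate_def)
  qed (use component_closed[OF R] component_add[OF R] component_mult[OF R] component_one[OF R]
      in \<open>simp_all add: ring.truncate_def\<close>)
  show ?thesis by (rule nil_algebra_exists) (use assms in auto)
qed

end
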